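(* Let $1\le l\le k$, let $u\in W^{k+l+2,\infty}(\Omega)$ be the solution of $u_t=u_{xx}$, $u(x,0)=u_0(x)$, let $q=u_x$, and let $u_h,q_h\in V_h$ be the solution of the LDG scheme with flux choice (I) or (II). Let $u_I^l,q_I^l\in V_h$ be the interpolation functions corresponding to the flux choice used. Suppose the initial solution is $u_h(\cdot,0)=u_I^l(\cdot,0)$. Then for both the periodic and mixed boundary conditions, $$\|u^l_I-u_h\|_0(t)\lesssim(1+t)\,h^{k+l+1}\|u\|_{k+l+2,\infty},$$ $$\|q^l_I-q_h\|_0(t)\lesssim(1+t^{\frac12})\,h^{k+l+1}\|u\|_{k+l+2,\infty}.$$
   Context: Equation: $u_t=u_{xx}$, $(x,t)\in[0,2\pi]\times(0,T]$, $u(x,0)=u_0(x)$, with $u_0$ sufficiently smooth; $\Omega=[0,2\pi]$. Boundary conditions: periodic, $u(0,t)=u(2\pi,t)$; or mixed, $u(0,t)=g_0(t),\,u_x(2\pi,t)=g_1(t)$, or $u_x(0,t)=g_0(t),\,u(2\pi,t)=g_1(t)$. Norms: $\|\cdot\|_{m,\infty}$ is the $W^{m,\infty}(\Omega)$ norm in $x$, with $\|u\|_{m,\infty}$ taken uniformly in time (supremum over $[0,T]$); $\|\cdot\|_0(t)$ is the $L^2(\Omega)$ norm at time $t$. $A\lesssim B$ means $A\le CB$ with $C$ independent of the mesh size $h$ (and of $t\in[0,T]$). Mesh: $0=x_{\frac12}<\cdots<x_{N+\frac12}=2\pi$, $\tau_j=(x_{j-\frac12},x_{j+\frac12})$, $x_j$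 the midpoint, $h_j=x_{j+\frac12}-x_{j-\frac12}$, $\bar h_j=h_j/2$, $h=\max_jh_j$, quasi-uniform ($h\le ch_j$ for all $j$). $V_h=\{v: v|_{\tau_j}\in P_k(\tau_j),\ 1\le j\le N\}$, $P_k$ the polynomials in $x$ of degree at most $k$ with coefficients that may depend on $t$; $(u,v)_j=\int_{\tau_j}uv\,dx$; $v^\mp|_{j+\frac12}$ are the left/right limits at $x_{j+\frac12}$. LDG scheme: find $u_h,q_h\in V_h$ such that for all $v,w\in V_h$ and all $j$, $(u_{ht},v)_j=-(q_h,v_x)_j+\hat q_hv^-|_{j+\frac12}-\hat q_hv^+|_{j-\frac12}$, $\ (q_h,w)_j=-(u_h,w_x)_j+\hat u_hw^-|_{j+\frac12}-\hat u_hw^+|_{j-\frac12}$. Flux choice (I): $\hat u_h=u_h^-$, $\hat q_h=q_h^+$. Flux choice (II): $\hat u_h=u_h^+$, $\hat q_h=q_h^-$. Both are used for the periodic condition (with periodic identification of one-sided limits at $x_{\frac12}$ and $x_{N+\frac12}$); (I) is used for $u(0,t)=g_0,u_x(2\pi,t)=g_1$ (with $u_h^-|_{\frac12}=g_0$, $q_h^+|_{N+\frac12}=g_1$); (II) is used for $u_x(0,t)=g_0,u(2\pi,t)=g_1$ (with $q_h^-|_{\frac12}=g_0$, $u_h^+|_{N+\frac12}=g_1$). Legendre polynomials: $L_{j,m}(x)=L_m((x-x_j)/\bar h_j)$ on $\tau_j$, $L_m$ standard Legendre. Gauss-Radau projections onto $V_h$: $(P_h^\mp v,w)_j=(v,w)_j$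 for all $w\in P_{k-1}(\tau_j)$, with $P_h^-v(x_{j+\frac12}^-)=v(x_{j+\frac12}^-)$ and $P_h^+v(x_{j-\frac12}^+)=v(x_{j-\frac12}^+)$. $D_s^{-1}v(x)=\frac1{\bar h_j}\int_{x_{j-\frac12}}^xv(x')\,dx'$, $x\in\tau_j$. On each $\tau_j$: $F_{1,1}=P_h^+D_s^{-1}L_{j,k}$, $F_{2,1}=P_h^-D_s^{-1}L_{j,k}$, $F_{1,i+1}=P_h^+D_s^{-1}P_h^-D_s^{-1}F_{1,i}$, $F_{2,i+1}=P_h^-D_s^{-1}P_h^+D_s^{-1}F_{2,i}$ ($i\ge1$), $\bar F_{1,i}=P_h^-D_s^{-1}F_{1,i}$, $\bar F_{2,i}=P_h^+D_s^{-1}F_{2,i}$ ($1\le i\le\lfloor k/2\rfloor$). Coefficients: $\bar v_{j,k}(t)=-v(x^-_{j+\frac12},t)+\frac1{h_j}\int_{\tau_j}v\sum_{m=0}^k(2m+1)L_{j,m}\,dx$, $\ \tilde v_{j,k}(t)=(-1)^{k+1}v(x^+_{j-\frac12},t)+\frac1{h_j}\int_{\tau_j}v\sum_{m=0}^k(-1)^{k+m}(2m+1)L_{j,m}\,dx$. Interpolation functions for choice (I): on $\tau_j$, $G_i=\frac{d^i}{dt^i}\bar u_{j,k}$, $Q_i=\frac{d^i}{dt^i}\tilde q_{j,k}$; $w_{1,i}=\bar h_j^{2i-1}G_iF_{1,i}$, $\bar w_{1,i}=\bar h_j^{2i}G_i\bar F_{1,i}$, $w_{2,i}=\bar h_j^{2i-1}Q_{i-1}F_{2,i}$,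 $\bar w_{2,i}=\bar h_j^{2i}Q_i\bar F_{2,i}$; $W_1^l=\sum_{i=1}^{\lceil l/2\rceil}w_{1,i}+\sum_{i=1}^{\lfloor l/2\rfloor}\bar w_{2,i}$, $W_2^l=\sum_{i=1}^{\lfloor l/2\rfloor}\bar w_{1,i}+\sum_{i=1}^{\lceil l/2\rceil}w_{2,i}$ in each $\tau_j$, with $W_1^l(x^+_{N+\frac12},t)=0$, $W_2^l(x^-_{\frac12},t)=0$; $u_I^l=P_h^-u-W_2^l$, $q_I^l=P_h^+q-W_1^l$. Interpolation functions for choice (II): on $\tau_j$, $G_i=\frac{d^i}{dt^i}\tilde u_{j,k}$, $Q_i=\frac{d^i}{dt^i}\bar q_{j,k}$; $w_{1,i}=\bar h_j^{2i-1}Q_{i-1}F_{1,i}$, $\bar w_{1,i}=\bar h_j^{2i}Q_i\bar F_{1,i}$, $w_{2,i}=\bar h_j^{2i-1}G_iF_{2,i}$, $\bar w_{2,i}=\bar h_j^{2i}G_i\bar F_{2,i}$; $W_1^l=\sum_{i=1}^{\lfloor l/2\rfloor}\bar w_{1,i}+\sum_{i=1}^{\lceil l/2\rceil}w_{2,i}$, $W_2^l=\sum_{i=1}^{\lceil l/2\rceil}w_{1,i}+\sum_{i=1}^{\lfloor l/2\rfloor}\bar w_{2,i}$ in each $\tau_j$, with $W_1^l(x^-_{\frac12},t)=0$, $W_2^l(x^+_{N+\frac12},t)=0$; $u_I^l=P_h^+u-W_2^l$, $q_I^l=P_h^-q-W_1^l$.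
   Formalization: In the periodic case the boundary condition is taken to be u(0,t)=u(2π,t) together with u_x(0,t)=u_x(2π,t); with the first alone the estimate fails, e.g. for u=e^{-t/4}sin(x/2). *)

theory Defs
  imports
    "HOL-Analysis.Analysis"
    "HOL-Computational_Algebra.Polynomial"
    "HOL-Probability.Essential_Supremum"
begin

text \<open>
  A function of space and time is curried as \<open>u x t\<close>.  All derivatives of functions on the closed
  sets \<open>[0, 2\<pi>]\<close> and \<open>[0, T]\<close> are relative to those sets, i.e. one-sided at the end points.
\<close>

definition Omega :: "real set" where
  "Omega = {0..2 * pi}"

definition dx :: "(real \<Rightarrow> real \<Rightarrow> real) \<Rightarrow> real \<Rightarrow> real \<Rightarrow> real" where
  "dx u x t = vector_derivative (\<lambda>y. u y t) (at x within Omega)"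

definition dt :: "real \<Rightarrow> (real \<Rightarrow> real) \<Rightarrow> real \<Rightarrow> real" where
  "dt T f t = vector_derivative f (at t within {0..T})"


section \<open>The spaces \<open>W^{m,\<infinity>}\<close>\<close>

definition test_functions :: "(real \<Rightarrow> real) set" where
  "test_functions = {\<phi>. (\<forall>n x. (deriv ^^ n) \<phi> differentiable at x) \<and>
     compact (closure {x. \<phi> x \<noteq> 0}) \<and> closure {x. \<phi> x \<noteq> 0} \<subseteq> interior Omega}"

definition weak_deriv :: "nat \<Rightarrow> (real \<Rightarrow> real) \<Rightarrow> (real \<Rightarrow> real) \<Rightarrow> bool" where
  "weak_deriv i v g \<longleftrightarrow>
     integrable (lebesgue_on Omega) v \<and> integrable (lebesgue_on Omega) g \<and>
     (\<forall>\<phi>\<in>test_functions.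
        integral\<^sup>L (lebesgue_on Omega) (\<lambda>x. v x * (deriv ^^ i) \<phi> x)
        = (- 1) ^ i * integral\<^sup>L (lebesgue_on Omega) (\<lambda>x. g x * \<phi> x))"

definition Linf_norm :: "(real \<Rightarrow> real) \<Rightarrow> ereal" where
  "Linf_norm g = esssup (lebesgue_on Omega) (\<lambda>x. ereal \<bar>g x\<bar>)"

text \<open>Weak derivatives are unique almost everywhere, so the choice made by \<open>SOME\<close> does not matter.\<close>

definition Winf_norm :: "nat \<Rightarrow> (real \<Rightarrow> real) \<Rightarrow> ereal" where
  "Winf_norm m v =
     (if \<forall>i\<le>m. \<exists>g. weak_deriv i v g
      then MAX i\<in>{..m}. Linf_norm (SOME g. weak_deriv i v g)
      else \<infinity>)"

definition Winf_norm_unif :: "real \<Rightarrow> nat \<Rightarrow> (real \<Rightarrow> real \<Rightarrow> real) \<Rightarrow> ereal" where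
  "Winf_norm_unif T m u = (SUP t\<in>{0..T}. Winf_norm m (\<lambda>x. u x t))"

definition L2_norm_Omega :: "(real \<Rightarrow> real) \<Rightarrow> real" where
  "L2_norm_Omega v = sqrt (integral Omega (\<lambda>x. (v x)\<^sup>2))"


section \<open>The initial boundary value problem\<close>

definition heat_solution :: "real \<Rightarrow> (real \<Rightarrow> real) \<Rightarrow> (real \<Rightarrow> real \<Rightarrow> real) \<Rightarrow> bool" where
  "heat_solution T u0 u \<longleftrightarrow>
     continuous_on (Omega \<times> {0..T}) (\<lambda>(x, t). u x t) \<and>
     (\<forall>x\<in>Omega. u x 0 = u0 x) \<and>
     (\<forall>x\<in>Omega. \<forall>t\<in>{0<..T}.
        (\<lambda>y. u y t) differentiable (at x within Omega) \<and>
        (\<lambda>y. dx u y t) differentiable (at x within Omega) \<and>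
        (u x has_real_derivative dx (dx u) x t) (at t within {0..T}))"

datatype flux = Flux_I | Flux_II

text \<open>
  The kind of mixed condition is determined by the flux choice it is discretised with:
  Dirichlet at \<open>0\<close> and Neumann at \<open>2\<pi>\<close> for choice (I), the other way round for choice (II).
\<close>

datatype bc = Periodic | Mixed "real \<Rightarrow> real" "real \<Rightarrow> real"

text \<open>
  Periodicity of the second-order problem means that both \<open>u\<close> and \<open>u\<^sub>x\<close> match at the end points.
\<close>

fun boundary_condition :: "flux \<Rightarrow> bc \<Rightarrow> real \<Rightarrow> (real \<Rightarrow> real \<Rightarrow> real) \<Rightarrow> bool" where
  "boundary_condition _ Periodic T u \<longleftrightarrow>
     (\<forall>t\<in>{0..T}. u 0 t = u (2 * pi) t \<and> dx u 0 t = dx u (2 * pi) t)"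
| "boundary_condition Flux_I (Mixed g0 g1) T u \<longleftrightarrow>
     (\<forall>t\<in>{0..T}. u 0 t = g0 t \<and> dx u (2 * pi) t = g1 t)"
| "boundary_condition Flux_II (Mixed g0 g1) T u \<longleftrightarrow>
     (\<forall>t\<in>{0..T}. dx u 0 t = g0 t \<and> u (2 * pi) t = g1 t)"


section \<open>Meshes\<close>

text \<open>
  The nodes \<open>x\<^sub>1\<^sub>/\<^sub>2, \<dots>, x\<^sub>N\<^sub>+\<^sub>1\<^sub>/\<^sub>2\<close> are \<open>xs 0, \<dots>, xs N\<close>, and the cells are numbered from \<open>0\<close>:
  \<open>cell xs j\<close> for \<open>j < N\<close> is the classical \<open>\<tau>\<^sub>j\<^sub>+\<^sub>1\<close>.
\<close>

definition cell :: "(nat \<Rightarrow> real) \<Rightarrow> nat \<Rightarrow> real set" where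
  "cell xs j = {xs j <..< xs (Suc j)}"

definition midpt :: "(nat \<Rightarrow> real) \<Rightarrow> nat \<Rightarrow> real" where
  "midpt xs j = (xs j + xs (Suc j)) / 2"

definition cell_size :: "(nat \<Rightarrow> real) \<Rightarrow> nat \<Rightarrow> real" where
  "cell_size xs j = xs (Suc j) - xs j"

definition half_size :: "(nat \<Rightarrow> real) \<Rightarrow> nat \<Rightarrow> real" where
  "half_size xs j = cell_size xs j / 2"

definition mesh_size :: "nat \<Rightarrow> (nat \<Rightarrow> real) \<Rightarrow> real" where
  "mesh_size N xs = (MAX j\<in>{..<N}. cell_size xs j)"

definition mesh :: "nat \<Rightarrow> (nat \<Rightarrow> real) \<Rightarrow> bool" where
  "mesh N xs \<longleftrightarrow> 0 < N \<and> xs 0 = 0 \<and> xs N = 2 * pi \<and> (\<forall>j<N. xs j < xs (Suc j))"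

definition quasi_uniform :: "real \<Rightarrow> nat \<Rightarrow> (nat \<Rightarrow> real) \<Rightarrow> bool" where
  "quasi_uniform c N xs \<longleftrightarrow> (\<forall>j<N. mesh_size N xs \<le> c * cell_size xs j)"

definition dg_space :: "nat \<Rightarrow> nat \<Rightarrow> (nat \<Rightarrow> real) \<Rightarrow> (real \<Rightarrow> real) set" where
  "dg_space k N xs =
     {v. \<forall>j<N. \<exists>p :: real poly. degree p \<le> k \<and> (\<forall>x\<in>cell xs j. v x = poly p x)}"


section \<open>The LDG scheme\<close>

definition trace_left :: "(nat \<Rightarrow> real) \<Rightarrow> (real \<Rightarrow> real) \<Rightarrow> nat \<Rightarrow> real" where
  "trace_left xs v i = Lim (at_left (xs i)) v"

definition trace_right :: "(nat \<Rightarrow> real) \<Rightarrow> (real \<Rightarrow> real) \<Rightarrow> nat \<Rightarrow> real" where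
  "trace_right xs v i = Lim (at_right (xs i)) v"

text \<open>
  Numerical fluxes at node \<open>i \<le> N\<close> and time \<open>t\<close>.  The traces from outside the domain (the left one
  at node \<open>0\<close>, the right one at node \<open>N\<close>) come from periodicity or from the boundary data.
\<close>

fun u_hat :: "flux \<Rightarrow> bc \<Rightarrow> nat \<Rightarrow> (nat \<Rightarrow> real) \<Rightarrow> (real \<Rightarrow> real \<Rightarrow> real) \<Rightarrow> nat \<Rightarrow> real \<Rightarrow> real" where
  "u_hat Flux_I b N xs uh i t =
     (if i = 0
      then (case b of Periodic \<Rightarrow> trace_left xs (\<lambda>x. uh x t) N | Mixed g0 g1 \<Rightarrow> g0 t)
      else trace_left xs (\<lambda>x. uh x t) i)"
| "u_hat Flux_II b N xs uh i t =
     (if i = N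
      then (case b of Periodic \<Rightarrow> trace_right xs (\<lambda>x. uh x t) 0 | Mixed g0 g1 \<Rightarrow> g1 t)
      else trace_right xs (\<lambda>x. uh x t) i)"

fun q_hat :: "flux \<Rightarrow> bc \<Rightarrow> nat \<Rightarrow> (nat \<Rightarrow> real) \<Rightarrow> (real \<Rightarrow> real \<Rightarrow> real) \<Rightarrow> nat \<Rightarrow> real \<Rightarrow> real" where
  "q_hat Flux_I b N xs qh i t =
     (if i = N
      then (case b of Periodic \<Rightarrow> trace_right xs (\<lambda>x. qh x t) 0 | Mixed g0 g1 \<Rightarrow> g1 t)
      else trace_right xs (\<lambda>x. qh x t) i)"
| "q_hat Flux_II b N xs qh i t =
     (if i = 0
      then (case b of Periodic \<Rightarrow> trace_left xs (\<lambda>x. qh x t) N | Mixed g0 g1 \<Rightarrow> g0 t)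
      else trace_left xs (\<lambda>x. qh x t) i)"

definition ldg_solution ::
  "nat \<Rightarrow> nat \<Rightarrow> (nat \<Rightarrow> real) \<Rightarrow> flux \<Rightarrow> bc \<Rightarrow> real
    \<Rightarrow> (real \<Rightarrow> real \<Rightarrow> real) \<Rightarrow> (real \<Rightarrow> real \<Rightarrow> real) \<Rightarrow> bool" where
  "ldg_solution k N xs fl b T uh qh \<longleftrightarrow>
     (\<forall>t\<in>{0..T}. (\<lambda>x. uh x t) \<in> dg_space k N xs \<and> (\<lambda>x. qh x t) \<in> dg_space k N xs) \<and>
     (\<forall>j<N. \<forall>x\<in>cell xs j. uh x differentiable_on {0..T}) \<and>
     (\<forall>t\<in>{0..T}. \<forall>v\<in>dg_space k N xs. \<forall>w\<in>dg_space k N xs. \<forall>j<N.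
        integral (cell xs j) (\<lambda>x. dt T (uh x) t * v x)
        = - integral (cell xs j) (\<lambda>x. qh x t * deriv v x)
          + q_hat fl b N xs qh (Suc j) t * trace_left xs v (Suc j)
          - q_hat fl b N xs qh j t * trace_right xs v j \<and>
        integral (cell xs j) (\<lambda>x. qh x t * w x)
        = - integral (cell xs j) (\<lambda>x. uh x t * deriv w x)
          + u_hat fl b N xs uh (Suc j) t * trace_left xs w (Suc j)
          - u_hat fl b N xs uh j t * trace_right xs w j)"


section \<open>Legendre polynomials, projections and interpolation functions\<close>

text \<open>Rodrigues' formula.\<close>

definition legendre_poly :: "nat \<Rightarrow> real poly" where
  "legendre_poly m = smult (1 / (2 ^ m * fact m)) ((pderiv ^^ m) ([:-1, 0, 1:] ^ m))"

definition legendre_cell :: "(nat \<Rightarrow> real) \<Rightarrow> nat \<Rightarrow> nat \<Rightarrow> real \<Rightarrow> real" where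
  "legendre_cell xs j m x = poly (legendre_poly m) ((x - midpt xs j) / half_size xs j)"

text \<open>
  The operators below act on one cell \<open>j\<close>.  Their results are functions on all of \<open>real\<close>, of which only
  the restriction to that cell is meaningful; \<open>radau_minus\<close> and \<open>radau_plus\<close> are \<open>P\<^sub>h\<^sup>-\<close>
  and \<open>P\<^sub>h\<^sup>+\<close>.
\<close>

definition radau_minus :: "nat \<Rightarrow> (nat \<Rightarrow> real) \<Rightarrow> nat \<Rightarrow> (real \<Rightarrow> real) \<Rightarrow> real \<Rightarrow> real" where
  "radau_minus k xs j v = poly (THE p. degree p \<le> k \<and>
     (\<forall>w. degree w \<le> k - 1 \<longrightarrow>
        integral (cell xs j) (\<lambda>x. poly p x * poly w x) = integral (cell xs j) (\<lambda>x. v x * poly w x)) \<and>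
     poly p (xs (Suc j)) = trace_left xs v (Suc j))"

definition radau_plus :: "nat \<Rightarrow> (nat \<Rightarrow> real) \<Rightarrow> nat \<Rightarrow> (real \<Rightarrow> real) \<Rightarrow> real \<Rightarrow> real" where
  "radau_plus k xs j v = poly (THE p. degree p \<le> k \<and>
     (\<forall>w. degree w \<le> k - 1 \<longrightarrow>
        integral (cell xs j) (\<lambda>x. poly p x * poly w x) = integral (cell xs j) (\<lambda>x. v x * poly w x)) \<and>
     poly p (xs j) = trace_right xs v j)"

definition Ds_inv :: "(nat \<Rightarrow> real) \<Rightarrow> nat \<Rightarrow> (real \<Rightarrow> real) \<Rightarrow> real \<Rightarrow> real" where
  "Ds_inv xs j v x = 1 / half_size xs j * integral {xs j..x} v"

text \<open>\<open>F1 k xs j i\<close> and its companions are meant for \<open>i \<ge> 1\<close>.\<close>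

definition F1 :: "nat \<Rightarrow> (nat \<Rightarrow> real) \<Rightarrow> nat \<Rightarrow> nat \<Rightarrow> real \<Rightarrow> real" where
  "F1 k xs j i =
     ((\<lambda>F. radau_plus k xs j (Ds_inv xs j (radau_minus k xs j (Ds_inv xs j F)))) ^^ (i - 1))
       (radau_plus k xs j (Ds_inv xs j (legendre_cell xs j k)))"

definition F2 :: "nat \<Rightarrow> (nat \<Rightarrow> real) \<Rightarrow> nat \<Rightarrow> nat \<Rightarrow> real \<Rightarrow> real" where
  "F2 k xs j i =
     ((\<lambda>F. radau_minus k xs j (Ds_inv xs j (radau_plus k xs j (Ds_inv xs j F)))) ^^ (i - 1))
       (radau_minus k xs j (Ds_inv xs j (legendre_cell xs j k)))"

definition F1_bar :: "nat \<Rightarrow> (nat \<Rightarrow> real) \<Rightarrow> nat \<Rightarrow> nat \<Rightarrow> real \<Rightarrow> real" where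
  "F1_bar k xs j i = radau_minus k xs j (Ds_inv xs j (F1 k xs j i))"

definition F2_bar :: "nat \<Rightarrow> (nat \<Rightarrow> real) \<Rightarrow> nat \<Rightarrow> nat \<Rightarrow> real \<Rightarrow> real" where
  "F2_bar k xs j i = radau_plus k xs j (Ds_inv xs j (F2 k xs j i))"

definition coeff_bar :: "nat \<Rightarrow> (nat \<Rightarrow> real) \<Rightarrow> nat \<Rightarrow> (real \<Rightarrow> real) \<Rightarrow> real" where
  "coeff_bar k xs j v =
     - trace_left xs v (Suc j)
     + 1 / cell_size xs j *
       integral (cell xs j) (\<lambda>x. v x * (\<Sum>m=0..k. (2 * real m + 1) * legendre_cell xs j m x))"

definition coeff_tilde :: "nat \<Rightarrow> (nat \<Rightarrow> real) \<Rightarrow> nat \<Rightarrow> (real \<Rightarrow> real) \<Rightarrow> real" where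
  "coeff_tilde k xs j v =
     (- 1) ^ (k + 1) * trace_right xs v j
     + 1 / cell_size xs j *
       integral (cell xs j)
         (\<lambda>x. v x * (\<Sum>m=0..k. (- 1) ^ (k + m) * (2 * real m + 1) * legendre_cell xs j m x))"

fun G_coeff :: "flux \<Rightarrow> nat \<Rightarrow> (nat \<Rightarrow> real) \<Rightarrow> real \<Rightarrow> (real \<Rightarrow> real \<Rightarrow> real) \<Rightarrow> nat \<Rightarrow> nat \<Rightarrow> real \<Rightarrow> real" where
  "G_coeff Flux_I k xs T u j i = (dt T ^^ i) (\<lambda>t. coeff_bar k xs j (\<lambda>x. u x t))"
| "G_coeff Flux_II k xs T u j i = (dt T ^^ i) (\<lambda>t. coeff_tilde k xs j (\<lambda>x. u x t))"

fun Q_coeff :: "flux \<Rightarrow> nat \<Rightarrow> (nat \<Rightarrow> real) \<Rightarrow> real \<Rightarrow> (real \<Rightarrow> real \<Rightarrow> real) \<Rightarrow> nat \<Rightarrow> nat \<Rightarrow> real \<Rightarrow> real" where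
  "Q_coeff Flux_I k xs T q j i = (dt T ^^ i) (\<lambda>t. coeff_tilde k xs j (\<lambda>x. q x t))"
| "Q_coeff Flux_II k xs T q j i = (dt T ^^ i) (\<lambda>t. coeff_bar k xs j (\<lambda>x. q x t))"

text \<open>
  The corrections on cell \<open>j\<close>.  Here \<open>\<lceil>l/2\<rceil> = (l + 1) div 2\<close> and \<open>\<lfloor>l/2\<rfloor> = l div 2\<close>.
  The convention that they vanish outside the domain only affects exterior traces, which are not
  needed here.
\<close>

fun W1 :: "flux \<Rightarrow> nat \<Rightarrow> nat \<Rightarrow> (nat \<Rightarrow> real) \<Rightarrow> real
    \<Rightarrow> (real \<Rightarrow> real \<Rightarrow> real) \<Rightarrow> (real \<Rightarrow> real \<Rightarrow> real) \<Rightarrow> nat \<Rightarrow> real \<Rightarrow> real \<Rightarrow> real" where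
  "W1 Flux_I k l xs T u q j x t =
     (\<Sum>i=1..(l + 1) div 2. half_size xs j ^ (2 * i - 1) * G_coeff Flux_I k xs T u j i t * F1 k xs j i x)
   + (\<Sum>i=1..l div 2. half_size xs j ^ (2 * i) * Q_coeff Flux_I k xs T q j i t * F2_bar k xs j i x)"
| "W1 Flux_II k l xs T u q j x t =
     (\<Sum>i=1..l div 2. half_size xs j ^ (2 * i) * Q_coeff Flux_II k xs T q j i t * F1_bar k xs j i x)
   + (\<Sum>i=1..(l + 1) div 2. half_size xs j ^ (2 * i - 1) * G_coeff Flux_II k xs T u j i t * F2 k xs j i x)"

fun W2 :: "flux \<Rightarrow> nat \<Rightarrow> nat \<Rightarrow> (nat \<Rightarrow> real) \<Rightarrow> real
    \<Rightarrow> (real \<Rightarrow> real \<Rightarrow> real) \<Rightarrow> (real \<Rightarrow> real \<Rightarrow> real) \<Rightarrow> nat \<Rightarrow> real \<Rightarrow> real \<Rightarrow> real" where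
  "W2 Flux_I k l xs T u q j x t =
     (\<Sum>i=1..l div 2. half_size xs j ^ (2 * i) * G_coeff Flux_I k xs T u j i t * F1_bar k xs j i x)
   + (\<Sum>i=1..(l + 1) div 2. half_size xs j ^ (2 * i - 1) * Q_coeff Flux_I k xs T q j (i - 1) t * F2 k xs j i x)"
| "W2 Flux_II k l xs T u q j x t =
     (\<Sum>i=1..(l + 1) div 2. half_size xs j ^ (2 * i - 1) * Q_coeff Flux_II k xs T q j (i - 1) t * F1 k xs j i x)
   + (\<Sum>i=1..l div 2. half_size xs j ^ (2 * i) * G_coeff Flux_II k xs T u j i t * F2_bar k xs j i x)"

definition radau_u :: "flux \<Rightarrow> nat \<Rightarrow> (nat \<Rightarrow> real) \<Rightarrow> nat \<Rightarrow> (real \<Rightarrow> real) \<Rightarrow> real \<Rightarrow> real" where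
  "radau_u fl = (case fl of Flux_I \<Rightarrow> radau_minus | Flux_II \<Rightarrow> radau_plus)"

definition radau_q :: "flux \<Rightarrow> nat \<Rightarrow> (nat \<Rightarrow> real) \<Rightarrow> nat \<Rightarrow> (real \<Rightarrow> real) \<Rightarrow> real \<Rightarrow> real" where
  "radau_q fl = (case fl of Flux_I \<Rightarrow> radau_plus | Flux_II \<Rightarrow> radau_minus)"

text \<open>
  The interpolation functions on the union of the cells, with value \<open>0\<close> at the nodes (a null set).
\<close>

definition u_interp :: "flux \<Rightarrow> nat \<Rightarrow> nat \<Rightarrow> nat \<Rightarrow> (nat \<Rightarrow> real) \<Rightarrow> real
    \<Rightarrow> (real \<Rightarrow> real \<Rightarrow> real) \<Rightarrow> real \<Rightarrow> real \<Rightarrow> real" where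
  "u_interp fl k l N xs T u x t =
     (\<Sum>j<N. indicat_real (cell xs j) x *
        (radau_u fl k xs j (\<lambda>y. u y t) x - W2 fl k l xs T u (dx u) j x t))"

definition q_interp :: "flux \<Rightarrow> nat \<Rightarrow> nat \<Rightarrow> nat \<Rightarrow> (nat \<Rightarrow> real) \<Rightarrow> real
    \<Rightarrow> (real \<Rightarrow> real \<Rightarrow> real) \<Rightarrow> real \<Rightarrow> real \<Rightarrow> real" where
  "q_interp fl k l N xs T u x t =
     (\<Sum>j<N. indicat_real (cell xs j) x *
        (radau_q fl k xs j (\<lambda>y. dx u y t) x - W1 fl k l xs T u (dx u) j x t))"

end

theory Submission
  imports Defs "HOL-Real_Asymp.Real_Asymp"
begin

text \<open>
  The corrections of the Gauss--Radau projections are chosen such that in orthonormal coordinates of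
  \<open>V\<^sub>h\<close> the errors \<open>\<alpha>\<close> of \<open>u\<close> and \<open>\<beta>\<close> of \<open>q\<close> solve \<open>\<alpha>' = - d\<^sup>T \<beta> + \<rho>'\<close> and \<open>\<beta> = d \<alpha> + \<gamma>\<close>, where \<open>d\<close> is the discrete
  derivative and \<open>\<rho>\<close>, \<open>\<gamma>\<close> are integrals against the last correction polynomials, of order \<open>h ^ (k + l + 1)\<close>.
  The residual \<open>\<rho>'\<close> itself would cost one more derivative of \<open>u\<close> than is available.  Instead, testing with
  the backward gradient flow \<open>z' = d\<^sup>T d z\<close> and integrating by parts in time bounds \<open>\<alpha>(t)\<close> and \<open>\<beta>(t)\<close> by \<open>\<gamma>\<close>
  and the time increments of \<open>\<rho>\<close> and \<open>\<gamma>\<close>.  For \<open>\<alpha>\<close>, Hoelder continuity of \<open>\<rho>\<close> with exponent \<open>1/2\<close> suffices.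
  For \<open>\<beta>\<close> a little more is needed, which \<open>k + l + 2\<close> bounded derivatives give only away from the parabolic
  boundary: there Bernstein's interior gradient estimates bound further derivatives by powers of the
  inverse distance \<open>r\<close>, and the resulting weight \<open>r powr (-1/2)\<close> is summable over the cells.
\<close>

section \<open>Mixed systems and their dual\<close>

text \<open>A coefficient built from the derivative of order n is of size h^(k+1) only if n + k + 1
  derivatives are bounded, and \<rho>' has n = l + 2: this is the missing derivative. Its primitive
  \<rho> has n = l, and the derivatives to spare become regularity in time through u_t = u_xx. In
  the duality argument for \<beta>, the squared increments of \<rho> divided by s^2 and those of
  \<gamma> divided by s must be integrated over the time lag s. With the global bounds K^2 s and K^2
  both integrands are of size 1/s, a logarithmic divergence at s = 0, so that any positive power of
  s as an additional factor would suffice. In a cell at distance r from the parabolic boundary these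
  bounds gain min(1, s/r^2), which is at most s^(1/4) r^(-1/2). The exponent 1/4 makes the integral
  over s converge and still leaves an integrable singularity in r. The distance to the initial time
  contributes t^(-1/4), which cancels the t^(1/4) produced by that integral; hence no constant
  depends on T or degenerates as t tends to 0.\<close>

lemma linear_ode_exists:
  fixes a :: "'i \<Rightarrow> 'i \<Rightarrow> real"
  assumes fin: "finite I"
  shows "\<exists>z. (\<forall>i\<in>I. z i 0 = p i) \<and>
           (\<forall>i\<in>I. \<forall>s. (z i has_real_derivative - (\<Sum>i'\<in>I. a i i' * z i' s)) (at s))"
proof -
  \<comment> \<open>\<open>v n\<close> is (-a)^n p, and \<open>z\<close> below is the exponential
    series exp(-s a) p, written entry by entry. \<open>L\<close> dominates every row sum of |a|,
    which gives the majorant B exp(L |s|).\<close>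
  define v where "v = rec_nat p (\<lambda>_ w i. - (\<Sum>i'\<in>I. a i i' * w i'))"
  have v0: "v 0 = p" and vS: "\<And>n i. v (Suc n) i = - (\<Sum>i'\<in>I. a i i' * v n i')"
    by (simp_all add: v_def)
  define L where "L = (\<Sum>i\<in>I. \<Sum>i'\<in>I. \<bar>a i i'\<bar>)"
  define B where "B = (\<Sum>i\<in>I. \<bar>p i\<bar>)"
  have B0: "B \<ge> 0" by (simp add: B_def sum_nonneg)
  have L0: "L \<ge> 0" by (simp add: L_def sum_nonneg)
  have bound: "\<bar>v n i\<bar> \<le> B * L ^ n" if "i \<in> I" for n i
    using that
  proof (induction n arbitrary: i)
    case 0
    then show ?case using fin by (auto simp: v0 B_def intro: member_le_sum)
  next
    case (Suc n)
    have row: "(\<Sum>i'\<in>I. \<bar>a i i'\<bar>) \<le> L"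
      unfolding L_def using fin Suc.prems
      by (intro member_le_sum[where f = "\<lambda>i. \<Sum>i'\<in>I. \<bar>a i i'\<bar>"]) (auto intro: sum_nonneg)
    have "\<bar>v (Suc n) i\<bar> \<le> (\<Sum>i'\<in>I. \<bar>a i i'\<bar> * (B * L ^ n))"
      unfolding vS abs_minus
      by (rule order_trans[OF sum_abs]) (auto simp: abs_mult intro!: sum_mono mult_left_mono Suc.IH)
    also have "\<dots> \<le> L * (B * L ^ n)"
      unfolding sum_distrib_right[symmetric] using row B0 L0 by (intro mult_right_mono) auto
    finally show ?case by (simp add: ac_simps)
  qed
  define z where "z = (\<lambda>i s. \<Sum>n. (v n i / fact n) * s ^ n)"
  have summ: "summable (\<lambda>n. (v n i / fact n) * s ^ n)" if "i \<in> I" for i s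
  proof (rule summable_comparison_test')
    show "summable (\<lambda>n. B * ((L * \<bar>s\<bar>) ^ n /\<^sub>R fact n))"
      by (intro summable_mult summable_exp_generic)
    show "norm ((v n i / fact n) * s ^ n) \<le> B * ((L * \<bar>s\<bar>) ^ n /\<^sub>R fact n)" for n
    proof -
      have "norm ((v n i / fact n) * s ^ n) = \<bar>v n i\<bar> * (\<bar>s\<bar> ^ n / fact n)"
        by (simp add: abs_mult power_abs)
      also have "\<dots> \<le> B * L ^ n * (\<bar>s\<bar> ^ n / fact n)"
        by (intro mult_right_mono bound that) auto
      finally show ?thesis by (simp add: power_mult_distrib divide_inverse ac_simps)
    qed
  qed
  have "(z i has_real_derivative - (\<Sum>i'\<in>I. a i i' * z i' s)) (at s)" if "i \<in> I" for i s
  proof -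
    have "(z i has_real_derivative (\<Sum>n. diffs (\<lambda>n. v n i / fact n) n * s ^ n)) (at s)"
      unfolding z_def by (rule termdiffs_strong_converges_everywhere[OF summ[OF that]])
    moreover have "diffs (\<lambda>n. v n i / fact n) n * s ^ n
        = - (\<Sum>i'\<in>I. a i i' * ((v n i' / fact n) * s ^ n))" for n
    proof -
      have "diffs (\<lambda>n. v n i / fact n) n = v (Suc n) i / fact n"
        by (simp add: diffs_def divide_simps)
      also have "\<dots> * s ^ n = - (\<Sum>i'\<in>I. a i i' * ((v n i' / fact n) * s ^ n))"
        by (simp add: vS sum_divide_distrib sum_distrib_left sum_distrib_right mult_ac)
      finally show ?thesis .
    qed
    moreover have "(\<Sum>n. - (\<Sum>i'\<in>I. a i i' * ((v n i' / fact n) * s ^ n)))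
        = - (\<Sum>i'\<in>I. a i i' * z i' s)"
      unfolding z_def
      by (subst suminf_minus, intro summable_sum summable_mult summ, assumption,
          subst suminf_sum, intro summable_mult summ, assumption)
        (intro arg_cong[of _ _ uminus] sum.cong refl suminf_mult summ, assumption)
    ultimately show ?thesis by simp
  qed
  moreover have "z i 0 = p i" for i
    unfolding z_def by (subst powser_zero) (simp add: v0)
  ultimately show ?thesis by blast
qed

definition mat_vec :: "'i set \<Rightarrow> ('i \<Rightarrow> 'i \<Rightarrow> real) \<Rightarrow> ('i \<Rightarrow> real) \<Rightarrow> 'i \<Rightarrow> real" where
  "mat_vec I d x i = (\<Sum>i'\<in>I. d i i' * x i')"

definition dotp :: "'i set \<Rightarrow> ('i \<Rightarrow> real) \<Rightarrow> ('i \<Rightarrow> real) \<Rightarrow> real" where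
  "dotp I x y = (\<Sum>i\<in>I. x i * y i)"

definition transp_mat :: "('i \<Rightarrow> 'i \<Rightarrow> real) \<Rightarrow> 'i \<Rightarrow> 'i \<Rightarrow> real" where
  "transp_mat d i i' = d i' i"

lemma dotp_adjoint: "dotp I x (mat_vec I d y) = dotp I (mat_vec I (transp_mat d) x) y"
proof -
  have "dotp I x (mat_vec I d y) = (\<Sum>i\<in>I. \<Sum>i'\<in>I. x i * (d i i' * y i'))"
    by (simp add: dotp_def mat_vec_def sum_distrib_left)
  also have "\<dots> = (\<Sum>i'\<in>I. \<Sum>i\<in>I. d i i' * x i * y i')"
    by (subst sum.swap) (simp add: mult_ac)
  finally show ?thesis by (simp add: dotp_def mat_vec_def transp_mat_def sum_distrib_right)
qed

lemma dotp_commute: "dotp I x y = dotp I y x"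
  by (simp add: dotp_def mult.commute)

lemma dotp_nonneg: "dotp I x x \<ge> 0"
  by (simp add: dotp_def sum_nonneg)

lemma dotp_diff_left: "dotp I (\<lambda>i. x i - y i) w = dotp I x w - dotp I y w"
  by (simp add: dotp_def algebra_simps sum_subtractf)

lemma dotp_add_left: "dotp I (\<lambda>i. x i + y i) w = dotp I x w + dotp I y w"
  by (simp add: dotp_def algebra_simps sum.distrib)

lemma dotp_minus_left: "dotp I (\<lambda>i. - x i) w = - dotp I x w"
  by (simp add: dotp_def sum_negf)

lemma dotp_minus_right: "dotp I w (\<lambda>i. - x i) = - dotp I w x"
  by (simp add: dotp_def sum_negf)

lemma dotp_young:
  assumes "c > 0"
  shows "\<bar>dotp I x y\<bar> \<le> (c * dotp I x x + dotp I y y / c) / 2"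
proof -
  have "\<bar>x i * y i\<bar> \<le> (c * (x i * x i) + (y i * y i) / c) / 2" for i
  proof -
    have "0 \<le> (c * \<bar>x i\<bar> - \<bar>y i\<bar>)\<^sup>2 / (2 * c)" using assms by simp
    also have "\<dots> = (c * (x i * x i) + (y i * y i) / c) / 2 - \<bar>x i * y i\<bar>"
      using assms by (simp add: power2_eq_square field_simps abs_mult)
    finally show ?thesis by simp
  qed
  then have "\<bar>dotp I x y\<bar> \<le> (\<Sum>i\<in>I. (c * (x i * x i) + (y i * y i) / c) / 2)"
    unfolding dotp_def by (intro order_trans[OF sum_abs] sum_mono)
  also have "\<dots> = (c * dotp I x x + dotp I y y / c) / 2"
    by (simp add: dotp_def sum.distrib sum_distrib_left sum_divide_distrib add_divide_distrib)
  finally show ?thesis .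
qed

lemma has_derivative_dotp:
  assumes "\<And>i. i \<in> I \<Longrightarrow> ((\<lambda>s. x s i) has_real_derivative x' i) (at s within S)"
    and "\<And>i. i \<in> I \<Longrightarrow> ((\<lambda>s. y s i) has_real_derivative y' i) (at s within S)"
  shows "((\<lambda>s. dotp I (x s) (y s)) has_real_derivative dotp I x' (y s) + dotp I (x s) y') (at s within S)"
proof -
  have "((\<lambda>s. \<Sum>i\<in>I. x s i * y s i) has_real_derivative (\<Sum>i\<in>I. x' i * y s i + y' i * x s i)) (at s within S)"
    using assms by (intro DERIV_sum DERIV_mult) auto
  then show ?thesis by (simp add: dotp_def sum.distrib mult.commute)
qed

lemma has_derivative_mat_vec_minus:
  assumes "\<And>i. i \<in> I \<Longrightarrow> ((\<lambda>s. x s i) has_real_derivative - x' i) (at t)"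
  shows "((\<lambda>s. mat_vec I d (x s) i) has_real_derivative - mat_vec I d x' i) (at t)"
proof -
  have "((\<lambda>s. \<Sum>i'\<in>I. d i i' * x s i') has_real_derivative (\<Sum>i'\<in>I. d i i' * - x' i')) (at t)"
    by (intro DERIV_sum DERIV_cmult assms)
  then show ?thesis by (simp add: mat_vec_def sum_negf)
qed

lemma continuous_on_dotp:
  assumes "\<And>i. i \<in> I \<Longrightarrow> continuous_on S (\<lambda>s. x s i)"
    and "\<And>i. i \<in> I \<Longrightarrow> continuous_on S (\<lambda>s. y s i)"
  shows "continuous_on S (\<lambda>s. dotp I (x s) (y s))"
  unfolding dotp_def using assms by (intro continuous_intros)

text \<open>The decay of a gradient flow \<open>z\<^sub>0' = - d\<^sup>T d z\<^sub>0\<close> is recorded through the norms of the successive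
  images under \<open>d\<close> and \<open>d\<^sup>T\<close>.\<close>

definition gradient_flow where
  "gradient_flow I d z0 z1 z2 z3 \<longleftrightarrow>
     (\<forall>s. z1 s = mat_vec I d (z0 s)) \<and> (\<forall>s. z2 s = mat_vec I (transp_mat d) (z1 s)) \<and>
     (\<forall>s. z3 s = mat_vec I d (z2 s)) \<and>
     (\<forall>i\<in>I. \<forall>s. ((\<lambda>s. z0 s i) has_real_derivative - z2 s i) (at s)) \<and>
     (\<forall>i\<in>I. \<forall>s. ((\<lambda>s. z1 s i) has_real_derivative - z3 s i) (at s)) \<and>
     (\<forall>s. ((\<lambda>s. dotp I (z0 s) (z0 s)) has_real_derivative - 2 * dotp I (z1 s) (z1 s)) (at s)) \<and>
     (\<forall>s. ((\<lambda>s. dotp I (z1 s) (z1 s)) has_real_derivative - 2 * dotp I (z2 s) (z2 s)) (at s)) \<and>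
     (\<forall>s. ((\<lambda>s. dotp I (z2 s) (z2 s)) has_real_derivative - 2 * dotp I (z3 s) (z3 s)) (at s))"

lemma gradient_flow_exists:
  fixes d :: "'i \<Rightarrow> 'i \<Rightarrow> real"
  assumes fin: "finite I"
  shows "\<exists>z0 z1 z2 z3. gradient_flow I d z0 z1 z2 z3 \<and> (\<forall>i\<in>I. z0 0 i = p i)"
proof -
  define a where "a i i' = (\<Sum>r\<in>I. d r i * d r i')" for i i'
  obtain z where z0: "\<forall>i\<in>I. z i 0 = p i"
    and z': "\<forall>i\<in>I. \<forall>s. (z i has_real_derivative - (\<Sum>i'\<in>I. a i i' * z i' s)) (at s)"
    using linear_ode_exists[OF fin, of p a] by blast
  let ?z0 = "\<lambda>s i. z i s"
  let ?z1 = "\<lambda>s. mat_vec I d (?z0 s)"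
  let ?z2 = "\<lambda>s. mat_vec I (transp_mat d) (?z1 s)"
  let ?z3 = "\<lambda>s. mat_vec I d (?z2 s)"
  let ?z4 = "\<lambda>s. mat_vec I (transp_mat d) (?z3 s)"
  have a_eq: "(\<Sum>i'\<in>I. a i i' * x i') = mat_vec I (transp_mat d) (mat_vec I d x) i" for i x
  proof -
    have "(\<Sum>i'\<in>I. a i i' * x i') = (\<Sum>i'\<in>I. \<Sum>r\<in>I. d r i * (d r i' * x i'))"
      by (simp add: a_def sum_distrib_right mult.assoc)
    also have "\<dots> = mat_vec I (transp_mat d) (mat_vec I d x) i"
      by (subst sum.swap) (simp add: mat_vec_def transp_mat_def sum_distrib_left)
    finally show ?thesis .
  qed
  have d0: "((\<lambda>s. ?z0 s i) has_real_derivative - ?z2 s i) (at s)" if "i \<in> I" for i s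
    using z' that unfolding a_eq by blast
  have d1: "((\<lambda>s. ?z1 s i) has_real_derivative - ?z3 s i) (at s)" for i s
    by (rule has_derivative_mat_vec_minus[OF d0])
  have d2: "((\<lambda>s. ?z2 s i) has_real_derivative - ?z4 s i) (at s)" for i s
    by (rule has_derivative_mat_vec_minus[OF d1])
  have n: "((\<lambda>s. dotp I (x s) (x s)) has_real_derivative - 2 * dotp I (x1 s) (x1 s)) (at s)"
    if "\<And>i. i \<in> I \<Longrightarrow> ((\<lambda>s. x s i) has_real_derivative - x2 s i) (at s)"
      and "dotp I (x2 s) (x s) = dotp I (x1 s) (x1 s)" for x x1 x2 :: "real \<Rightarrow> 'i \<Rightarrow> real" and s
    by (rule DERIV_cong[OF has_derivative_dotp[OF that(1) that(1)]])
      (auto simp: dotp_minus_left dotp_minus_right that(2) dotp_commute[of I "x s"])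
  have "gradient_flow I d ?z0 ?z1 ?z2 ?z3"
    unfolding gradient_flow_def
  proof (intro conjI allI ballI)
    show "((\<lambda>s. dotp I (?z0 s) (?z0 s)) has_real_derivative - 2 * dotp I (?z1 s) (?z1 s)) (at s)" for s
      by (rule n[of ?z0 ?z2 _ ?z1, OF d0], assumption) (rule dotp_adjoint[symmetric])
    show "((\<lambda>s. dotp I (?z1 s) (?z1 s)) has_real_derivative - 2 * dotp I (?z2 s) (?z2 s)) (at s)" for s
      by (rule n[of ?z1 ?z3 _ ?z2, OF d1], subst dotp_commute) (rule dotp_adjoint)
    show "((\<lambda>s. dotp I (?z2 s) (?z2 s)) has_real_derivative - 2 * dotp I (?z3 s) (?z3 s)) (at s)" for s
      by (rule n[of ?z2 ?z4 _ ?z3, OF d2]) (rule dotp_adjoint[symmetric])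
  qed (rule refl d0 d1, assumption?)+
  then show ?thesis using z0 by blast
qed

lemma transp_mat_transp_mat [simp]: "transp_mat (transp_mat d) = d"
  by (simp add: transp_mat_def fun_eq_iff)

text \<open>The error equations of a mixed method in an orthonormal basis: \<open>\<alpha>' = - d\<^sup>T \<beta> + \<rho>'\<close> and
  \<open>\<beta> = d \<alpha> + \<gamma>\<close>.  The consistency error \<open>\<rho>'\<close> is only known to be small after integration in time.\<close>

locale mixed_error_system =
  fixes I :: "'i set" and d :: "'i \<Rightarrow> 'i \<Rightarrow> real"
    and \<alpha> \<rho> \<rho>' \<beta> \<gamma> :: "real \<Rightarrow> 'i \<Rightarrow> real" and t0 K :: real
  assumes fin: "finite I" and t0: "t0 > 0" and K: "K \<ge> 0"
    and \<alpha>': "\<And>t i. 0 < t \<Longrightarrow> t < t0 \<Longrightarrow> i \<in> I \<Longrightarrow>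
          ((\<lambda>t. \<alpha> t i) has_real_derivative - mat_vec I (transp_mat d) (\<beta> t) i + \<rho>' t i) (at t)"
    and \<beta>: "\<And>t i. 0 \<le> t \<Longrightarrow> t \<le> t0 \<Longrightarrow> i \<in> I \<Longrightarrow> \<beta> t i = mat_vec I d (\<alpha> t) i + \<gamma> t i"
    and \<rho>': "\<And>t i. 0 < t \<Longrightarrow> t < t0 \<Longrightarrow> i \<in> I \<Longrightarrow> ((\<lambda>t. \<rho> t i) has_real_derivative \<rho>' t i) (at t)"
    and cont: "\<And>i. i \<in> I \<Longrightarrow> continuous_on {0..t0} (\<lambda>t. \<alpha> t i)"
              "\<And>i. i \<in> I \<Longrightarrow> continuous_on {0..t0} (\<lambda>t. \<rho> t i)"
    and init: "\<And>i. i \<in> I \<Longrightarrow> \<alpha> 0 i = 0"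
    and \<gamma>K: "\<And>t. 0 \<le> t \<Longrightarrow> t \<le> t0 \<Longrightarrow> dotp I (\<gamma> t) (\<gamma> t) \<le> K\<^sup>2"
    and \<rho>K: "\<And>s. 0 \<le> s \<Longrightarrow> s \<le> t0 \<Longrightarrow>
          dotp I (\<lambda>i. \<rho> (t0 - s) i - \<rho> t0 i) (\<lambda>i. \<rho> (t0 - s) i - \<rho> t0 i) \<le> K\<^sup>2 * s"
begin

definition \<Delta> :: "real \<Rightarrow> 'i \<Rightarrow> real" where "\<Delta> s i = \<rho> (t0 - s) i - \<rho> t0 i"

text \<open>Up to a constant, \<alpha> - \<Delta> is \<alpha> - \<rho> run backwards from
  \<open>t0\<close>, so its derivative is free of \<rho>'. Anchoring \<Delta> at \<open>t0\<close>
  makes it vanish at s = 0: there the pairing is the quantity to be estimated, while at s =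
  \<open>t0\<close> the initial condition leaves only \<Delta>.\<close>

definition pairing :: "(real \<Rightarrow> 'i \<Rightarrow> real) \<Rightarrow> real \<Rightarrow> real" where
  "pairing y s = dotp I (\<lambda>i. \<alpha> (t0 - s) i - \<Delta> s i) (y s)"

lemma pairing_0: "pairing y 0 = dotp I (\<alpha> t0) (y 0)"
  by (simp add: pairing_def \<Delta>_def)

lemma pairing_t0: "pairing y t0 = - dotp I (\<Delta> t0) (y t0)"
  unfolding pairing_def by (simp add: dotp_def init flip: sum_negf)

lemma continuous_on_pairing:
  assumes "\<And>i s. i \<in> I \<Longrightarrow> ((\<lambda>s. y s i) has_real_derivative y' s i) (at s)"
  shows "continuous_on {0..t0} (pairing y)"
proof -
  have c0: "continuous_on {0..t0} (\<lambda>s. y s i)" if "i \<in> I" for i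
    using assms[OF that] by (meson DERIV_continuous continuous_at_imp_continuous_on)
  have sub: "(\<lambda>s. t0 - s) ` {0..t0} \<subseteq> {0..t0}" using t0 by auto
  show ?thesis unfolding pairing_def[abs_def] \<Delta>_def
    by (intro continuous_on_dotp c0 continuous_intros continuous_on_compose2[OF cont(1) _ sub]
        continuous_on_compose2[OF cont(2) _ sub]) auto
qed

text \<open>If y solves y' = - d^T d y, the two terms containing \<alpha> cancel because \<beta> = d
  \<alpha> + \<gamma>. What is left involves only the small data \<gamma> and \<Delta>, tested with
  d y and d^T d y.\<close>

lemma has_derivative_pairing:
  assumes s: "0 < s" "s < t0"
    and y: "\<And>i. i \<in> I \<Longrightarrow> ((\<lambda>s. y s i) has_real_derivative - w i) (at s)"
    and w: "w = mat_vec I (transp_mat d) (mat_vec I d (y s))"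
  shows "(pairing y has_real_derivative dotp I (\<gamma> (t0 - s)) (mat_vec I d (y s)) + dotp I (\<Delta> s) w) (at s)"
proof -
  have T: "0 < t0 - s" "t0 - s < t0" "0 \<le> t0 - s" "t0 - s \<le> t0" using s t0 by auto
  have 1: "((\<lambda>s. \<alpha> (t0 - s) i - \<Delta> s i) has_real_derivative mat_vec I (transp_mat d) (\<beta> (t0 - s)) i) (at s)"
    if "i \<in> I" for i
  proof -
    have "((\<lambda>s. \<alpha> (t0 - s) i) has_real_derivative
        (- mat_vec I (transp_mat d) (\<beta> (t0 - s)) i + \<rho>' (t0 - s) i) * (- 1)) (at s)"
      by (rule DERIV_chain2[where f = "\<lambda>t. \<alpha> t i" and g = "\<lambda>s. t0 - s", OF \<alpha>'[OF T(1,2) that]])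
        (auto intro!: derivative_eq_intros)
    moreover have "((\<lambda>s. \<rho> (t0 - s) i) has_real_derivative \<rho>' (t0 - s) i * (- 1)) (at s)"
      by (rule DERIV_chain2[where f = "\<lambda>t. \<rho> t i" and g = "\<lambda>s. t0 - s", OF \<rho>'[OF T(1,2) that]])
        (auto intro!: derivative_eq_intros)
    ultimately show ?thesis unfolding \<Delta>_def by (auto intro!: derivative_eq_intros)
  qed
  have 2: "dotp I (mat_vec I (transp_mat d) (\<beta> (t0 - s))) (y s) = dotp I (\<beta> (t0 - s)) (mat_vec I d (y s))"
    by (simp add: dotp_adjoint)
  have 3: "dotp I (\<beta> (t0 - s)) v = dotp I (mat_vec I d (\<alpha> (t0 - s))) v + dotp I (\<gamma> (t0 - s)) v" for v
    unfolding dotp_add_left[symmetric] unfolding dotp_def by (intro sum.cong) (auto simp: \<beta>[OF T(3,4)])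
  have 4: "dotp I (mat_vec I d (\<alpha> (t0 - s))) v = dotp I (\<alpha> (t0 - s)) (mat_vec I (transp_mat d) v)" for v
    using dotp_adjoint[of I v d "\<alpha> (t0 - s)"] by (simp add: dotp_commute)
  show ?thesis unfolding pairing_def[abs_def]
    by (rule DERIV_cong[OF has_derivative_dotp[OF 1 y]])
      (simp_all add: dotp_minus_right dotp_diff_left 2 3 4 w)
qed

lemma \<Delta>_bound: "0 \<le> s \<Longrightarrow> s \<le> t0 \<Longrightarrow> dotp I (\<Delta> s) (\<Delta> s) \<le> K\<^sup>2 * s"
  using \<rho>K by (simp add: \<Delta>_def[abs_def])

text \<open>Duality: the flow starts from \<alpha>(t0), so the pairing at 0 is the squared norm. Its
  change along the flow is paid for by the dissipation of the flow, once Young's inequality is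
  applied with weight 1 to \<gamma> and weight 1/s to \<Delta>.\<close>

lemma primal_bound: "dotp I (\<alpha> t0) (\<alpha> t0) \<le> 9 * K\<^sup>2 * t0"
proof -
  obtain z0 z1 z2 z3 where flow: "gradient_flow I d z0 z1 z2 z3" and z00: "\<forall>i\<in>I. z0 0 i = \<alpha> t0 i"
    using gradient_flow_exists[OF fin, of d "\<alpha> t0"] by blast
  have z1: "\<And>s. z1 s = mat_vec I d (z0 s)" and z2: "\<And>s. z2 s = mat_vec I (transp_mat d) (z1 s)"
    and d0: "\<And>i s. i \<in> I \<Longrightarrow> ((\<lambda>s. z0 s i) has_real_derivative - z2 s i) (at s)"
    and n0: "\<And>s. ((\<lambda>s. dotp I (z0 s) (z0 s)) has_real_derivative - 2 * dotp I (z1 s) (z1 s)) (at s)"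
    and n1: "\<And>s. ((\<lambda>s. dotp I (z1 s) (z1 s)) has_real_derivative - 2 * dotp I (z2 s) (z2 s)) (at s)"
    using flow unfolding gradient_flow_def by blast+
  define P where "P = dotp I (\<alpha> t0) (\<alpha> t0)"
  have P0: "dotp I (z0 0) (z0 0) = P" "dotp I (\<alpha> t0) (z0 0) = P"
    using z00 unfolding P_def dotp_def by simp_all
  \<comment> \<open>The weights are chosen such that -S' is exactly |z1|^2 + s |z2|^2, the
    dissipation that Young's inequality consumes. The remaining terms |\<gamma>|^2 and |\<Delta>|^2
    / s are each at most K^2, hence the summand K^2 s of \<open>H\<close>.\<close>
  define S where "S s = 3 / 4 * dotp I (z0 s) (z0 s) + s / 2 * dotp I (z1 s) (z1 s)" for s
  define H where "H s = pairing z0 s + K\<^sup>2 * s - S s / 2" for s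
  have S': "(S has_real_derivative - dotp I (z1 s) (z1 s) - s * dotp I (z2 s) (z2 s)) (at s)" for s
    unfolding S_def by (rule derivative_eq_intros n0 n1 refl | simp)+
  have "H 0 \<le> H t0"
  proof (rule DERIV_nonneg_imp_increasing_open[of 0 t0 H])
    show "0 \<le> t0" using t0 by simp
    fix s assume s: "0 < s" "s < t0"
    define D where "D = dotp I (\<gamma> (t0 - s)) (z1 s) + dotp I (\<Delta> s) (z2 s) + K\<^sup>2
        + (dotp I (z1 s) (z1 s) + s * dotp I (z2 s) (z2 s)) / 2"
    have F': "(pairing z0 has_real_derivative dotp I (\<gamma> (t0 - s)) (z1 s) + dotp I (\<Delta> s) (z2 s)) (at s)"
      unfolding z1 by (rule has_derivative_pairing[OF s d0]) (simp_all add: z1 z2)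
    have "(H has_real_derivative D) (at s)"
      unfolding H_def D_def
      by (auto intro!: derivative_eq_intros F' S' simp: field_simps)
    moreover have "D \<ge> 0"
    proof -
      have "\<bar>dotp I (\<gamma> (t0 - s)) (z1 s)\<bar> \<le> (1 * dotp I (\<gamma> (t0 - s)) (\<gamma> (t0 - s)) + dotp I (z1 s) (z1 s) / 1) / 2"
        by (rule dotp_young) simp
      moreover have "\<bar>dotp I (\<Delta> s) (z2 s)\<bar> \<le> ((1 / s) * dotp I (\<Delta> s) (\<Delta> s) + dotp I (z2 s) (z2 s) / (1 / s)) / 2"
        by (rule dotp_young) (use s in simp)
      moreover have "dotp I (\<gamma> (t0 - s)) (\<gamma> (t0 - s)) \<le> K\<^sup>2" using \<gamma>K[of "t0 - s"] s t0 by simp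
      moreover have "(1 / s) * dotp I (\<Delta> s) (\<Delta> s) \<le> K\<^sup>2"
        using \<Delta>_bound[of s] s by (simp add: field_simps)
      ultimately show ?thesis unfolding D_def by (simp add: abs_le_iff field_simps)
    qed
    ultimately show "\<exists>y. (H has_real_derivative y) (at s) \<and> 0 \<le> y" by blast
  next
    have cS: "continuous_on {0..t0} S"
      using S' by (meson DERIV_continuous continuous_at_imp_continuous_on)
    show "continuous_on {0..t0} H" unfolding H_def
      by (intro continuous_intros cS continuous_on_pairing[OF d0]) auto
  qed
  moreover have "H 0 = P - 3 / 8 * P"
    unfolding H_def S_def pairing_0 using P0 by simp
  moreover have "H t0 \<le> 2 * (K\<^sup>2 * t0) + P / 4"
  proof -
    have "dotp I (z0 t0) (z0 t0) \<le> dotp I (z0 0) (z0 0)"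
    proof (rule DERIV_nonpos_imp_nonincreasing[of 0 t0])
      show "\<exists>y. ((\<lambda>s. dotp I (z0 s) (z0 s)) has_real_derivative y) (at s) \<and> y \<le> 0" for s
        by (intro exI conjI, rule n0) (simp add: dotp_nonneg)
    qed (use t0 in simp)
    moreover have "\<bar>dotp I (\<Delta> t0) (z0 t0)\<bar> \<le> (2 * dotp I (\<Delta> t0) (\<Delta> t0) + dotp I (z0 t0) (z0 t0) / 2) / 2"
      by (rule dotp_young) simp
    moreover have "dotp I (\<Delta> t0) (\<Delta> t0) \<le> K\<^sup>2 * t0"
      using \<Delta>_bound[of t0] t0 by simp
    moreover have "S t0 \<ge> 0" unfolding S_def using t0 by (simp add: dotp_nonneg)
    ultimately have "pairing z0 t0 \<le> K\<^sup>2 * t0 + P / 4" "S t0 \<ge> 0"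
      unfolding P0 pairing_t0 by (auto simp: abs_le_iff)
    then show ?thesis unfolding H_def by (simp add: algebra_simps)
  qed
  \<comment> \<open>This yields the factor 16/3; it is rounded up to 9 to have an integral square
    root.\<close>
  ultimately have "3 / 8 * P \<le> 2 * (K\<^sup>2 * t0)" by simp
  moreover have "0 \<le> K\<^sup>2 * t0" using t0 by simp
  ultimately show ?thesis unfolding P_def[symmetric] mult.assoc by linarith
qed

text \<open>Here the flow is that of d d^T and starts from \<beta>(t0). Pairing \<alpha> with z1 =
  d^T z0 and adding \<gamma>(t0) paired with z0 gives |\<beta>(t0)|^2 at s = 0, and in the
  derivative \<gamma> enters only through its increment from t0. The increments are tested with z2
  and z3, one order higher than for \<alpha>, so the admissible weights are 1/s and 1/s^2.\<close>

lemma flux_bound: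
  assumes g: "g \<ge> 0"
    and \<rho>g: "\<And>s. 0 < s \<Longrightarrow> s < t0 / 2 \<Longrightarrow> dotp I (\<Delta> s) (\<Delta> s) \<le> K\<^sup>2 * g * s * s powr (1/4)"
    and \<gamma>g: "\<And>s. 0 < s \<Longrightarrow> s < t0 / 2 \<Longrightarrow>
          dotp I (\<lambda>i. \<gamma> (t0 - s) i - \<gamma> t0 i) (\<lambda>i. \<gamma> (t0 - s) i - \<gamma> t0 i) \<le> K\<^sup>2 * g * s powr (1/4)"
  shows "dotp I (\<beta> t0) (\<beta> t0) \<le> K\<^sup>2 * (32 + 8 * g * t0 powr (1/4))"
proof -
  obtain z0 z1 z2 z3 where flow: "gradient_flow I (transp_mat d) z0 z1 z2 z3"
    and z00: "\<forall>i\<in>I. z0 0 i = \<beta> t0 i"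
    using gradient_flow_exists[OF fin, of "transp_mat d" "\<beta> t0"] by blast
  have z1: "\<And>s. z1 s = mat_vec I (transp_mat d) (z0 s)" and z2: "\<And>s. z2 s = mat_vec I d (z1 s)"
    and z3: "\<And>s. z3 s = mat_vec I (transp_mat d) (z2 s)"
    and d0: "\<And>i s. i \<in> I \<Longrightarrow> ((\<lambda>s. z0 s i) has_real_derivative - z2 s i) (at s)"
    and d1: "\<And>i s. i \<in> I \<Longrightarrow> ((\<lambda>s. z1 s i) has_real_derivative - z3 s i) (at s)"
    and n0: "\<And>s. ((\<lambda>s. dotp I (z0 s) (z0 s)) has_real_derivative - 2 * dotp I (z1 s) (z1 s)) (at s)"
    and n1: "\<And>s. ((\<lambda>s. dotp I (z1 s) (z1 s)) has_real_derivative - 2 * dotp I (z2 s) (z2 s)) (at s)"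
    and n2: "\<And>s. ((\<lambda>s. dotp I (z2 s) (z2 s)) has_real_derivative - 2 * dotp I (z3 s) (z3 s)) (at s)"
    using flow unfolding gradient_flow_def transp_mat_transp_mat by blast+
  define P where "P = dotp I (\<beta> t0) (\<beta> t0)"
  have P0: "dotp I (z0 0) (z0 0) = P" "dotp I (\<beta> t0) (z0 0) = P"
    using z00 unfolding P_def dotp_def by simp_all
  \<comment> \<open>The coefficients make the |z1|^2 terms of the derivative cancel, leaving -S' = s
    |z2|^2 + s^2 |z3|^2.\<close>
  define S where "S s = dotp I (z0 s) (z0 s) / 2 + s * dotp I (z1 s) (z1 s) + s\<^sup>2 / 2 * dotp I (z2 s) (z2 s)" for s
  define F where "F s = pairing z1 s + dotp I (\<gamma> t0) (z0 s)" for s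
  define \<Gamma> where "\<Gamma> s i = \<gamma> (t0 - s) i - \<gamma> t0 i" for s i
  define R where "R s = s * dotp I (z2 s) (z2 s) + s\<^sup>2 * dotp I (z3 s) (z3 s)" for s
  have S': "(S has_real_derivative - R s) (at s)" for s
    unfolding S_def R_def by (auto intro!: derivative_eq_intros n0 n1 n2 simp: field_simps power2_eq_square)
  have F': "(F has_real_derivative dotp I (\<Gamma> s) (z2 s) + dotp I (\<Delta> s) (z3 s)) (at s)"
    if s: "0 < s" "s < t0" for s
  proof -
    have "(pairing z1 has_real_derivative dotp I (\<gamma> (t0 - s)) (z2 s) + dotp I (\<Delta> s) (z3 s)) (at s)"
      unfolding z2 by (rule has_derivative_pairing[OF s d1]) (simp_all add: z3 z2)
    moreover have "((\<lambda>s. dotp I (\<gamma> t0) (z0 s)) has_real_derivative dotp I (\<lambda>_. 0) (z0 s) + dotp I (\<gamma> t0) (\<lambda>i. - z2 s i)) (at s)"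
      by (rule has_derivative_dotp[OF _ d0]) auto
    ultimately have "(F has_real_derivative (dotp I (\<gamma> (t0 - s)) (z2 s) + dotp I (\<Delta> s) (z3 s)) +
        (dotp I (\<lambda>_. 0) (z0 s) + dotp I (\<gamma> t0) (\<lambda>i. - z2 s i))) (at s)"
      unfolding F_def by (rule DERIV_add)
    moreover have "dotp I (\<lambda>_. 0) (z0 s) = 0" by (simp add: dotp_def)
    ultimately show ?thesis by (simp add: \<Gamma>_def[abs_def] dotp_diff_left dotp_minus_right algebra_simps)
  qed
  have cF: "continuous_on {0..t0} F" unfolding F_def
    by (intro continuous_intros continuous_on_pairing[OF d1] continuous_on_dotp)
      (auto intro: continuous_at_imp_continuous_on DERIV_continuous d0)
  have cS: "continuous_on A S" for A
    using S' by (meson DERIV_continuous continuous_at_imp_continuous_on)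
  have young: "- (dotp I (\<Gamma> s) (\<Gamma> s) / s + dotp I (\<Delta> s) (\<Delta> s) / s\<^sup>2) / 2 - R s / 2
      \<le> dotp I (\<Gamma> s) (z2 s) + dotp I (\<Delta> s) (z3 s)" if "0 < s" for s
  proof -
    have "\<bar>dotp I (\<Gamma> s) (z2 s)\<bar> \<le> ((1 / s) * dotp I (\<Gamma> s) (\<Gamma> s) + dotp I (z2 s) (z2 s) / (1 / s)) / 2"
      by (rule dotp_young) (use that in simp)
    moreover have "\<bar>dotp I (\<Delta> s) (z3 s)\<bar> \<le> ((1 / s\<^sup>2) * dotp I (\<Delta> s) (\<Delta> s) + dotp I (z3 s) (z3 s) / (1 / s\<^sup>2)) / 2"
      by (rule dotp_young) (use that in simp)
    ultimately show ?thesis unfolding R_def by (simp add: abs_le_iff algebra_simps add_divide_distrib)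
  qed
  \<comment> \<open>On (0, t0/2) the refined increments bound the Young terms by K^2 g s^(-3/4),
    whose primitive is 4 K^2 g s^(1/4).\<close>
  define H where "H s = F s + 4 * K\<^sup>2 * g * s powr (1/4) - S s / 2" for s
  have "H 0 \<le> H (t0 / 2)"
  proof (rule DERIV_nonneg_imp_increasing_open[of 0 "t0 / 2" H])
    show "0 \<le> t0 / 2" using t0 by simp
    fix s assume s: "0 < s" "s < t0 / 2"
    define D where "D = dotp I (\<Gamma> s) (z2 s) + dotp I (\<Delta> s) (z3 s) + K\<^sup>2 * g * s powr (1/4 - 1) + R s / 2"
    have "(H has_real_derivative D) (at s)"
      unfolding H_def D_def using s
      by (auto intro!: derivative_eq_intros F' S' simp: field_simps)
    moreover have "D \<ge> 0"
    proof -
      define X where "X = K\<^sup>2 * g * s powr (1/4) / s"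
      have "dotp I (\<Gamma> s) (\<Gamma> s) / s \<le> X"
        unfolding X_def using \<gamma>g[OF s] s unfolding \<Gamma>_def by (intro divide_right_mono) auto
      moreover have "dotp I (\<Delta> s) (\<Delta> s) / s\<^sup>2 \<le> K\<^sup>2 * g * s * s powr (1/4) / s\<^sup>2"
        using \<rho>g[OF s] s by (intro divide_right_mono) auto
      moreover have "K\<^sup>2 * g * s * s powr (1/4) / s\<^sup>2 = X"
        using s by (simp add: X_def power2_eq_square)
      moreover have "K\<^sup>2 * g * s powr (1/4 - 1) = X"
        unfolding X_def using powr_diff[of s "1/4" 1] s by simp
      ultimately show ?thesis using young[OF s(1)] unfolding D_def by argo
    qed
    ultimately show "\<exists>y. (H has_real_derivative y) (at s) \<and> 0 \<le> y" by blast
  next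
    show "continuous_on {0..t0/2} H" unfolding H_def
      by (intro continuous_intros cS continuous_on_subset[OF cF] continuous_on_powr') (use t0 in auto)
  qed
  \<comment> \<open>On (t0/2, t0) the global bounds suffice since 1/s is at most 2/t0: the Young
    terms are at most (4 + 1)/2 times 2 K^2/t0.\<close>
  moreover define H2 where "H2 s = F s + 5 * (K\<^sup>2 / t0) * s - S s / 2" for s
  have "H2 (t0 / 2) \<le> H2 t0"
  proof (rule DERIV_nonneg_imp_increasing_open[of "t0 / 2" t0 H2])
    show "t0 / 2 \<le> t0" using t0 by simp
    fix s assume s: "t0 / 2 < s" "s < t0"
    have s0: "0 < s" using s t0 by linarith
    define D where "D = dotp I (\<Gamma> s) (z2 s) + dotp I (\<Delta> s) (z3 s) + 5 * (K\<^sup>2 / t0) + R s / 2"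
    have "(H2 has_real_derivative D) (at s)"
      unfolding H2_def D_def using s s0 t0
      by (auto intro!: derivative_eq_intros F' S' simp: field_simps)
    moreover have "D \<ge> 0"
    proof -
      have "dotp I (\<Gamma> s) (\<Gamma> s) \<le> 2 * (dotp I (\<gamma> (t0 - s)) (\<gamma> (t0 - s)) + dotp I (\<gamma> t0) (\<gamma> t0))"
        unfolding dotp_def \<Gamma>_def sum.distrib[symmetric] sum_distrib_left
        by (intro sum_mono) (use zero_le_square[of "\<gamma> (t0 - s) _ + \<gamma> t0 _"] in \<open>simp add: algebra_simps\<close>)
      also have "\<dots> \<le> 4 * K\<^sup>2" using \<gamma>K[of "t0 - s"] \<gamma>K[of t0] s s0 t0 by simp
      finally have "dotp I (\<Gamma> s) (\<Gamma> s) / s \<le> 4 * (K\<^sup>2 / s)"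
        using s0 by (simp add: field_simps)
      moreover have "dotp I (\<Delta> s) (\<Delta> s) / s\<^sup>2 \<le> K\<^sup>2 / s"
        using \<Delta>_bound[of s] s s0 by (simp add: field_simps power2_eq_square)
      moreover have "K\<^sup>2 / s \<le> 2 * (K\<^sup>2 / t0)"
        using s s0 t0 divide_left_mono[of "t0 / 2" s "K\<^sup>2"] by (simp add: mult.commute)
      ultimately show ?thesis using young[OF s0] unfolding D_def by argo
    qed
    ultimately show "\<exists>y. (H2 has_real_derivative y) (at s) \<and> 0 \<le> y" by blast
  next
    show "continuous_on {t0/2..t0} H2" unfolding H2_def
      by (intro continuous_intros cS continuous_on_subset[OF cF]) (use t0 in auto)
  qed
  moreover have "F 0 = P"
  proof -
    have "F 0 = dotp I (mat_vec I d (\<alpha> t0)) (z0 0) + dotp I (\<gamma> t0) (z0 0)"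
      unfolding F_def pairing_0 z1 by (simp add: dotp_adjoint)
    also have "\<dots> = dotp I (\<beta> t0) (z0 0)"
      unfolding dotp_add_left[symmetric] unfolding dotp_def
      by (intro sum.cong) (use t0 in \<open>auto simp: \<beta>\<close>)
    finally show ?thesis by (simp add: P0)
  qed
  moreover have S0: "S 0 = P / 2" unfolding S_def using P0 by simp
  moreover have "F t0 \<le> 5 * K\<^sup>2 + P / 4"
  proof -
    \<comment> \<open>Besides |z0|, this controls t0 |z1(t0)|^2 by P/2. That is what the pairing
      with \<Delta>(t0), of squared norm at most K^2 t0, needs.\<close>
    have "S t0 \<le> S 0"
    proof (rule DERIV_nonpos_imp_nonincreasing[of 0 t0])
      show "\<exists>y. (S has_real_derivative y) (at s) \<and> y \<le> 0" if "0 \<le> s" for s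
      proof (intro exI conjI, rule S')
        have "0 \<le> R s" unfolding R_def using that by (intro add_nonneg_nonneg mult_nonneg_nonneg dotp_nonneg) auto
        then show "- R s \<le> 0" by simp
      qed
    qed (use t0 in auto)
    moreover have "0 \<le> t0\<^sup>2 / 2 * dotp I (z2 t0) (z2 t0)" by (simp add: dotp_nonneg)
    ultimately have a: "dotp I (z0 t0) (z0 t0) + 2 * (t0 * dotp I (z1 t0) (z1 t0)) \<le> P"
      unfolding S0 unfolding S_def by linarith
    have "\<bar>dotp I (\<Delta> t0) (z1 t0)\<bar> \<le> ((2 / t0) * dotp I (\<Delta> t0) (\<Delta> t0) + dotp I (z1 t0) (z1 t0) / (2 / t0)) / 2"
      by (rule dotp_young) (use t0 in simp)
    also have "\<dots> = dotp I (\<Delta> t0) (\<Delta> t0) / t0 + t0 * dotp I (z1 t0) (z1 t0) / 4"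
      using t0 by (simp add: field_simps)
    also have "dotp I (\<Delta> t0) (\<Delta> t0) / t0 \<le> K\<^sup>2"
      using \<Delta>_bound[of t0] t0 by (simp add: field_simps)
    finally have b: "\<bar>dotp I (\<Delta> t0) (z1 t0)\<bar> \<le> K\<^sup>2 + t0 * dotp I (z1 t0) (z1 t0) / 4" by simp
    have "\<bar>dotp I (\<gamma> t0) (z0 t0)\<bar> \<le> (4 * dotp I (\<gamma> t0) (\<gamma> t0) + dotp I (z0 t0) (z0 t0) / 4) / 2"
      by (rule dotp_young) simp
    also have "\<dots> \<le> 2 * K\<^sup>2 + dotp I (z0 t0) (z0 t0) / 8"
      using \<gamma>K[of t0] t0 by simp
    finally have c: "\<bar>dotp I (\<gamma> t0) (z0 t0)\<bar> \<le> 2 * K\<^sup>2 + dotp I (z0 t0) (z0 t0) / 8" .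
    have "0 \<le> K\<^sup>2" "0 \<le> t0 * dotp I (z1 t0) (z1 t0)" "0 \<le> dotp I (z0 t0) (z0 t0)"
      using t0 by (auto simp: dotp_nonneg)
    then show ?thesis using a b c unfolding F_def pairing_t0 by linarith
  qed
  moreover have "S t0 \<ge> 0" unfolding S_def using t0 by (simp add: dotp_nonneg)
  ultimately have "P / 2 \<le> 15 / 2 * K\<^sup>2 + 4 * K\<^sup>2 * g * (t0 / 2) powr (1/4)"
    unfolding H_def H2_def using t0 by (simp add: field_simps)
  moreover have "4 * K\<^sup>2 * g * (t0 / 2) powr (1/4) \<le> 4 * K\<^sup>2 * g * t0 powr (1/4)"
    using t0 g by (intro mult_left_mono powr_mono2) auto
  ultimately have "P \<le> 15 * K\<^sup>2 + 8 * K\<^sup>2 * g * t0 powr (1/4)" by simp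
  moreover have "0 \<le> K\<^sup>2" by simp
  moreover have "K\<^sup>2 * (32 + 8 * g * t0 powr (1/4)) = 32 * K\<^sup>2 + 8 * K\<^sup>2 * g * t0 powr (1/4)"
    by (simp add: algebra_simps)
  ultimately show ?thesis unfolding P_def[symmetric] by linarith
qed

end

section \<open>Polynomials on the reference cell\<close>

lemma pderiv_sum: "pderiv (\<Sum>i\<in>A. f i) = (\<Sum>i\<in>A. pderiv (f i))"
  by (induction A rule: infinite_finite_induct) (auto simp: pderiv_add)

lemma pderiv_surj: "\<exists>q. pderiv q = p \<and> degree q \<le> Suc (degree p)" for p :: "real poly"
proof -
  define q where "q = (\<Sum>i\<le>degree p. monom (coeff p i / real (Suc i)) (Suc i))"
  have "pderiv q = (\<Sum>i\<le>degree p. monom (coeff p i) i)"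
    unfolding q_def pderiv_sum pderiv_monom by simp
  moreover have "degree q \<le> Suc (degree p)"
    unfolding q_def by (intro degree_sum_le) (auto intro: order_trans[OF degree_monom_le])
  ultimately show ?thesis using poly_as_sum_of_monoms[of p] by auto
qed

definition primitive :: "real poly \<Rightarrow> real poly" where
  "primitive p = (THE q. pderiv q = p \<and> poly q (-1) = 0)"

text \<open>The integral over [-1, 1], defined algebraically so that calculations with polynomials
  need no integrability; \<open>cint_poly\<close> connects it with the integral over a cell.\<close>

definition refint :: "real poly \<Rightarrow> real" where
  "refint p = poly (primitive p) 1"

lemma primitive_unique:
  assumes "pderiv q = p" "poly q (-1) = 0"
  shows "primitive p = q"
  unfolding primitive_def
proof (rule the_equality)
  fix r assume r: "pderiv r = p \<and> poly r (-1) = 0"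
  then have "pderiv (r - q) = 0" using assms by (simp add: pderiv_diff)
  then have "degree (r - q) = 0" by (simp add: pderiv_eq_0_iff)
  then obtain c where c: "r - q = [:c:]" by (metis degree_eq_zeroE)
  have "poly (r - q) (-1) = 0" using r assms by simp
  then show "r = q" using c by simp
qed (use assms in simp)

lemma pderiv_primitive [simp]: "pderiv (primitive p) = p"
  and poly_primitive_minus_1 [simp]: "poly (primitive p) (-1) = 0"
  and degree_primitive_le: "degree (primitive p) \<le> Suc (degree p)"
proof -
  obtain q where q: "pderiv q = p" "degree q \<le> Suc (degree p)" using pderiv_surj by blast
  define r where "r = q - [:poly q (-1):]"
  have "pderiv r = p" "poly r (-1) = 0" by (simp_all add: r_def pderiv_diff q pderiv_pCons)
  moreover have "degree r \<le> Suc (degree p)" using q unfolding r_def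
    by (intro degree_diff_le) auto
  ultimately show "pderiv (primitive p) = p" "poly (primitive p) (-1) = 0"
    "degree (primitive p) \<le> Suc (degree p)"
    using primitive_unique by auto
qed

lemma refint_pderiv: "refint (pderiv p) = poly p 1 - poly p (-1)"
proof -
  have "primitive (pderiv p) = p - [:poly p (-1):]"
    by (rule primitive_unique) (simp_all add: pderiv_diff pderiv_pCons)
  then show ?thesis by (simp add: refint_def)
qed

lemma refint_add: "refint (p + q) = refint p + refint q"
  and refint_smult: "refint (smult c p) = c * refint p"
proof -
  have "primitive (p + q) = primitive p + primitive q"
    by (rule primitive_unique) (simp_all add: pderiv_add)
  then show "refint (p + q) = refint p + refint q" by (simp add: refint_def)
  have "primitive (smult c p) = smult c (primitive p)"
    by (rule primitive_unique) (simp_all add: pderiv_smult)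
  then show "refint (smult c p) = c * refint p" by (simp add: refint_def)
qed

lemma refint_0 [simp]: "refint 0 = 0"
  using refint_smult[of 0 0] by simp

lemma refint_minus: "refint (- p) = - refint p"
  using refint_smult[of "-1" p] by simp

lemma refint_diff: "refint (p - q) = refint p - refint q"
  using refint_add[of p "- q"] by (simp add: refint_minus)

lemma refint_sum: "refint (\<Sum>i\<in>A. f i) = (\<Sum>i\<in>A. refint (f i))"
  by (induction A rule: infinite_finite_induct) (auto simp: refint_add)

lemma refint_by_parts:
  "refint (pderiv p * q) = poly p 1 * poly q 1 - poly p (-1) * poly q (-1) - refint (p * pderiv q)"
  using refint_pderiv[of "p * q"] by (simp add: pderiv_mult refint_add mult.commute)

subsection \<open>Legendre polynomials\<close>

lemma pderiv_linear_power_mult: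
  fixes g :: "real poly"
  shows "pderiv ([:-a, 1:] ^ Suc j * g) = [:-a, 1:] ^ j * ([:-a, 1:] * pderiv g + smult (real (Suc j)) g)"
proof -
  define l where "l = [:-a, 1:]"
  have "pderiv l = 1" by (simp add: l_def pderiv_pCons)
  then have "pderiv (l ^ Suc j) = smult (real (Suc j)) (l ^ j)"
    by (simp only: pderiv_power_Suc mult_1_right)
  then show ?thesis unfolding l_def[symmetric] by (simp only: pderiv_mult) (simp add: algebra_simps)
qed

lemma linear_power_dvd_pderiv:
  fixes f :: "real poly"
  assumes "[:-a, 1:] ^ Suc j dvd f"
  shows "[:-a, 1:] ^ j dvd pderiv f"
proof -
  obtain g where g: "f = [:-a, 1:] ^ Suc j * g" using assms by (elim dvdE)
  have "pderiv f = [:-a, 1:] ^ j * ([:-a, 1:] * pderiv g + smult (real (Suc j)) g)"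
    unfolding g by (rule pderiv_linear_power_mult)
  then show ?thesis by simp
qed

lemma linear_power_dvd_higher_pderiv:
  fixes f :: "real poly"
  assumes "[:-a, 1:] ^ (i + j) dvd f"
  shows "[:-a, 1:] ^ i dvd (pderiv ^^ j) f"
  using assms
proof (induction j arbitrary: i)
  case (Suc j)
  have "[:-a, 1:] ^ Suc i dvd (pderiv ^^ j) f" by (rule Suc.IH) (use Suc.prems in simp)
  then have "[:-a, 1:] ^ i dvd pderiv ((pderiv ^^ j) f)" by (rule linear_power_dvd_pderiv)
  then show ?case by simp
qed simp

text \<open>Only the term in which all \<open>m\<close> derivatives fall on the power survives at
  \<open>a\<close>. It gives the values of Legendre polynomials at both end points.\<close>

lemma higher_pderiv_linear_power:
  fixes g :: "real poly"
  shows "poly ((pderiv ^^ m) ([:-a, 1:] ^ m * g)) a = fact m * poly g a"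
proof (induction m arbitrary: g)
  case (Suc m)
  have "pderiv ([:-a, 1:] ^ Suc m * g) = [:-a, 1:] ^ m * ([:-a, 1:] * pderiv g + smult (real (Suc m)) g)"
    by (rule pderiv_linear_power_mult)
  then have "poly ((pderiv ^^ Suc m) ([:-a, 1:] ^ Suc m * g)) a
      = fact m * poly ([:-a, 1:] * pderiv g + smult (real (Suc m)) g) a"
    by (simp only: funpow_Suc_right comp_apply Suc.IH)
  then show ?case by (simp add: algebra_simps)
qed simp

abbreviation rodrigues :: "nat \<Rightarrow> real poly" where
  "rodrigues m \<equiv> [:-1, 0, 1:] ^ m"

lemma rodrigues_factor: "rodrigues m = [:-1, 1:] ^ m * [:1, 1:] ^ m"
  unfolding power_mult_distrib[symmetric] by simp

lemma poly_legendre_1: "poly (legendre_poly m) 1 = 1"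
  using higher_pderiv_linear_power[of m 1 "[:1, 1:] ^ m"]
  by (simp add: legendre_poly_def rodrigues_factor)

lemma poly_legendre_minus_1: "poly (legendre_poly m) (-1) = (-1) ^ m"
proof -
  have "rodrigues m = [:-(-1), 1:] ^ m * [:-1, 1:] ^ m"
    by (simp add: rodrigues_factor mult.commute)
  then show ?thesis using higher_pderiv_linear_power[of m "-1" "[:-1, 1:] ^ m"]
    by (simp add: legendre_poly_def power_minus[of 2])
qed

lemma poly_legendre_sign: "s = 1 \<or> s = -1 \<Longrightarrow> poly (legendre_poly m) s = s ^ m"
  using poly_legendre_1 poly_legendre_minus_1 by auto

lemma degree_higher_pderiv: "degree ((pderiv ^^ j) p) = degree p - j" for p :: "real poly"
  by (induction j) (auto simp: degree_pderiv)

lemma degree_legendre: "degree (legendre_poly m) = m"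
  by (simp add: legendre_poly_def degree_higher_pderiv degree_power_eq)

text \<open>Rodrigues' formula is integrated by parts m times: 1 and -1 are zeros of order m, so no
  boundary term appears, and the m-th derivative of w vanishes. The alternative w = 0 is listed
  separately because the zero polynomial has degree 0 here, which matters for m = 0.\<close>

lemma refint_legendre_orthogonal:
  assumes "w = 0 \<or> degree w < m"
  shows "refint (legendre_poly m * w) = 0"
proof -
  have end_zero: "poly ((pderiv ^^ j) (rodrigues m)) x = 0" if "j < m" "x = 1 \<or> x = -1" for j x
  proof -
    have "[:-x, 1:] ^ (1 + j) dvd [:-x, 1:] ^ m" using that by (intro le_imp_power_dvd) simp
    also have "[:-x, 1:] ^ m dvd rodrigues m" using that(2) by (auto simp: rodrigues_factor)
    finally have "[:-x, 1:] ^ 1 dvd (pderiv ^^ j) (rodrigues m)"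
      by (rule linear_power_dvd_higher_pderiv)
    then show ?thesis by (simp add: poly_eq_0_iff_dvd)
  qed
  have "refint ((pderiv ^^ m) (rodrigues m) * w)
      = (-1) ^ j * refint ((pderiv ^^ (m - j)) (rodrigues m) * (pderiv ^^ j) w)" if "j \<le> m" for j
    using that
  proof (induction j)
    case (Suc j)
    then have m: "m - j = Suc (m - Suc j)" by simp
    have "refint ((pderiv ^^ (m - j)) (rodrigues m) * (pderiv ^^ j) w)
        = - refint ((pderiv ^^ (m - Suc j)) (rodrigues m) * (pderiv ^^ Suc j) w)"
      unfolding m using refint_by_parts[of "(pderiv ^^ (m - Suc j)) (rodrigues m)" "(pderiv ^^ j) w"]
        end_zero[of "m - Suc j" 1] end_zero[of "m - Suc j" "-1"] Suc.prems by simp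
    then show ?case using Suc by simp
  qed simp
  from this[of m] have "refint ((pderiv ^^ m) (rodrigues m) * w)
      = (-1) ^ m * refint (rodrigues m * (pderiv ^^ m) w)" by simp
  also have "(pderiv ^^ m) w = 0"
  proof (cases "w = 0")
    case False
    then have "degree w < m" using assms by simp
    then obtain m' where m': "m = Suc m'" "degree w \<le> m'" by (cases m) auto
    then have "degree ((pderiv ^^ m') w) = 0" by (simp add: degree_higher_pderiv)
    then show ?thesis using m' by (simp add: pderiv_eq_0_iff)
  qed (simp add: higher_pderiv_0)
  finally show ?thesis by (simp add: legendre_poly_def refint_smult)
qed

text \<open>x L' - m L has lower degree, since the leading terms cancel, and is therefore orthogonal
  to L. So x L' may be replaced by m L in the integral of (x L^2)' = L^2 + 2 x L L', whose value is
  2.\<close>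

lemma refint_legendre_square: "refint (legendre_poly m * legendre_poly m) = 2 / (2 * real m + 1)"
proof -
  let ?L = "legendre_poly m"
  define r where "r = [:0, 1:] * pderiv ?L - smult (real m) ?L"
  have "r = 0 \<or> degree r < m"
  proof (cases m)
    case 0
    then show ?thesis by (auto simp: r_def legendre_poly_def)
  next
    case (Suc m')
    have "degree r \<le> m" unfolding r_def using degree_legendre[of m] Suc
      by (intro degree_diff_le order_trans[OF degree_mult_le]) (auto simp: degree_pderiv)
    moreover have "coeff r m = 0"
      unfolding r_def using Suc by (simp add: coeff_pderiv)
    ultimately show ?thesis
      by (metis coeff_eq_0 leading_coeff_0_iff le_neq_implies_less)
  qed
  then have "refint (?L * r) = 0" by (rule refint_legendre_orthogonal)
  then have "refint (?L * ([:0, 1:] * pderiv ?L)) = real m * refint (?L * ?L)"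
    unfolding r_def by (simp only: right_diff_distrib refint_diff mult_smult_right refint_smult)
  moreover have "refint (pderiv ([:0, 1:] * (?L * ?L))) = 2"
    unfolding refint_pderiv by (simp add: poly_legendre_1 poly_legendre_minus_1 flip: power_add)
  moreover have "pderiv ([:0, 1:] * (?L * ?L)) = ?L * ?L + smult 2 (?L * ([:0, 1:] * pderiv ?L))"
    unfolding pderiv_mult by (simp add: pderiv_pCons algebra_simps smult_add_left[of 1 1, simplified] one_pCons[symmetric] numeral_poly)
  ultimately have "refint (?L * ?L) + 2 * (real m * refint (?L * ?L)) = 2"
    by (simp only: refint_add refint_smult)
  then have "refint (?L * ?L) * (2 * real m + 1) = 2" by (simp add: algebra_simps)
  moreover have "2 * real m + 1 > 0" by simp
  ultimately show ?thesis by (simp only: eq_divide_eq) simp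
qed

lemma refint_legendre_legendre:
  "refint (legendre_poly m * legendre_poly n) = (if m = n then 2 / (2 * real m + 1) else 0)"
proof -
  consider "m = n" | "n < m" | "m < n" by linarith
  then show ?thesis
  proof cases
    case 3
    then show ?thesis using refint_legendre_orthogonal[of "legendre_poly m" n]
      by (simp add: degree_legendre mult.commute)
  qed (simp_all add: refint_legendre_square refint_legendre_orthogonal degree_legendre)
qed

lemma legendre_span:
  assumes "degree p \<le> k"
  shows "\<exists>c. p = (\<Sum>m\<le>k. smult (c m) (legendre_poly m))"
  using assms
proof (induction k arbitrary: p)
  case 0
  have "legendre_poly 0 = 1" by (simp add: legendre_poly_def)
  moreover obtain a where "p = [:a:]" using 0 degree_eq_zeroE by auto
  ultimately show ?case by (intro exI[of _ "\<lambda>_. a"]) simp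
next
  case (Suc k)
  have lead: "coeff (legendre_poly (Suc k)) (Suc k) \<noteq> 0"
    using degree_legendre[of "Suc k"] by (metis degree_0 leading_coeff_0_iff nat.simps(3))
  define a where "a = coeff p (Suc k) / coeff (legendre_poly (Suc k)) (Suc k)"
  define q where "q = p - smult a (legendre_poly (Suc k))"
  have "degree q \<le> Suc k" unfolding q_def using Suc.prems degree_legendre[of "Suc k"]
    by (intro degree_diff_le) (auto intro: order_trans[OF degree_smult_le])
  moreover have "coeff q (Suc k) = 0" using lead by (simp add: q_def a_def)
  ultimately have "degree q \<le> k"
    by (metis coeff_eq_0 leading_coeff_0_iff le_Suc_eq degree_0 le0)
  then obtain c where c: "q = (\<Sum>m\<le>k. smult (c m) (legendre_poly m))" using Suc.IH by blast
  have "p = q + smult a (legendre_poly (Suc k))" by (simp add: q_def)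
  also have "\<dots> = (\<Sum>m\<le>Suc k. smult (if m = Suc k then a else c m) (legendre_poly m))"
    unfolding c by simp
  finally show ?case by (intro exI[of _ "\<lambda>m. if m = Suc k then a else c m"])
qed

lemma two_real_plus_1_nonzero [simp]: "2 * real m + 1 \<noteq> 0" "1 + 2 * real m \<noteq> 0" "1 + real m * 2 \<noteq> 0"
  by (simp_all add: add_nonneg_eq_0_iff)

text \<open>The parameters are the moments against the Legendre polynomials rather than the
  coefficients, because moments are what the projections prescribe.\<close>

definition legendre_sum :: "nat \<Rightarrow> (nat \<Rightarrow> real) \<Rightarrow> real poly" where
  "legendre_sum k c = (\<Sum>m\<le>k. smult ((2 * real m + 1) / 2 * c m) (legendre_poly m))"

lemma degree_legendre_sum: "degree (legendre_sum k c) \<le> k"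
  unfolding legendre_sum_def
  by (intro degree_sum_le) (auto intro!: order_trans[OF degree_smult_le] simp: degree_legendre)

lemma refint_legendre_sum:
  assumes "m \<le> k"
  shows "refint (legendre_sum k c * legendre_poly m) = c m"
proof -
  have "refint (legendre_sum k c * legendre_poly m)
      = (\<Sum>n\<le>k. (2 * real n + 1) / 2 * c n * (if n = m then 2 / (2 * real n + 1) else 0))"
    unfolding legendre_sum_def sum_distrib_right refint_sum mult_smult_left refint_smult
      refint_legendre_legendre ..
  also have "\<dots> = (\<Sum>n\<le>k. if n = m then c m else 0)"
    by (intro sum.cong) auto
  finally show ?thesis using assms by simp
qed

lemma legendre_expansion:
  assumes "degree p \<le> k"
  shows "p = legendre_sum k (\<lambda>m. refint (p * legendre_poly m))"
proof -
  obtain c where "p = (\<Sum>m\<le>k. smult (c m) (legendre_poly m))" using legendre_span[OF assms] by blast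
  also have "\<dots> = legendre_sum k (\<lambda>m. 2 / (2 * real m + 1) * c m)"
    unfolding legendre_sum_def by (intro sum.cong) auto
  finally have "p = legendre_sum k (\<lambda>m. 2 / (2 * real m + 1) * c m)" .
  moreover from this have "refint (p * legendre_poly m) = 2 / (2 * real m + 1) * c m" if "m \<le> k" for m
    using refint_legendre_sum[OF that] by metis
  ultimately show ?thesis unfolding legendre_sum_def by (metis (no_types, lifting) atMost_iff sum.cong)
qed

lemma refint_parseval:
  assumes "degree p \<le> k"
  shows "refint (p * p) = (\<Sum>m\<le>k. (2 * real m + 1) / 2 * (refint (p * legendre_poly m))\<^sup>2)"
proof -
  have "refint (p * p) = refint (p * legendre_sum k (\<lambda>m. refint (p * legendre_poly m)))"
    using legendre_expansion[OF assms] by simp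
  also have "\<dots> = (\<Sum>m\<le>k. (2 * real m + 1) / 2 * (refint (p * legendre_poly m))\<^sup>2)"
    unfolding legendre_sum_def sum_distrib_left refint_sum mult_smult_right refint_smult
    by (simp add: power2_eq_square mult.assoc)
  finally show ?thesis .
qed

lemma poly_legendre_sum_sign:
  assumes "s = 1 \<or> s = -1"
  shows "poly (legendre_sum k c) s = (\<Sum>m\<le>k. (2 * real m + 1) / 2 * c m * s ^ m)"
  unfolding legendre_sum_def poly_sum by (simp add: poly_legendre_sign[OF assms])

subsection \<open>Gauss--Radau projections on the reference cell\<close>

text \<open>The end point of the projection is \<open>s = 1\<close> or \<open>s = -1\<close>; \<open>radau_coeff\<close> is the reference version of
  the coefficients \<open>coeff_bar\<close> and \<open>coeff_tilde\<close>.\<close>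

definition radau_coeff :: "real \<Rightarrow> nat \<Rightarrow> real \<Rightarrow> (nat \<Rightarrow> real) \<Rightarrow> real" where
  "radau_coeff s k v c = s ^ k * ((\<Sum>m\<le>k. (2 * real m + 1) / 2 * c m * s ^ m) - v)"

text \<open>The L^2 projection with these moments, corrected at the end point \<open>s\<close>. A
  multiple of L_k does not change the moments below k, and L_k(s) = s^k is 1 or -1, so the value at
  \<open>s\<close> can be adjusted freely.\<close>

definition radau_from_moments :: "real \<Rightarrow> nat \<Rightarrow> real \<Rightarrow> (nat \<Rightarrow> real) \<Rightarrow> real poly" where
  "radau_from_moments s k v c = legendre_sum k c - smult (radau_coeff s k v c) (legendre_poly k)"

lemma radau_coeff_eq_0:
  assumes "s = 1 \<or> s = -1" "degree p \<le> k"
  shows "radau_coeff s k (poly p s) (\<lambda>m. refint (p * legendre_poly m)) = 0"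
proof -
  have "poly p s = (\<Sum>m\<le>k. (2 * real m + 1) / 2 * refint (p * legendre_poly m) * s ^ m)"
    using arg_cong[OF legendre_expansion[OF assms(2)], of "\<lambda>p. poly p s"]
    unfolding poly_legendre_sum_sign[OF assms(1)] .
  then show ?thesis unfolding radau_coeff_def by simp
qed

lemma degree_radau_from_moments: "degree (radau_from_moments s k v c) \<le> k"
  unfolding radau_from_moments_def
  by (intro degree_diff_le degree_legendre_sum order_trans[OF degree_smult_le]) (simp add: degree_legendre)

lemma poly_radau_from_moments:
  assumes "s = 1 \<or> s = -1"
  shows "poly (radau_from_moments s k v c) s = v"
proof -
  have "s ^ k * s ^ k = 1" using assms by (auto simp flip: power_add)
  then have "radau_coeff s k v c * s ^ k = (\<Sum>m\<le>k. (2 * real m + 1) / 2 * c m * s ^ m) - v"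
    unfolding radau_coeff_def by (simp add: ac_simps flip: mult.assoc)
  then show ?thesis unfolding radau_from_moments_def
    by (simp add: poly_legendre_sum_sign[OF assms] poly_legendre_sign[OF assms])
qed

lemma refint_radau_from_moments:
  assumes "m < k"
  shows "refint (radau_from_moments s k v c * legendre_poly m) = c m"
  using assms refint_legendre_legendre[of k m]
  by (simp add: radau_from_moments_def left_diff_distrib refint_diff refint_legendre_sum refint_smult)

text \<open>The difference of two candidates has no moments below k, hence is a multiple of L_k; it
  vanishes at \<open>s\<close>, where L_k does not.\<close>

lemma radau_from_moments_unique:
  assumes s: "s = 1 \<or> s = -1" and deg: "degree p \<le> k"
    and mom: "\<And>m. m < k \<Longrightarrow> refint (p * legendre_poly m) = c m" and v: "poly p s = v"
  shows "p = radau_from_moments s k v c"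
proof -
  define e where "e = p - radau_from_moments s k v c"
  have dege: "degree e \<le> k" unfolding e_def by (intro degree_diff_le deg degree_radau_from_moments)
  have "refint (e * legendre_poly m) = 0" if "m < k" for m
    using that by (simp add: e_def left_diff_distrib refint_diff refint_radau_from_moments mom)
  then have "(\<Sum>m\<le>k. smult ((2 * real m + 1) / 2 * refint (e * legendre_poly m)) (legendre_poly m))
      = smult ((2 * real k + 1) / 2 * refint (e * legendre_poly k)) (legendre_poly k)"
    by (cases k) (simp_all add: lessThan_Suc_atMost[symmetric])
  then have e: "e = smult ((2 * real k + 1) / 2 * refint (e * legendre_poly k)) (legendre_poly k)"
    using legendre_expansion[OF dege] unfolding legendre_sum_def by metis
  define a where "a = (2 * real k + 1) / 2 * refint (e * legendre_poly k)"
  have "poly e s = 0" unfolding e_def by (simp add: v poly_radau_from_moments[OF s])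
  then have "poly (smult a (legendre_poly k)) s = 0" using e unfolding a_def by simp
  moreover have "s ^ k \<noteq> 0" using s by auto
  ultimately have "a = 0" using s by (auto simp: poly_legendre_sign[OF s])
  then have "e = 0" using e unfolding a_def[symmetric] by simp
  then show ?thesis by (simp add: e_def)
qed

definition ref_radau :: "real \<Rightarrow> nat \<Rightarrow> real poly \<Rightarrow> real poly" where
  "ref_radau s k p = radau_from_moments s k (poly p s) (\<lambda>m. refint (p * legendre_poly m))"

lemma refint_ref_radau:
  assumes "degree w < k"
  shows "refint (ref_radau s k p * w) = refint (p * w)"
proof -
  have "w = legendre_sum (k - 1) (\<lambda>m. refint (w * legendre_poly m))"
    by (rule legendre_expansion) (use assms in simp)
  moreover have "refint (ref_radau s k p * legendre_sum (k - 1) c) = refint (p * legendre_sum (k - 1) c)" for c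
    unfolding legendre_sum_def sum_distrib_left refint_sum mult_smult_right refint_smult ref_radau_def
    using assms by (intro sum.cong refl) (simp add: refint_radau_from_moments)
  ultimately show ?thesis by metis
qed

text \<open>Both families of correction polynomials of the interpolants, \<open>F\<^sub>1, F\<^sub>2\<close> and their barred versions,
  are members of this single family.\<close>

fun corr :: "real \<Rightarrow> nat \<Rightarrow> nat \<Rightarrow> real poly" where
  "corr s k 0 = legendre_poly k"
| "corr s k (Suc n) = ref_radau s k (primitive (corr (- s) k n))"

lemma degree_corr: "degree (corr s k n) \<le> k"
  by (cases n) (auto simp: degree_legendre ref_radau_def degree_radau_from_moments)

text \<open>Every step of the recursion costs one degree of orthogonality. Integration by parts
  moves the primitive onto w, and the boundary terms vanish: at -1 by normalisation, at 1 because
  the previous polynomial is orthogonal to constants. The projection preserves integrals against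
  degrees below k.\<close>

lemma refint_corr_orthogonal:
  assumes "degree w + n < k"
  shows "refint (corr s k n * w) = 0"
  using assms
proof (induction n arbitrary: s w)
  case 0
  then show ?case by (simp add: refint_legendre_orthogonal)
next
  case (Suc n)
  have "poly (primitive (corr (- s) k n)) 1 = 0"
    using Suc.IH[of 1 "- s"] Suc.prems by (simp add: refint_def)
  then have "refint (primitive (corr (- s) k n) * w) = - refint (corr (- s) k n * primitive w)"
    using refint_by_parts[of "primitive w" "primitive (corr (- s) k n)"]
    by (simp add: mult.commute)
  also have "\<dots> = 0" using Suc.IH[of "primitive w"] Suc.prems degree_primitive_le[of w] by simp
  finally show ?case using Suc.prems by (simp add: refint_ref_radau)
qed

lemma poly_primitive_corr_1: "n < k \<Longrightarrow> poly (primitive (corr s k n)) 1 = 0"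
  using refint_corr_orthogonal[of 1 n k s] by (simp add: refint_def)

text \<open>Hence the corrections do not disturb the traces that enter the numerical fluxes.\<close>

lemma poly_corr_end:
  assumes "s = 1 \<or> s = -1" "1 \<le> n" "n \<le> k"
  shows "poly (corr s k n) s = 0"
  using assms poly_primitive_corr_1[of "n - 1" k "- s"]
  by (cases n) (auto simp: ref_radau_def poly_radau_from_moments)

text \<open>The cancellation mechanism: correction n + 1 seen through the derivative term of the
  scheme compensates correction n of the other unknown seen through the mass term.\<close>

lemma refint_corr_Suc_pderiv:
  assumes "n < k" "degree w \<le> k"
  shows "refint (corr s k (Suc n) * pderiv w) = - refint (corr (- s) k n * w)"
proof -
  have "degree (pderiv w) < k" using assms by (simp add: degree_pderiv)
  then have "refint (corr s k (Suc n) * pderiv w) = refint (pderiv w * primitive (corr (- s) k n))"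
    using refint_ref_radau[of "pderiv w" k s "primitive (corr (- s) k n)"] by (simp add: mult.commute)
  then show ?thesis using poly_primitive_corr_1[OF assms(1), of "- s"]
    by (simp add: refint_by_parts mult.commute)
qed

lemma refint_corr_0_pderiv:
  assumes "0 < k" "degree w \<le> k"
  shows "refint (corr s k 0 * pderiv w) = 0"
proof -
  have "degree (pderiv w) < k" using assms by (auto simp: degree_pderiv)
  then show ?thesis by (simp add: refint_legendre_orthogonal)
qed

section \<open>Functions on one cell\<close>

definition cellmap :: "(nat \<Rightarrow> real) \<Rightarrow> nat \<Rightarrow> real \<Rightarrow> real" where
  "cellmap xs j x = (x - midpt xs j) / half_size xs j"

definition cint :: "(nat \<Rightarrow> real) \<Rightarrow> nat \<Rightarrow> (real \<Rightarrow> real) \<Rightarrow> real poly \<Rightarrow> real" where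
  "cint xs j f w = integral (cell xs j) (\<lambda>x. f x * poly w (cellmap xs j x)) / half_size xs j"

definition cell_end :: "(nat \<Rightarrow> real) \<Rightarrow> nat \<Rightarrow> real \<Rightarrow> real" where
  "cell_end xs j s = (if s = 1 then xs (Suc j) else xs j)"

text \<open>Common form of \<open>coeff_bar\<close> (s = 1) and \<open>coeff_tilde\<close> (s = -1),
  see \<open>coeff_bar_eq\<close> and \<open>coeff_tilde_eq\<close>. It is the multiple of L_k by
  which the Gauss--Radau projection differs from the L^2 projection.\<close>

definition kap :: "real \<Rightarrow> nat \<Rightarrow> (nat \<Rightarrow> real) \<Rightarrow> nat \<Rightarrow> (real \<Rightarrow> real) \<Rightarrow> real" where
  "kap s k xs j f = radau_coeff s k (f (cell_end xs j s)) (\<lambda>m. cint xs j f (legendre_poly m))"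

lemma integral_cell: "integral (cell xs j) (f :: real \<Rightarrow> real) = integral {xs j..xs (Suc j)} f"
  unfolding cell_def using integral_open_interval_real[of "xs j" "xs (Suc j)" f] by simp

lemma cint_cong: "(\<And>x. x \<in> cell xs j \<Longrightarrow> f x = g x) \<Longrightarrow> cint xs j f w = cint xs j g w"
  unfolding cint_def by (metis (no_types, lifting) integral_cong)

locale mesh_cell =
  fixes xs :: "nat \<Rightarrow> real" and j :: nat
  assumes cell_lt: "xs j < xs (Suc j)"
begin

abbreviation "a \<equiv> xs j"
abbreviation "b \<equiv> xs (Suc j)"
abbreviation "hb \<equiv> half_size xs j"
abbreviation "\<xi> \<equiv> cellmap xs j"

lemma hb_pos: "hb > 0"
  using cell_lt by (simp add: half_size_def cell_size_def)

lemma hb_eq: "b - a = 2 * hb" by (simp add: half_size_def cell_size_def)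

lemma \<xi>_a [simp]: "\<xi> a = -1" and \<xi>_b [simp]: "\<xi> b = 1"
  using hb_pos cell_lt unfolding cellmap_def midpt_def half_size_def cell_size_def by (auto simp: field_simps)

lemma \<xi>_cell_end: "s = 1 \<or> s = -1 \<Longrightarrow> \<xi> (cell_end xs j s) = s"
  by (auto simp: cell_end_def)

lemma cell_end_mem: "cell_end xs j s \<in> {a..b}"
  using cell_lt by (auto simp: cell_end_def)

lemma \<xi>_range: "x \<in> {a..b} \<Longrightarrow> \<xi> x \<in> {-1..1}"
  using hb_pos unfolding cellmap_def midpt_def half_size_def cell_size_def by (auto simp: field_simps)

lemma \<xi>_deriv: "(\<xi> has_real_derivative 1 / hb) (at x within S)"
  unfolding cellmap_def using hb_pos by (auto intro!: derivative_eq_intros)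

lemma poly_\<xi>_deriv: "((\<lambda>x. poly p (\<xi> x)) has_real_derivative poly (pderiv p) (\<xi> x) / hb) (at x within S)"
  using DERIV_chain2[OF poly_DERIV \<xi>_deriv, of p x S] by simp

lemma continuous_on_poly_\<xi> [continuous_intros]: "continuous_on S (\<lambda>x. poly p (\<xi> x))"
  unfolding cellmap_def using hb_pos by (intro continuous_intros) auto

lemma cell_subset: "cell xs j \<subseteq> {a..b}" by (auto simp: cell_def)

lemma integrable_times_poly:
  assumes "continuous_on {a..b} f"
  shows "(\<lambda>x. f x * poly w (\<xi> x)) integrable_on {a..b}"
  by (intro integrable_continuous_interval continuous_intros assms)

lemma cint_by_parts:
  assumes "\<And>x. x \<in> {a..b} \<Longrightarrow> (f has_real_derivative f' x) (at x within {a..b})"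
    and cf': "continuous_on {a..b} f'"
  shows "cint xs j f' w = (f b * poly w 1 - f a * poly w (-1) - cint xs j f (pderiv w)) / hb"
proof -
  have cf: "continuous_on {a..b} f" using assms(1) by (meson DERIV_continuous_on)
  have "((\<lambda>x. f' x * poly w (\<xi> x) + f x * (poly (pderiv w) (\<xi> x) / hb)) has_integral
      f b * poly w (\<xi> b) - f a * poly w (\<xi> a)) {a..b}"
  proof (rule fundamental_theorem_of_calculus)
    show "((\<lambda>x. f x * poly w (\<xi> x)) has_vector_derivative
        f' x * poly w (\<xi> x) + f x * (poly (pderiv w) (\<xi> x) / hb)) (at x within {a..b})"
      if "x \<in> {a..b}" for x
      unfolding has_real_derivative_iff_has_vector_derivative[symmetric]
      using DERIV_mult[OF assms(1)[OF that] poly_\<xi>_deriv[of w x "{a..b}"]] by (simp add: ac_simps)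
  qed (use cell_lt in simp)
  then have "integral {a..b} (\<lambda>x. f' x * poly w (\<xi> x) + f x * poly (pderiv w) (\<xi> x) / hb)
      = f b * poly w 1 - f a * poly w (-1)" by (simp add: integral_unique)
  moreover have "integral {a..b} (\<lambda>x. f' x * poly w (\<xi> x) + f x * poly (pderiv w) (\<xi> x) / hb)
      = integral {a..b} (\<lambda>x. f' x * poly w (\<xi> x)) + integral {a..b} (\<lambda>x. f x * poly (pderiv w) (\<xi> x)) / hb"
    by (subst Henstock_Kurzweil_Integration.integral_add)
      (auto intro!: integrable_times_poly cf cf' integrable_on_divide simp: integral_divide)
  ultimately have "integral {a..b} (\<lambda>x. f' x * poly w (\<xi> x))
     = f b * poly w 1 - f a * poly w (-1) - integral {a..b} (\<lambda>x. f x * poly (pderiv w) (\<xi> x)) / hb"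
    by simp
  then show ?thesis unfolding cint_def integral_cell by simp
qed

lemma cint_poly: "cint xs j (\<lambda>x. poly p (\<xi> x)) w = refint (p * w)"
proof -
  have "((\<lambda>x. poly (p * w) (\<xi> x) / hb) has_integral
      poly (primitive (p * w)) (\<xi> b) - poly (primitive (p * w)) (\<xi> a)) {a..b}"
    by (rule fundamental_theorem_of_calculus)
      (use cell_lt poly_\<xi>_deriv[of "primitive (p * w)"] in
        \<open>auto simp: has_real_derivative_iff_has_vector_derivative[symmetric]\<close>)
  then have "integral {a..b} (\<lambda>x. poly p (\<xi> x) * poly w (\<xi> x)) / hb = refint (p * w)"
    by (simp add: refint_def integral_unique flip: integral_divide)
  then show ?thesis unfolding cint_def integral_cell .
qed

lemma cint_diff:
  assumes "continuous_on {a..b} f" "continuous_on {a..b} g"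
  shows "cint xs j (\<lambda>x. f x - g x) w = cint xs j f w - cint xs j g w"
  unfolding cint_def integral_cell left_diff_distrib
  by (subst Henstock_Kurzweil_Integration.integral_diff)
    (auto intro!: integrable_times_poly assms simp: diff_divide_distrib)

lemma cint_sum_right:
  assumes "continuous_on {a..b} f" "finite A"
  shows "cint xs j f (\<Sum>i\<in>A. smult (c i) (w i)) = (\<Sum>i\<in>A. c i * cint xs j f (w i))"
proof -
  have "(\<lambda>x. f x * poly (\<Sum>i\<in>A. smult (c i) (w i)) (\<xi> x))
      = (\<lambda>x. \<Sum>i\<in>A. c i * (f x * poly (w i) (\<xi> x)))"
    by (auto simp: poly_sum sum_distrib_left mult_ac)
  then have "integral {a..b} (\<lambda>x. f x * poly (\<Sum>i\<in>A. smult (c i) (w i)) (\<xi> x))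
      = (\<Sum>i\<in>A. integral {a..b} (\<lambda>x. c i * (f x * poly (w i) (\<xi> x))))"
    using assms by (simp only:) (intro integral_sum, auto intro!: continuous_intros integrable_continuous_interval)
  then show ?thesis unfolding cint_def integral_cell by (simp add: sum_divide_distrib)
qed

lemma abs_cint_le:
  assumes f: "continuous_on {a..b} f" and B: "\<And>x. x \<in> {a..b} \<Longrightarrow> \<bar>f x\<bar> \<le> B"
    and w: "\<And>y. y \<in> {-1..1} \<Longrightarrow> \<bar>poly w y\<bar> \<le> A"
  shows "\<bar>cint xs j f w\<bar> \<le> 2 * (A * B)"
proof -
  have A0: "A \<ge> 0" using w[of 0] by simp
  have "norm (integral {a..b} (\<lambda>x. f x * poly w (\<xi> x))) \<le> integral {a..b} (\<lambda>_. A * B)"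
  proof (rule integral_norm_bound_integral)
    show "(\<lambda>x. f x * poly w (\<xi> x)) integrable_on {a..b}" using integrable_times_poly[OF f] by simp
    show "norm (f x * poly w (\<xi> x)) \<le> A * B" if "x \<in> {a..b}" for x
      using mult_mono[OF w[OF \<xi>_range] B A0, of x x] that by (simp add: abs_mult mult.commute)
  qed (rule integrable_const_ivl)
  then show ?thesis unfolding cint_def integral_cell using hb_pos hb_eq cell_lt
    by (simp add: field_simps)
qed

lemma kap_diff:
  assumes "continuous_on {a..b} f" "continuous_on {a..b} g"
  shows "kap s k xs j (\<lambda>x. f x - g x) = kap s k xs j f - kap s k xs j g"
  unfolding kap_def radau_coeff_def cint_diff[OF assms]
  by (simp add: algebra_simps sum_subtractf)

lemma kap_poly:
  assumes "s = 1 \<or> s = -1" "degree p \<le> k"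
  shows "kap s k xs j (\<lambda>x. poly p (\<xi> x)) = 0"
  using radau_coeff_eq_0[OF assms] by (simp add: kap_def cint_poly \<xi>_cell_end[OF assms(1)])

lemma ex_poly_\<xi>: "\<exists>q. degree q = degree p \<and> (\<forall>x. poly p x = poly q (\<xi> x))"
proof (intro exI conjI allI)
  let ?q = "pcompose p [:midpt xs j, hb:]"
  show "degree ?q = degree p" using hb_pos by (simp add: degree_pcompose)
  show "poly p x = poly ?q (\<xi> x)" for x
    using hb_pos by (simp add: poly_pcompose cellmap_def)
qed

lemma ex_poly_unscaled: "\<exists>q. degree q = degree p \<and> (\<forall>x. poly q x = poly p (\<xi> x))"
proof (intro exI conjI allI)
  let ?q = "pcompose p [:- midpt xs j / hb, 1 / hb:]"
  show "degree ?q = degree p" using hb_pos by (simp add: degree_pcompose)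
  show "poly ?q x = poly p (\<xi> x)" for x
    using hb_pos by (simp add: poly_pcompose cellmap_def diff_divide_distrib)
qed

lemma trace_left_eq:
  assumes "\<forall>x\<in>cell xs j. v x = V x" "continuous_on {a..b} V"
  shows "trace_left xs v (Suc j) = V b"
proof -
  have "(V \<longlongrightarrow> V b) (at b within {a..b})"
    using assms(2) cell_lt by (auto simp: continuous_on)
  then have "(V \<longlongrightarrow> V b) (at_left b)"
    using cell_lt by (simp add: at_within_Icc_at_left)
  moreover have "eventually (\<lambda>x. V x = v x) (at_left b)"
    using cell_lt assms(1) by (auto simp: eventually_at_left cell_def)
  ultimately have "(v \<longlongrightarrow> V b) (at_left b)" by (rule Lim_transform_eventually)
  then show ?thesis unfolding trace_left_def by (intro tendsto_Lim) auto
qed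

lemma trace_right_eq:
  assumes "\<forall>x\<in>cell xs j. v x = V x" "continuous_on {a..b} V"
  shows "trace_right xs v j = V a"
proof -
  have "(V \<longlongrightarrow> V a) (at a within {a..b})"
    using assms(2) cell_lt by (auto simp: continuous_on)
  then have "(V \<longlongrightarrow> V a) (at_right a)"
    using cell_lt by (simp add: at_within_Icc_at_right)
  moreover have "eventually (\<lambda>x. V x = v x) (at_right a)"
    using cell_lt assms(1) by (auto simp: eventually_at_right cell_def)
  ultimately have "(v \<longlongrightarrow> V a) (at_right a)" by (rule Lim_transform_eventually)
  then show ?thesis unfolding trace_right_def by (intro tendsto_Lim) auto
qed

section \<open>Gauss--Radau projections and correction functions on a physical cell\<close>

definition radau :: "real \<Rightarrow> nat \<Rightarrow> (real \<Rightarrow> real) \<Rightarrow> real poly" where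
  "radau s k V = radau_from_moments s k (V (cell_end xs j s)) (\<lambda>m. cint xs j V (legendre_poly m))"

text \<open>The projections see a function only in the open cell and through a trace. They are
  evaluated by means of a continuous \<open>V\<close> on the closed cell, because the functions they
  are applied to are known in good form only inside the cell.\<close>

lemma the_radau:
  assumes s: "s = 1 \<or> s = -1" and k: "1 \<le> k" and v: "\<forall>x\<in>cell xs j. v x = V x"
    and V: "continuous_on {a..b} V"
  shows "poly (THE p. degree p \<le> k \<and>
     (\<forall>w. degree w \<le> k - 1 \<longrightarrow>
        integral (cell xs j) (\<lambda>x. poly p x * poly w x) = integral (cell xs j) (\<lambda>x. v x * poly w x)) \<and>
     poly p (cell_end xs j s) = V (cell_end xs j s)) = (\<lambda>x. poly (radau s k V) (\<xi> x))"
    (is "poly (THE p. ?Q p) = _")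
proof -
  have mom: "integral (cell xs j) (\<lambda>x. v x * poly w (\<xi> x)) = hb * cint xs j V w" for w
    using cint_cong[of xs j v V w] v hb_pos by (simp add: cint_def)
  have momp: "integral (cell xs j) (\<lambda>x. poly q (\<xi> x) * poly w (\<xi> x)) = hb * refint (q * w)" for q w
    using cint_poly[of q w] hb_pos by (simp add: cint_def field_simps)
  obtain p where p: "degree p = degree (radau s k V)" "\<forall>x. poly p x = poly (radau s k V) (\<xi> x)"
    using ex_poly_unscaled by blast
  have "?Q p"
  proof (intro conjI allI impI)
    show "degree p \<le> k" unfolding p radau_def by (rule degree_radau_from_moments)
    show "poly p (cell_end xs j s) = V (cell_end xs j s)"
      unfolding p(2)[rule_format] \<xi>_cell_end[OF s] radau_def by (rule poly_radau_from_moments[OF s])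
    fix w :: "real poly" assume w: "degree w \<le> k - 1"
    obtain w' where w': "degree w' = degree w" "\<forall>x. poly w x = poly w' (\<xi> x)" using ex_poly_\<xi> by blast
    have e: "w' = (\<Sum>m\<le>k - 1. smult ((2 * real m + 1) / 2 * refint (w' * legendre_poly m)) (legendre_poly m))"
      using legendre_expansion[of w' "k - 1"] w w' by (simp add: legendre_sum_def)
    have "refint (radau s k V * w') = cint xs j V w'"
      by (subst (1 2) e) (use k in \<open>auto simp: cint_sum_right[OF V] sum_distrib_left refint_sum
        refint_smult radau_def refint_radau_from_moments intro!: sum.cong\<close>)
    then show "integral (cell xs j) (\<lambda>x. poly p x * poly w x) = integral (cell xs j) (\<lambda>x. v x * poly w x)"
      unfolding p(2)[rule_format] w'(2)[rule_format] momp mom by simp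
  qed
  moreover have "q = p" if q: "?Q q" for q
  proof -
    obtain r where r: "degree r = degree q" "\<forall>x. poly q x = poly r (\<xi> x)" using ex_poly_\<xi> by blast
    have "r = radau s k V" unfolding radau_def
    proof (rule radau_from_moments_unique[OF s])
      show "degree r \<le> k" using q r by simp
      show "poly r s = V (cell_end xs j s)" using q r(2) by (metis \<xi>_cell_end[OF s])
      fix m assume m: "m < k"
      obtain w where w: "degree w = degree (legendre_poly m)" "\<forall>x. poly w x = poly (legendre_poly m) (\<xi> x)"
        using ex_poly_unscaled by blast
      have "degree w \<le> k - 1" using w m by (simp add: degree_legendre)
      then have "integral (cell xs j) (\<lambda>x. poly q x * poly w x) = integral (cell xs j) (\<lambda>x. v x * poly w x)"
        using q by blast
      then show "refint (r * legendre_poly m) = cint xs j V (legendre_poly m)"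
        unfolding r(2)[rule_format] w(2)[rule_format] momp mom using hb_pos by simp
    qed
    then have "poly q = poly p" using r p by auto
    then show ?thesis by (simp add: poly_eq_poly_eq_iff)
  qed
  ultimately have "(THE p. ?Q p) = p" by (rule the_equality)
  then show ?thesis using p by (auto simp: fun_eq_iff)
qed

lemma radau_minus_eq:
  assumes "1 \<le> k" "\<forall>x\<in>cell xs j. v x = V x" "continuous_on {a..b} V"
  shows "radau_minus k xs j v = (\<lambda>x. poly (radau 1 k V) (\<xi> x))"
  using the_radau[of 1 k v V] assms unfolding radau_minus_def trace_left_eq[OF assms(2,3)]
  by (simp add: cell_end_def)

lemma radau_plus_eq:
  assumes "1 \<le> k" "\<forall>x\<in>cell xs j. v x = V x" "continuous_on {a..b} V"
  shows "radau_plus k xs j v = (\<lambda>x. poly (radau (-1) k V) (\<xi> x))"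
  using the_radau[of "-1" k v V] assms unfolding radau_plus_def trace_right_eq[OF assms(2,3)]
  by (simp add: cell_end_def)

lemma radau_poly:
  assumes "s = 1 \<or> s = -1"
  shows "radau s k (\<lambda>x. poly p (\<xi> x)) = ref_radau s k p"
  unfolding radau_def ref_radau_def cint_poly \<xi>_cell_end[OF assms] ..

lemma coeff_sum:
  assumes "\<forall>x\<in>cell xs j. v x = V x" "continuous_on {a..b} V"
  shows "1 / cell_size xs j * integral (cell xs j) (\<lambda>x. v x * (\<Sum>m=0..k. c m * legendre_cell xs j m x))
    = (\<Sum>m\<le>k. c m / 2 * cint xs j V (legendre_poly m))"
proof -
  have "(\<lambda>x. v x * (\<Sum>m=0..k. c m * legendre_cell xs j m x))
      = (\<lambda>x. v x * poly (\<Sum>m\<le>k. smult (c m) (legendre_poly m)) (\<xi> x))"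
    by (simp add: poly_sum legendre_cell_def cellmap_def atLeast0AtMost)
  then have "integral (cell xs j) (\<lambda>x. v x * (\<Sum>m=0..k. c m * legendre_cell xs j m x))
      = hb * cint xs j V (\<Sum>m\<le>k. smult (c m) (legendre_poly m))"
    using cint_cong[of xs j v V] assms(1) hb_pos by (simp add: cint_def)
  then show ?thesis using hb_pos
    by (simp add: cint_sum_right[OF assms(2)] half_size_def field_simps sum_distrib_left sum_divide_distrib)
qed

lemma coeff_bar_eq:
  assumes "\<forall>x\<in>cell xs j. v x = V x" "continuous_on {a..b} V"
  shows "coeff_bar k xs j v = kap 1 k xs j V"
  unfolding coeff_bar_def coeff_sum[OF assms] trace_left_eq[OF assms] kap_def radau_coeff_def
  by (simp add: cell_end_def)

lemma coeff_tilde_eq: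
  assumes "\<forall>x\<in>cell xs j. v x = V x" "continuous_on {a..b} V"
  shows "coeff_tilde k xs j v = kap (-1) k xs j V"
  unfolding coeff_tilde_def coeff_sum[OF assms] trace_right_eq[OF assms] kap_def radau_coeff_def
  by (simp add: cell_end_def right_diff_distrib power_add sum_distrib_left mult_ac)

lemma Ds_inv_poly:
  assumes "x \<ge> a"
  shows "Ds_inv xs j (\<lambda>x. poly p (\<xi> x)) x = poly (primitive p) (\<xi> x)"
proof -
  have "((\<lambda>x. poly p (\<xi> x) / hb) has_integral
      poly (primitive p) (\<xi> x) - poly (primitive p) (\<xi> a)) {a..x}"
    by (rule fundamental_theorem_of_calculus)
      (use assms poly_\<xi>_deriv[of "primitive p"] in
        \<open>auto simp: has_real_derivative_iff_has_vector_derivative[symmetric]\<close>)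
  then have "integral {a..x} (\<lambda>x. poly p (\<xi> x)) / hb = poly (primitive p) (\<xi> x)"
    by (simp add: integral_unique flip: integral_divide)
  then show ?thesis by (simp add: Ds_inv_def)
qed

lemma radau_plus_Ds_inv:
  assumes "1 \<le> k"
  shows "radau_plus k xs j (Ds_inv xs j (\<lambda>x. poly p (\<xi> x))) = (\<lambda>x. poly (ref_radau (-1) k (primitive p)) (\<xi> x))"
  unfolding radau_poly[of "-1" k "primitive p", simplified, symmetric]
  by (rule radau_plus_eq[OF assms]) (auto intro!: Ds_inv_poly continuous_intros simp: cell_def)

lemma radau_minus_Ds_inv:
  assumes "1 \<le> k"
  shows "radau_minus k xs j (Ds_inv xs j (\<lambda>x. poly p (\<xi> x))) = (\<lambda>x. poly (ref_radau 1 k (primitive p)) (\<xi> x))"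
  unfolding radau_poly[of 1 k "primitive p", simplified, symmetric]
  by (rule radau_minus_eq[OF assms]) (auto intro!: Ds_inv_poly continuous_intros simp: cell_def)

text \<open>One step from \<open>F1\<close> to the next applies a minus and then a plus projection,
  so it raises the index of \<open>corr\<close> by two and restores the sign. The unbarred functions
  are thus the odd members, the barred ones the even members with the opposite sign.\<close>

lemma F1_eq:
  assumes "1 \<le> k"
  shows "F1 k xs j (Suc i) = (\<lambda>x. poly (corr (-1) k (Suc (2 * i))) (\<xi> x))"
proof (induction i)
  case 0
  show ?case using radau_plus_Ds_inv[OF assms, of "legendre_poly k"]
    by (simp add: F1_def legendre_cell_def[abs_def] cellmap_def)
next
  case (Suc i)
  have "F1 k xs j (Suc (Suc i))
      = radau_plus k xs j (Ds_inv xs j (radau_minus k xs j (Ds_inv xs j (F1 k xs j (Suc i)))))"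
    by (simp add: F1_def)
  then show ?case unfolding Suc radau_plus_Ds_inv[OF assms] radau_minus_Ds_inv[OF assms] by simp
qed

lemma F2_eq:
  assumes "1 \<le> k"
  shows "F2 k xs j (Suc i) = (\<lambda>x. poly (corr 1 k (Suc (2 * i))) (\<xi> x))"
proof (induction i)
  case 0
  show ?case using radau_minus_Ds_inv[OF assms, of "legendre_poly k"]
    by (simp add: F2_def legendre_cell_def[abs_def] cellmap_def)
next
  case (Suc i)
  have "F2 k xs j (Suc (Suc i))
      = radau_minus k xs j (Ds_inv xs j (radau_plus k xs j (Ds_inv xs j (F2 k xs j (Suc i)))))"
    by (simp add: F2_def)
  then show ?case unfolding Suc radau_plus_Ds_inv[OF assms] radau_minus_Ds_inv[OF assms] by simp
qed

lemma F1_bar_eq: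
  assumes "1 \<le> k"
  shows "F1_bar k xs j (Suc i) = (\<lambda>x. poly (corr 1 k (Suc (Suc (2 * i)))) (\<xi> x))"
  unfolding F1_bar_def F1_eq[OF assms] radau_minus_Ds_inv[OF assms] by simp

lemma F2_bar_eq:
  assumes "1 \<le> k"
  shows "F2_bar k xs j (Suc i) = (\<lambda>x. poly (corr (-1) k (Suc (Suc (2 * i)))) (\<xi> x))"
  unfolding F2_bar_def F2_eq[OF assms] radau_plus_Ds_inv[OF assms] by simp

end

section \<open>Polynomial approximation and bounds for the coefficients\<close>

lemma poly_bounded_interval: "\<exists>A\<ge>0. \<forall>y\<in>{-1..1}. \<bar>poly p y\<bar> \<le> (A::real)"
proof -
  have "compact (poly p ` {-1..1})" by (intro compact_continuous_image continuous_intros) auto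
  then obtain A where "\<forall>y\<in>{-1..1}. norm (poly p y) \<le> A"
    by (meson bounded_iff compact_imp_bounded imageI)
  then show ?thesis by (intro exI[of _ "max A 0"]) (auto intro: order_trans[OF _ max.cobounded1])
qed

text \<open>Bramble--Hilbert: the coefficient functionals annihilate polynomials of degree \<open>k\<close>.\<close>

lemma kap_bound:
  "\<exists>C>0. \<forall>s (xs :: nat \<Rightarrow> real) j f p B. (s = 1 \<or> s = -1) \<and> xs j < xs (Suc j) \<and> continuous_on {xs j..xs (Suc j)} f \<and>
     degree p \<le> k \<and> (\<forall>x\<in>{xs j..xs (Suc j)}. \<bar>f x - poly p x\<bar> \<le> B) \<longrightarrow> \<bar>kap s k xs j f\<bar> \<le> C * B"
proof -
  have "\<exists>A. \<forall>m. A m \<ge> 0 \<and> (\<forall>y\<in>{-1..1}. \<bar>poly (legendre_poly m) y\<bar> \<le> A m)"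
    using poly_bounded_interval[of "legendre_poly _"] by (intro choice) blast
  then obtain A where A: "\<And>m. A m \<ge> 0" "\<And>m y. y \<in> {-1..1} \<Longrightarrow> \<bar>poly (legendre_poly m) y\<bar> \<le> A m"
    by blast
  \<comment> \<open>The 1 accounts for the end point value; in the moments the length 2 of the
    reference cell cancels the 1/2 in \<open>radau_coeff\<close>.\<close>
  define C where "C = 1 + (\<Sum>m\<le>k. (2 * real m + 1) * A m)"
  show ?thesis
  proof (intro exI[of _ C] conjI allI impI)
    show "C > 0" unfolding C_def using A(1) by (intro add_pos_nonneg sum_nonneg) auto
    fix s :: real and xs :: "nat \<Rightarrow> real" and j f p B
    assume H: "(s = 1 \<or> s = -1) \<and> xs j < xs (Suc j) \<and> continuous_on {xs j..xs (Suc j)} f \<and>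
      degree p \<le> k \<and> (\<forall>x\<in>{xs j..xs (Suc j)}. \<bar>f x - poly p x\<bar> \<le> B)"
    interpret mesh_cell xs j using H by unfold_locales auto
    obtain q where q: "degree q = degree p" "\<forall>x. poly p x = poly q (\<xi> x)" using ex_poly_\<xi> by blast
    define g where "g x = f x - poly p x" for x
    have cg: "continuous_on {a..b} g" unfolding g_def using H by (intro continuous_intros) auto
    have gB: "\<bar>g x\<bar> \<le> B" if "x \<in> {a..b}" for x using H that unfolding g_def by auto
    have "kap s k xs j f = kap s k xs j g"
      using kap_diff[of f "\<lambda>x. poly q (\<xi> x)" s k] kap_poly[of s q k] H q
      by (simp add: g_def[abs_def] continuous_on_poly_\<xi>)
    moreover have "\<bar>kap s k xs j g\<bar> \<le> (\<Sum>m\<le>k. (2 * real m + 1) * A m * B) + B"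
    proof -
      have s1: "\<bar>s ^ n\<bar> = 1" for n using H by (auto simp: power_abs)
      have "\<bar>kap s k xs j g\<bar> \<le> \<bar>\<Sum>m\<le>k. (2 * real m + 1) / 2 * cint xs j g (legendre_poly m) * s ^ m\<bar> + \<bar>g (cell_end xs j s)\<bar>"
        unfolding kap_def radau_coeff_def abs_mult s1 by simp
      also have "\<dots> \<le> (\<Sum>m\<le>k. \<bar>(2 * real m + 1) / 2 * cint xs j g (legendre_poly m) * s ^ m\<bar>) + B"
        by (intro add_mono sum_abs gB cell_end_mem)
      also have "\<dots> \<le> (\<Sum>m\<le>k. (2 * real m + 1) * A m * B) + B"
      proof (intro add_mono sum_mono order_refl)
        fix m
        have "\<bar>(2 * real m + 1) / 2 * cint xs j g (legendre_poly m) * s ^ m\<bar>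
            = (2 * real m + 1) / 2 * \<bar>cint xs j g (legendre_poly m)\<bar>"
          by (simp add: abs_mult s1)
        also have "\<dots> \<le> (2 * real m + 1) / 2 * (2 * (A m * B))"
          by (intro mult_left_mono abs_cint_le[OF cg gB A(2)]) auto
        finally show "\<bar>(2 * real m + 1) / 2 * cint xs j g (legendre_poly m) * s ^ m\<bar> \<le> (2 * real m + 1) * A m * B"
          by simp
      qed
      finally show ?thesis .
    qed
    moreover have "C * B = (\<Sum>m\<le>k. (2 * real m + 1) * A m * B) + B"
      by (simp add: C_def distrib_right sum_distrib_right)
    ultimately show "\<bar>kap s k xs j f\<bar> \<le> C * B" by simp
  qed
qed

text \<open>The derivative is approximated first and then integrated, with the constant fixed at
  \<open>lo\<close>. Measuring the last derivative relative to a constant \<open>c\<close> covers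
  bounds (c = 0) as well as oscillation over the cell (c its value at the left end), which gains one
  more power of the length.\<close>

lemma ex_poly_approx:
  fixes g :: "nat \<Rightarrow> real \<Rightarrow> real"
  assumes "lo \<le> hi"
    and "\<And>i x. i < n \<Longrightarrow> x \<in> {lo..hi} \<Longrightarrow> (g i has_real_derivative g (Suc i) x) (at x within {lo..hi})"
    and "\<And>x. x \<in> {lo..hi} \<Longrightarrow> \<bar>g n x - c\<bar> \<le> B"
  shows "\<exists>p. degree p \<le> n \<and> (\<forall>x\<in>{lo..hi}. \<bar>g 0 x - poly p x\<bar> \<le> B * (hi - lo) ^ n)"
  using assms(2,3)
proof (induction n arbitrary: g)
  case 0
  then show ?case by (intro exI[of _ "[:c:]"]) auto
next
  case (Suc n)
  have "\<exists>p. degree p \<le> n \<and> (\<forall>x\<in>{lo..hi}. \<bar>g (Suc 0) x - poly p x\<bar> \<le> B * (hi - lo) ^ n)"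
    using Suc.IH[of "\<lambda>i. g (Suc i)"] Suc.prems by auto
  then obtain p where p: "degree p \<le> n" "\<forall>x\<in>{lo..hi}. \<bar>g (Suc 0) x - poly p x\<bar> \<le> B * (hi - lo) ^ n" by blast
  define q where "q = primitive p"
  define r where "r = q + [:g 0 lo - poly q lo:]"
  have dr: "degree r \<le> Suc n" unfolding r_def
    by (intro degree_add_le order_trans[OF degree_primitive_le[of p, folded q_def]]) (use p in auto)
  have "\<bar>g 0 x - poly r x\<bar> \<le> B * (hi - lo) ^ Suc n" if x: "x \<in> {lo..hi}" for x
  proof -
    have "norm ((g 0 x - poly r x) - (g 0 lo - poly r lo)) \<le> (B * (hi - lo) ^ n) * norm (x - lo)"
    proof (rule field_differentiable_bound[where S = "{lo..hi}" and f' = "\<lambda>x. g (Suc 0) x - poly p x"])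
      fix z assume z: "z \<in> {lo..hi}"
      have "(poly r has_real_derivative poly (pderiv r) z) (at z within {lo..hi})"
        by (rule has_field_derivative_at_within[OF poly_DERIV])
      moreover have "pderiv r = p" by (simp add: r_def q_def pderiv_add pderiv_pCons)
      ultimately show "((\<lambda>x. g 0 x - poly r x) has_field_derivative g (Suc 0) z - poly p z) (at z within {lo..hi})"
        using Suc.prems(1)[of 0 z] z by (intro DERIV_diff) auto
      show "norm (g (Suc 0) z - poly p z) \<le> B * (hi - lo) ^ n" using p z by auto
    qed (use x assms in auto)
    moreover have "g 0 lo - poly r lo = 0" by (simp add: r_def)
    moreover have "norm (x - lo) \<le> hi - lo" using x by auto
    moreover have "0 \<le> B * (hi - lo) ^ n" using p(2) assms(1) by (auto intro: order_trans[OF abs_ge_zero])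
    ultimately have "\<bar>g 0 x - poly r x\<bar> \<le> B * (hi - lo) ^ n * (hi - lo)"
      by (smt (verit, best) mult_left_mono real_norm_def)
    then show ?thesis by (simp add: mult_ac)
  qed
  then show ?case using dr by blast
qed

section \<open>Mollification\<close>

text \<open>The derivative is an existential witness, so that sums, products and affine
  substitutions are handled by induction without computing iterated \<open>deriv\<close>;
  \<open>smooth_deriv\<close> returns to \<open>deriv\<close>, which \<open>test_functions\<close>
  requires.\<close>

fun ndiff :: "nat \<Rightarrow> (real \<Rightarrow> real) \<Rightarrow> bool" where
  "ndiff 0 f = True"
| "ndiff (Suc n) f = (\<exists>f'. (\<forall>x. (f has_real_derivative f' x) (at x)) \<and> ndiff n f')"

lemma ndiff_Suc_imp: "ndiff (Suc n) f \<Longrightarrow> ndiff n f"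
proof (induction n arbitrary: f)
  case (Suc n)
  then obtain f' where "\<forall>x. (f has_real_derivative f' x) (at x)" "ndiff (Suc n) f'"
    by (auto simp del: ndiff.simps simp: ndiff.simps(2)[of "Suc n"])
  then show ?case using Suc.IH by auto
qed simp

lemma ndiff_add: "ndiff n f \<Longrightarrow> ndiff n g \<Longrightarrow> ndiff n (\<lambda>x. f x + g x)"
proof (induction n arbitrary: f g)
  case (Suc n)
  then obtain f' g' where "\<forall>x. (f has_real_derivative f' x) (at x)" "ndiff n f'"
    "\<forall>x. (g has_real_derivative g' x) (at x)" "ndiff n g'" by auto
  then show ?case using Suc.IH by (auto intro!: exI[of _ "\<lambda>x. f' x + g' x"] DERIV_add)
qed simp

lemma ndiff_mult: "ndiff n f \<Longrightarrow> ndiff n g \<Longrightarrow> ndiff n (\<lambda>x. f x * g x)"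
proof (induction n arbitrary: f g)
  case (Suc n)
  then obtain f' g' where *: "\<forall>x. (f has_real_derivative f' x) (at x)" "ndiff n f'"
    "\<forall>x. (g has_real_derivative g' x) (at x)" "ndiff n g'" by auto
  have "ndiff n f" "ndiff n g" using Suc.prems by (auto intro: ndiff_Suc_imp simp del: ndiff.simps)
  then have "ndiff n (\<lambda>x. f' x * g x + g' x * f x)"
    using * Suc.IH by (intro ndiff_add) auto
  moreover have "\<forall>x. ((\<lambda>x. f x * g x) has_real_derivative f' x * g x + g' x * f x) (at x)"
    using * by (auto intro!: DERIV_mult)
  ultimately show ?case by (auto simp del: ndiff.simps simp: ndiff.simps(2))
qed simp

lemma ndiff_const: "ndiff n (\<lambda>_. c)"
  by (induction n arbitrary: c) (auto intro!: exI[of _ "\<lambda>_. 0"])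

lemma ndiff_affine: "ndiff n f \<Longrightarrow> ndiff n (\<lambda>x. f (c * x + d))"
proof (induction n arbitrary: f)
  case (Suc n)
  then obtain f' where *: "\<forall>x. (f has_real_derivative f' x) (at x)" "ndiff n f'" by auto
  have "((\<lambda>x. f (c * x + d)) has_real_derivative f' (c * x + d) * c) (at x)" for x
    by (rule DERIV_chain2[OF *(1)[rule_format]]) (auto intro!: derivative_eq_intros)
  moreover have "ndiff n (\<lambda>x. f' (c * x + d) * c)"
    using Suc.IH[OF *(2)] by (intro ndiff_mult ndiff_const)
  ultimately show ?case by (auto intro!: exI[of _ "\<lambda>x. f' (c * x + d) * c"])
qed simp

definition smooth :: "(real \<Rightarrow> real) \<Rightarrow> bool" where
  "smooth f \<longleftrightarrow> (\<forall>n. ndiff n f)"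

lemma smooth_mult: "smooth f \<Longrightarrow> smooth g \<Longrightarrow> smooth (\<lambda>x. f x * g x)"
  and smooth_const: "smooth (\<lambda>_. c)"
  and smooth_affine: "smooth f \<Longrightarrow> smooth (\<lambda>x. f (p * x + q))"
  by (auto simp: smooth_def ndiff_mult ndiff_const ndiff_affine)

lemma smooth_deriv:
  assumes "smooth f"
  shows "(f has_real_derivative deriv f x) (at x)" "smooth (deriv f)"
proof -
  have ex: "\<exists>f'. (\<forall>x. (f has_real_derivative f' x) (at x)) \<and> ndiff n f'" for n
    using assms unfolding smooth_def by (metis ndiff.simps(2))
  then show "(f has_real_derivative deriv f x) (at x)" using DERIV_imp_deriv by metis
  have "ndiff n (deriv f)" for n
  proof -
    obtain f' where f': "\<forall>x. (f has_real_derivative f' x) (at x)" "ndiff n f'" using ex by blast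
    then have "deriv f = f'" by (auto intro!: DERIV_imp_deriv)
    then show ?thesis using f' by simp
  qed
  then show "smooth (deriv f)" by (simp add: smooth_def)
qed

lemma smooth_higher_deriv: "smooth f \<Longrightarrow> smooth ((deriv ^^ i) f)"
  by (induction i) (auto intro: smooth_deriv)

lemma has_derivative_higher_deriv:
  "smooth f \<Longrightarrow> ((deriv ^^ i) f has_real_derivative (deriv ^^ Suc i) f x) (at x)"
  using smooth_deriv(1)[OF smooth_higher_deriv] by simp

lemma higher_deriv_reflect:
  assumes "smooth f"
  shows "(deriv ^^ i) (\<lambda>y. f (x - y)) = (\<lambda>y. (-1) ^ i * (deriv ^^ i) f (x - y))"
proof (induction i)
  case (Suc i)
  have "((\<lambda>y. (-1) ^ i * (deriv ^^ i) f (x - y)) has_real_derivative (-1) ^ Suc i * (deriv ^^ Suc i) f (x - y)) (at y)" for y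
    by (auto intro!: derivative_eq_intros DERIV_chain2[OF has_derivative_higher_deriv[OF assms]])
  then show ?case by (auto simp: Suc intro!: DERIV_imp_deriv)
qed simp

text \<open>The flat function exp(-1/x) with a polynomial factor in 1/x: the factor makes the family
  closed under differentiation, so smoothness becomes an induction on the order.\<close>

definition flat :: "real poly \<Rightarrow> real \<Rightarrow> real" where
  "flat p x = (if x > 0 then poly p (1 / x) * exp (- (1 / x)) else 0)"

lemma poly_exp_decay: "((\<lambda>y. poly p y * exp (- y)) \<longlongrightarrow> 0) at_top" for p :: "real poly"
proof -
  have "((\<lambda>y. \<Sum>i\<le>degree p. coeff p i * (y ^ i / exp y)) \<longlongrightarrow> (\<Sum>i\<le>degree p. coeff p i * 0)) at_top"
    by (intro tendsto_intros tendsto_power_div_exp_0)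
  then show ?thesis by (simp add: poly_altdef sum_distrib_right exp_minus divide_inverse mult.assoc)
qed

lemma flat_deriv: "(flat p has_real_derivative flat ([:0, 0, 1:] * (p - pderiv p)) x) (at x)"
proof -
  consider "x > 0" | "x < 0" | "x = 0" by linarith
  then show ?thesis
  proof cases
    case 1
    have "((\<lambda>x. poly p (1 / x) * exp (- (1 / x))) has_real_derivative
        flat ([:0, 0, 1:] * (p - pderiv p)) x) (at x)"
      using 1 by (auto intro!: derivative_eq_intros DERIV_chain2[OF poly_DERIV]
          simp: flat_def field_simps power2_eq_square)
    then show ?thesis
      by (rule has_field_derivative_transform_within_open[where S = "{0<..}"])
        (use 1 in \<open>auto simp: flat_def\<close>)
  next
    case 2
    have "((\<lambda>_. 0) has_real_derivative 0) (at x)" by simp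
    then show ?thesis using 2 unfolding flat_def
      by (auto intro: has_field_derivative_transform_within_open[where S = "{..<0}" and f = "\<lambda>_. 0"])
  next
    case 3
    have "((\<lambda>y. poly ([:0, 1:] * p) (inverse y) * exp (- inverse y)) \<longlongrightarrow> 0) (at_right 0)"
      using poly_exp_decay[of "[:0, 1:] * p"]
      by (rule filterlim_compose[OF _ filterlim_inverse_at_top_right])
    moreover have "eventually (\<lambda>y. poly ([:0, 1:] * p) (inverse y) * exp (- inverse y) = flat p y / y) (at_right 0)"
      by (auto simp: eventually_at_filter flat_def divide_inverse)
    ultimately have r: "((\<lambda>y. flat p y / y) \<longlongrightarrow> 0) (at_right 0)" by (rule Lim_transform_eventually)
    have "eventually (\<lambda>y. 0 = flat p y / y) (at_left 0)"
      by (auto simp: eventually_at_filter flat_def)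
    then have l: "((\<lambda>y. flat p y / y) \<longlongrightarrow> 0) (at_left 0)"
      by (rule Lim_transform_eventually[OF tendsto_const])
    have "((\<lambda>y. flat p y / y) \<longlongrightarrow> 0) (at 0)" by (rule filterlim_split_at[OF l r])
    then show ?thesis using 3 by (simp add: has_field_derivative_iff flat_def)
  qed
qed

lemma smooth_flat: "smooth (flat p)"
proof -
  have "ndiff n (flat p)" for n
    by (induction n arbitrary: p) (use flat_deriv in auto)
  then show ?thesis by (simp add: smooth_def)
qed

definition bump :: "real \<Rightarrow> real" where
  "bump x = flat 1 (1 + x) * flat 1 (1 - x)"

lemma bump_nonneg: "bump x \<ge> 0" and bump_eq_0_iff: "bump x = 0 \<longleftrightarrow> \<bar>x\<bar> \<ge> 1"
  by (auto simp: bump_def flat_def)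

lemma smooth_bump: "smooth bump"
  unfolding bump_def[abs_def]
  using smooth_mult[OF smooth_affine[OF smooth_flat, of 1 1 1] smooth_affine[OF smooth_flat, of 1 "-1" 1]]
  by (simp add: add.commute)

definition moll :: "real \<Rightarrow> real \<Rightarrow> real" where
  "moll \<delta> z = bump (z / \<delta>) / integral {-\<delta>..\<delta>} (\<lambda>z. bump (z / \<delta>))"

lemma smooth_moll: "smooth (moll \<delta>)"
  using smooth_mult[OF smooth_affine[OF smooth_bump, of "1 / \<delta>" 0]
      smooth_const[of "1 / integral {-\<delta>..\<delta>} (\<lambda>z. bump (z / \<delta>))"]]
  by (simp add: moll_def[abs_def])

abbreviation dmoll :: "real \<Rightarrow> nat \<Rightarrow> real \<Rightarrow> real" where
  "dmoll \<delta> i \<equiv> (deriv ^^ i) (moll \<delta>)"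

lemma dmoll_deriv: "(dmoll \<delta> i has_real_derivative dmoll \<delta> (Suc i) x) (at x)"
  by (rule has_derivative_higher_deriv[OF smooth_moll])

lemma continuous_on_dmoll [continuous_intros]:
  "continuous_on S f \<Longrightarrow> continuous_on S (\<lambda>x. dmoll \<delta> i (f x))"
  by (rule continuous_on_compose2[where t = UNIV])
    (auto intro!: DERIV_continuous_on[OF has_field_derivative_at_within[OF dmoll_deriv]] simp del: funpow.simps)

lemma continuous_on_moll [continuous_intros]:
  "continuous_on S f \<Longrightarrow> continuous_on S (\<lambda>x. moll \<delta> (f x))"
  using continuous_on_dmoll[of S f 0] by simp

lemma moll_nonneg: "moll \<delta> z \<ge> 0"
  unfolding moll_def by (intro divide_nonneg_nonneg integral_nonneg bump_nonneg)
    (auto intro!: integrable_continuous_interval continuous_intros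
      continuous_on_compose2[where t = UNIV, OF DERIV_continuous_on[OF has_field_derivative_at_within[OF smooth_deriv(1)[OF smooth_bump]]]]
      simp: divide_inverse)

lemma moll_eq_0: "\<delta> > 0 \<Longrightarrow> \<bar>z\<bar> \<ge> \<delta> \<Longrightarrow> moll \<delta> z = 0"
  by (simp add: moll_def bump_eq_0_iff)

lemma dmoll_eq_0:
  assumes "\<delta> > 0" "\<bar>z\<bar> > \<delta>"
  shows "dmoll \<delta> i z = 0"
  using assms(2)
proof (induction i arbitrary: z)
  case (Suc i)
  have "open {z. \<bar>z\<bar> > \<delta>}"
    by (intro open_Collect_less continuous_intros)
  have "((dmoll \<delta> i) has_real_derivative 0) (at z)"
  proof (rule has_field_derivative_transform_within_open)
    show "((\<lambda>_. 0) has_real_derivative 0) (at z)" by simp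
    show "open {z. \<bar>z\<bar> > \<delta>}" by fact
    show "z \<in> {z. \<bar>z\<bar> > \<delta>}" using Suc.prems by simp
    show "0 = dmoll \<delta> i y" if "y \<in> {z. \<bar>z\<bar> > \<delta>}" for y using Suc.IH[of y] that by simp
  qed
  then show ?case by (simp add: DERIV_imp_deriv)
qed (use assms moll_eq_0 in auto)

lemma integral_moll:
  assumes "\<delta> > 0"
  shows "integral {-\<delta>..\<delta>} (moll \<delta>) = 1"
proof -
  define f where "f z = bump (z / \<delta>)" for z
  have c: "continuous_on S f" for S
    unfolding f_def divide_inverse
    by (rule continuous_on_compose2[where t = UNIV, OF DERIV_continuous_on[OF has_field_derivative_at_within[OF smooth_deriv(1)[OF smooth_bump]]]])
      (auto intro!: continuous_intros)
  have "integral {-\<delta>..\<delta>} f \<noteq> 0"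
  proof
    assume "integral {-\<delta>..\<delta>} f = 0"
    then have "\<forall>x\<in>{-\<delta>..\<delta>}. f x = 0"
      using integral_eq_0_iff[of "-\<delta>" \<delta> f] c assms by (auto simp: f_def bump_nonneg)
    from bspec[OF this, of 0] have "f 0 = 0" using assms by simp
    then show False by (simp add: f_def bump_eq_0_iff)
  qed
  then show ?thesis by (simp add: moll_def[abs_def] f_def[symmetric] integral_divide f_def[abs_def, symmetric])
qed

text \<open>The i-th derivative of the mollification of v, where v counts as zero outside
  \<open>Omega\<close>. All derivatives fall on the kernel, so this is smooth for merely continuous
  v.\<close>

definition mconv :: "real \<Rightarrow> nat \<Rightarrow> (real \<Rightarrow> real) \<Rightarrow> real \<Rightarrow> real" where
  "mconv \<delta> i v x = integral Omega (\<lambda>y. v y * dmoll \<delta> i (x - y))"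

lemma mconv_deriv:
  assumes "continuous_on Omega v"
  shows "(mconv \<delta> i v has_real_derivative mconv \<delta> (Suc i) v x) (at x)"
proof -
  have "((\<lambda>x. integral (cbox 0 (2 * pi)) (\<lambda>y. v y * dmoll \<delta> i (x - y))) has_field_derivative
      integral (cbox 0 (2 * pi)) (\<lambda>y. v y * dmoll \<delta> (Suc i) (x - y))) (at x within UNIV)"
  proof (rule leibniz_rule_field_derivative)
    show "((\<lambda>x. v y * dmoll \<delta> i (x - y)) has_real_derivative v y * dmoll \<delta> (Suc i) (x - y)) (at x within UNIV)"
      for x y
    proof -
      have "((\<lambda>x. dmoll \<delta> i (x - y)) has_real_derivative dmoll \<delta> (Suc i) (x - y) * 1) (at x)"
        by (rule DERIV_chain2[OF dmoll_deriv]) (auto intro!: derivative_eq_intros)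
      then show ?thesis by (intro DERIV_cmult) simp
    qed
    show "(\<lambda>y. v y * dmoll \<delta> i (x - y)) integrable_on cbox 0 (2 * pi)" for x
      using assms by (intro integrable_continuous continuous_intros) (auto simp: Omega_def)
    show "continuous_on (UNIV \<times> cbox 0 (2 * pi)) (\<lambda>(x, y). v y * dmoll \<delta> (Suc i) (x - y))"
      unfolding case_prod_beta using assms
      by (intro continuous_intros continuous_on_compose2[OF assms]) (auto simp: Omega_def)
  qed auto
  then show ?thesis unfolding mconv_def[abs_def] by (simp add: Omega_def)
qed

lemma integral_moll_shift:
  assumes "\<delta> > 0" "\<delta> \<le> x" "x \<le> 2 * pi - \<delta>"
  shows "integral Omega (\<lambda>y. moll \<delta> (x - y)) = 1"
proof -
  have c: "continuous_on S (moll \<delta>)" for S by (intro continuous_intros)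
  have "(moll \<delta> has_integral 1) {-\<delta>..\<delta>}"
    using integral_moll[OF assms(1)] c
    by (metis has_integral_integral integrable_continuous_interval)
  then have "((\<lambda>y. moll \<delta> (-1 * y + x)) has_integral 1) ((\<lambda>y. - y + x) ` {-\<delta>..\<delta>})"
    using has_integral_affinity[of "moll \<delta>" 1 "-\<delta>" \<delta> "-1" x] by (simp add: image_iff)
  moreover have "(\<lambda>y. - y + x) ` {-\<delta>..\<delta>} = {x - \<delta>..x + \<delta>}"
    by (auto simp: image_iff intro!: bexI[of _ "x - _"])
  ultimately have "((\<lambda>y. moll \<delta> (x - y)) has_integral 1) {x - \<delta>..x + \<delta>}" by (simp add: add.commute)
  then have "((\<lambda>y. moll \<delta> (x - y)) has_integral 1) Omega"
    by (rule has_integral_on_superset) (use assms in \<open>auto simp: Omega_def intro!: moll_eq_0\<close>)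
  then show ?thesis by (rule integral_unique)
qed

lemma mconv_0_close:
  assumes v: "continuous_on Omega v" and \<delta>: "\<delta> > 0" "\<delta> \<le> x" "x \<le> 2 * pi - \<delta>"
    and e: "\<And>y. y \<in> Omega \<Longrightarrow> \<bar>y - x\<bar> \<le> \<delta> \<Longrightarrow> \<bar>v y - c\<bar> \<le> e"
  shows "\<bar>mconv \<delta> 0 v x - c\<bar> \<le> e"
proof -
  have cm: "continuous_on S (\<lambda>y. moll \<delta> (x - y))" for S
    by (intro continuous_intros)
  have i1: "(\<lambda>y. v y * moll \<delta> (x - y)) integrable_on Omega"
    and i2: "(\<lambda>y. C * moll \<delta> (x - y)) integrable_on Omega" for C
    using v unfolding Omega_def
    by (auto intro!: integrable_continuous_interval continuous_intros cm)
  have "mconv \<delta> 0 v x - c = integral Omega (\<lambda>y. v y * moll \<delta> (x - y)) - integral Omega (\<lambda>y. c * moll \<delta> (x - y))"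
    using integral_moll_shift[OF \<delta>] by (simp add: mconv_def)
  also have "\<dots> = integral Omega (\<lambda>y. v y * moll \<delta> (x - y) - c * moll \<delta> (x - y))"
    by (rule Henstock_Kurzweil_Integration.integral_diff[symmetric, OF i1 i2])
  finally have eq: "mconv \<delta> 0 v x - c = integral Omega (\<lambda>y. v y * moll \<delta> (x - y) - c * moll \<delta> (x - y))" .
  have "norm (mconv \<delta> 0 v x - c) \<le> integral Omega (\<lambda>y. e * moll \<delta> (x - y))"
    unfolding eq
  proof (rule integral_norm_bound_integral[OF integrable_diff[OF i1 i2] i2])
    fix y assume y: "y \<in> Omega"
    show "norm (v y * moll \<delta> (x - y) - c * moll \<delta> (x - y)) \<le> e * moll \<delta> (x - y)"
    proof (cases "\<bar>y - x\<bar> \<le> \<delta>")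
      case True
      then show ?thesis using e[OF y True] moll_nonneg[of \<delta> "x - y"]
        by (simp add: abs_mult mult_right_mono flip: left_diff_distrib)
    next
      case False
      then show ?thesis using moll_eq_0[of \<delta> "x - y"] \<delta> by simp
    qed
  qed
  then show ?thesis using integral_moll_shift[OF \<delta>] by simp
qed

lemma moll_test_function:
  assumes "\<delta> > 0" "\<delta> < x" "x < 2 * pi - \<delta>"
  shows "(\<lambda>y. moll \<delta> (x - y)) \<in> test_functions"
proof -
  have sub: "closure {y. moll \<delta> (x - y) \<noteq> 0} \<subseteq> {x - \<delta>..x + \<delta>}"
  proof (rule closure_minimal)
    have "\<bar>x - y\<bar> < \<delta>" if "moll \<delta> (x - y) \<noteq> 0" for y
      using moll_eq_0[OF assms(1), of "x - y"] that by linarith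
    then show "{y. moll \<delta> (x - y) \<noteq> 0} \<subseteq> {x - \<delta>..x + \<delta>}" by fastforce
  qed simp
  have "compact (closure {y. moll \<delta> (x - y) \<noteq> 0})"
    using bounded_subset[OF bounded_closed_interval sub] by (simp add: compact_eq_bounded_closed)
  moreover have "{x - \<delta>..x + \<delta>} \<subseteq> interior Omega"
    using assms by (auto simp: Omega_def interior_atLeastAtMost_real)
  moreover have "(deriv ^^ n) (\<lambda>y. moll \<delta> (x - y)) differentiable at y" for n y
  proof -
    have "((\<lambda>y. (-1) ^ n * dmoll \<delta> n (x - y)) has_real_derivative (-1) ^ n * (dmoll \<delta> (Suc n) (x - y) * (-1))) (at y)"
      by (intro DERIV_cmult DERIV_chain2[OF dmoll_deriv]) (auto intro!: derivative_eq_intros)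
    then show ?thesis unfolding higher_deriv_reflect[OF smooth_moll]
      using real_differentiable_def by blast
  qed
  ultimately show ?thesis unfolding test_functions_def using sub by blast
qed

text \<open>At distance more than \<delta> from the end points the kernel is a test function, so its
  derivatives can be exchanged for the weak derivative g. The sign from the weak derivative cancels
  the one from the reflected argument, and the kernel is nonnegative with mass 1.\<close>

lemma mconv_weak_bound:
  assumes v: "continuous_on Omega v" and w: "weak_deriv i v g"
    and g: "AE x in lebesgue_on Omega. \<bar>g x\<bar> \<le> M"
    and \<delta>: "\<delta> > 0" "\<delta> < x" "x < 2 * pi - \<delta>"
  shows "\<bar>mconv \<delta> i v x\<bar> \<le> M"
proof -
  let ?L = "lebesgue_on Omega" and ?\<phi> = "\<lambda>y. moll \<delta> (x - y)"
  have Om: "Omega \<in> sets lebesgue" by (simp add: Omega_def)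
  have int: "integrable ?L f" "integral\<^sup>L ?L f = integral Omega f" if "continuous_on Omega f" for f :: "real \<Rightarrow> real"
  proof -
    show "integrable ?L f" using that unfolding Omega_def by (rule continuous_imp_integrable_real)
    then show "integral\<^sup>L ?L f = integral Omega f" using Om by (rule lebesgue_integral_eq_integral)
  qed
  have cm: "continuous_on Omega ?\<phi>"
    by (intro continuous_intros)
  have "integral\<^sup>L ?L (\<lambda>y. v y * (deriv ^^ i) ?\<phi> y) = (-1) ^ i * integral\<^sup>L ?L (\<lambda>y. g y * ?\<phi> y)"
    using w moll_test_function[OF \<delta>] unfolding weak_deriv_def by blast
  moreover have "integral\<^sup>L ?L (\<lambda>y. v y * (deriv ^^ i) ?\<phi> y) = (-1) ^ i * mconv \<delta> i v x"
  proof -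
    have "integral\<^sup>L ?L (\<lambda>y. v y * (deriv ^^ i) ?\<phi> y) = integral Omega (\<lambda>y. v y * ((-1) ^ i * dmoll \<delta> i (x - y)))"
      unfolding higher_deriv_reflect[OF smooth_moll]
      by (intro int continuous_intros v)
    also have "\<dots> = (-1) ^ i * mconv \<delta> i v x"
      unfolding mconv_def integral_mult_right[symmetric] by (simp add: mult_ac)
    finally show ?thesis .
  qed
  ultimately have eq: "mconv \<delta> i v x = integral\<^sup>L ?L (\<lambda>y. g y * ?\<phi> y)" by simp
  have M: "integral\<^sup>L ?L (\<lambda>y. M * ?\<phi> y) = M"
    using int(2)[of "\<lambda>y. M * ?\<phi> y"] cm integral_moll_shift[of \<delta> x] \<delta>
    by (simp add: continuous_on_mult_left)
  have iM: "integrable ?L (\<lambda>y. M * ?\<phi> y)" by (intro int(1) continuous_on_mult_left cm)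
  \<comment> \<open>\<open>integral_mono_AE'\<close> asks for a nonnegative majorant; M >= 0 is read
    off from |g| <= M.\<close>
  have nn: "AE y in ?L. 0 \<le> M * ?\<phi> y"
    using g by eventually_elim (auto intro!: mult_nonneg_nonneg moll_nonneg)
  have "integral\<^sup>L ?L (\<lambda>y. g y * ?\<phi> y) \<le> integral\<^sup>L ?L (\<lambda>y. M * ?\<phi> y)"
    using iM by (rule integral_mono_AE')
      (use g nn in \<open>auto elim!: eventually_mono intro!: mult_right_mono moll_nonneg\<close>)
  moreover have "integral\<^sup>L ?L (\<lambda>y. - (g y * ?\<phi> y)) \<le> integral\<^sup>L ?L (\<lambda>y. M * ?\<phi> y)"
    using iM
  proof (rule integral_mono_AE')
    show "AE y in ?L. - (g y * ?\<phi> y) \<le> M * ?\<phi> y"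
      using g
    proof eventually_elim
      case (elim y)
      then have "- g y * ?\<phi> y \<le> M * ?\<phi> y" by (intro mult_right_mono moll_nonneg) auto
      then show ?case by simp
    qed
  qed (rule nn)
  ultimately show ?thesis unfolding eq M by (simp add: abs_le_iff)
qed

text \<open>The boundary terms vanish because the kernel around x does not reach 0 or 2 pi.\<close>

lemma mconv_by_parts:
  assumes v': "\<And>y. y \<in> Omega \<Longrightarrow> (v has_real_derivative v' y) (at y within Omega)"
    and c: "continuous_on Omega v'" and \<delta>: "\<delta> > 0" "\<delta> < x" "x < 2 * pi - \<delta>"
  shows "mconv \<delta> i v' x = mconv \<delta> (Suc i) v x"
proof -
  have cv: "continuous_on Omega v" using v' by (meson DERIV_continuous_on)
  have "((\<lambda>y. v' y * dmoll \<delta> i (x - y) - v y * dmoll \<delta> (Suc i) (x - y)) has_integral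
      v (2 * pi) * dmoll \<delta> i (x - 2 * pi) - v 0 * dmoll \<delta> i (x - 0)) {0..2 * pi}"
  proof (rule fundamental_theorem_of_calculus)
    fix y assume y: "y \<in> {0..2 * pi}"
    have "((\<lambda>y. dmoll \<delta> i (x - y)) has_real_derivative dmoll \<delta> (Suc i) (x - y) * (-1)) (at y within {0..2 * pi})"
      by (rule DERIV_chain2[OF dmoll_deriv]) (auto intro!: derivative_eq_intros)
    from DERIV_mult[OF v'[unfolded Omega_def, OF y] this]
    show "((\<lambda>y. v y * dmoll \<delta> i (x - y)) has_vector_derivative
        v' y * dmoll \<delta> i (x - y) - v y * dmoll \<delta> (Suc i) (x - y)) (at y within {0..2 * pi})"
      unfolding has_real_derivative_iff_has_vector_derivative[symmetric] by (simp add: algebra_simps)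
  qed simp
  moreover have "dmoll \<delta> i (x - 2 * pi) = 0" "dmoll \<delta> i (x - 0) = 0"
    using dmoll_eq_0[OF \<delta>(1)] \<delta> by auto
  ultimately have "integral Omega (\<lambda>y. v' y * dmoll \<delta> i (x - y) - v y * dmoll \<delta> (Suc i) (x - y)) = 0"
    unfolding Omega_def by (simp only: mult_zero_right) (simp add: integral_unique del: funpow.simps)
  moreover have "integral Omega (\<lambda>y. v' y * dmoll \<delta> i (x - y) - v y * dmoll \<delta> (Suc i) (x - y))
      = mconv \<delta> i v' x - mconv \<delta> (Suc i) v x"
    unfolding mconv_def using c cv unfolding Omega_def
    by (intro Henstock_Kurzweil_Integration.integral_diff integrable_continuous_interval continuous_intros)
  ultimately show ?thesis by simp
qed

section \<open>Interior gradient estimates for the heat equation\<close>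

lemma second_derivative_at_max:
  fixes f :: "real \<Rightarrow> real"
  assumes x: "lo < x" "x < hi"
    and f': "\<And>y. lo < y \<Longrightarrow> y < hi \<Longrightarrow> (f has_real_derivative f' y) (at y)"
    and f'': "(f' has_real_derivative f'') (at x)"
    and max: "\<And>y. lo < y \<Longrightarrow> y < hi \<Longrightarrow> f y \<le> f x"
  shows "f'' \<le> 0"
proof (rule ccontr)
  assume "\<not> f'' \<le> 0"
  then have pos: "0 < f''" by simp
  define e where "e = min (x - lo) (hi - x)"
  have e: "e > 0" using x by (simp add: e_def)
  have zero: "f' x = 0"
    by (rule DERIV_local_max[OF f'[OF x] e]) (auto simp: e_def abs_if split: if_splits intro!: max)
  obtain d where d: "d > 0" "\<forall>h>0. h < d \<longrightarrow> f' x < f' (x + h)"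
    using DERIV_pos_inc_right[OF f'' pos] by blast
  define h where "h = min d e / 2"
  have "h \<le> d / 2" "h \<le> e / 2" "e \<le> hi - x" by (auto simp: h_def e_def)
  moreover have "h > 0" using d e by (simp add: h_def)
  ultimately have h: "h > 0" "h < d" "x + h < hi" using d e by linarith+
  have "\<exists>z>x. z < x + h \<and> f (x + h) - f x = (x + h - x) * f' z"
    by (rule MVT2) (use h x in \<open>auto intro!: f'\<close>)
  then obtain z where z: "z > x" "z < x + h" "f (x + h) - f x = (x + h - x) * f' z" by blast
  have "f' z > 0" using d(2)[rule_format, of "z - x"] z h zero by simp
  then have "h * f' z > 0" using h by simp
  then have "f (x + h) > f x" using z by simp
  then show False using max[of "x + h"] h x by simp
qed

text \<open>A small multiple of t is subtracted so that the maximum, if it exceeds B, contradicts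
  the differential inequality strictly: there Pxx <= 0 and Pt >= \<kappa> > 0.\<close>

lemma parabolic_maximum_principle:
  fixes P Px Pxx Pt :: "real \<Rightarrow> real \<Rightarrow> real"
  assumes cont: "continuous_on ({lo..hi} \<times> {ta..tb}) (\<lambda>(x, t). P x t)"
    and Px: "\<And>x t. lo < x \<Longrightarrow> x < hi \<Longrightarrow> ta < t \<Longrightarrow> t \<le> tb \<Longrightarrow> ((\<lambda>x. P x t) has_real_derivative Px x t) (at x)"
    and Pxx: "\<And>x t. lo < x \<Longrightarrow> x < hi \<Longrightarrow> ta < t \<Longrightarrow> t \<le> tb \<Longrightarrow> ((\<lambda>x. Px x t) has_real_derivative Pxx x t) (at x)"
    and Pt: "\<And>x t. lo < x \<Longrightarrow> x < hi \<Longrightarrow> ta < t \<Longrightarrow> t \<le> tb \<Longrightarrow> (P x has_real_derivative Pt x t) (at t)"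
    and sub: "\<And>x t. lo < x \<Longrightarrow> x < hi \<Longrightarrow> ta < t \<Longrightarrow> t \<le> tb \<Longrightarrow> Pt x t \<le> Pxx x t"
    and bd: "\<And>x t. x \<in> {lo..hi} \<Longrightarrow> t \<in> {ta..tb} \<Longrightarrow> x = lo \<or> x = hi \<or> t = ta \<Longrightarrow> P x t \<le> B"
    and x1: "x1 \<in> {lo..hi}" "t1 \<in> {ta..tb}"
  shows "P x1 t1 \<le> B"
proof (rule ccontr)
  assume "\<not> P x1 t1 \<le> B"
  then have big: "P x1 t1 > B" by simp
  then have "ta < tb" using bd[of x1 t1] x1 by force
  \<comment> \<open>Small enough for the subtracted term to consume at most half of the excess of P
    x1 t1 over B.\<close>
  define \<kappa> where "\<kappa> = (P x1 t1 - B) / (2 * (tb - ta))"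
  have \<kappa>: "\<kappa> > 0" using big \<open>ta < tb\<close> by (simp add: \<kappa>_def)
  define Q where "Q = (\<lambda>(x, t). P x t - \<kappa> * (t - ta))"
  have "compact ({lo..hi} \<times> {ta..tb})" by (intro compact_Times compact_Icc)
  moreover have "continuous_on ({lo..hi} \<times> {ta..tb}) Q"
    using cont unfolding Q_def case_prod_beta by (intro continuous_intros)
  moreover have "(x1, t1) \<in> {lo..hi} \<times> {ta..tb}" using x1 by simp
  ultimately obtain p where p: "p \<in> {lo..hi} \<times> {ta..tb}" "\<forall>q\<in>{lo..hi} \<times> {ta..tb}. Q q \<le> Q p"
    using continuous_attains_sup[of "{lo..hi} \<times> {ta..tb}" Q] by blast
  obtain x t where xt: "p = (x, t)" by (cases p)
  have "\<kappa> * (t1 - ta) \<le> \<kappa> * (tb - ta)" using \<kappa> x1 by (intro mult_left_mono) auto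
  also have "\<dots> = (P x1 t1 - B) / 2" using \<open>ta < tb\<close> by (simp add: \<kappa>_def field_simps)
  finally have "Q (x1, t1) > B" using big by (simp add: Q_def field_simps)
  moreover have "Q (x1, t1) \<le> Q (x, t)" using p(2) x1 xt by blast
  ultimately have QB: "Q (x, t) > B" by simp
  have in_box: "x \<in> {lo..hi}" "t \<in> {ta..tb}" using p xt by auto
  have "P x t \<ge> Q (x, t)" using in_box \<kappa> by (simp add: Q_def)
  then have inner: "lo < x" "x < hi" "ta < t" "t \<le> tb"
    using bd[OF in_box] QB in_box by force+
  have "Pxx x t \<le> 0"
  proof (rule second_derivative_at_max[of lo x hi "\<lambda>x. P x t" "\<lambda>x. Px x t"])
    show "P y t \<le> P x t" if "lo < y" "y < hi" for y
    proof -
      have "Q (y, t) \<le> Q (x, t)" using p(2) xt that in_box inner by auto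
      then show ?thesis by (simp add: Q_def)
    qed
  qed (use inner Px Pxx in auto)
  \<comment> \<open>The maximum may lie on the final time \<open>tb\<close>, so it is compared with
    earlier times only; this gives an inequality instead of a vanishing derivative.\<close>
  moreover have "Pt x t - \<kappa> \<ge> 0"
  proof (rule ccontr)
    assume "\<not> Pt x t - \<kappa> \<ge> 0"
    then have neg: "Pt x t - \<kappa> < 0" by simp
    have "((\<lambda>t. Q (x, t)) has_real_derivative Pt x t - \<kappa>) (at t)"
      unfolding Q_def by (auto intro!: derivative_eq_intros Pt inner)
    from DERIV_neg_dec_left[OF this neg]
    obtain d where d: "d > 0" "\<forall>h>0. h < d \<longrightarrow> Q (x, t) < Q (x, t - h)" by blast
    define h where "h = min d (t - ta) / 2"
    have h: "h > 0" "h < d" "ta \<le> t - h" using d inner by (auto simp: h_def min_def field_simps)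
    then have "Q (x, t) < Q (x, t - h)" using d by blast
    moreover have "Q (x, t - h) \<le> Q (x, t)" using p(2) xt h in_box by auto
    ultimately show False by simp
  qed
  moreover have "Pt x t \<le> Pxx x t" by (rule sub) (use inner in auto)
  ultimately show False using \<kappa> by linarith
qed

text \<open>Bernstein's method: a cut-off multiple of \<open>w\<^sub>x\<^sup>2\<close> plus a large multiple of \<open>w\<^sup>2\<close> is a subsolution.\<close>

lemma heat_interior_gradient:
  fixes w w1 w2 w3 :: "real \<Rightarrow> real \<Rightarrow> real"
  assumes r: "r > 0"
    and cw: "continuous_on ({x0 - r..x0 + r} \<times> {t0 - r\<^sup>2..t0}) (\<lambda>(x, t). w x t)"
    and cw1: "continuous_on ({x0 - r..x0 + r} \<times> {t0 - r\<^sup>2..t0}) (\<lambda>(x, t). w1 x t)"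
    and wx: "\<And>x t. \<bar>x - x0\<bar> < r \<Longrightarrow> t0 - r\<^sup>2 < t \<Longrightarrow> t \<le> t0 \<Longrightarrow> ((\<lambda>x. w x t) has_real_derivative w1 x t) (at x)"
    and wxx: "\<And>x t. \<bar>x - x0\<bar> < r \<Longrightarrow> t0 - r\<^sup>2 < t \<Longrightarrow> t \<le> t0 \<Longrightarrow> ((\<lambda>x. w1 x t) has_real_derivative w2 x t) (at x)"
    and wxxx: "\<And>x t. \<bar>x - x0\<bar> < r \<Longrightarrow> t0 - r\<^sup>2 < t \<Longrightarrow> t \<le> t0 \<Longrightarrow> ((\<lambda>x. w2 x t) has_real_derivative w3 x t) (at x)"
    and wt: "\<And>x t. \<bar>x - x0\<bar> < r \<Longrightarrow> t0 - r\<^sup>2 < t \<Longrightarrow> t \<le> t0 \<Longrightarrow> (w x has_real_derivative w2 x t) (at t)"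
    and wxt: "\<And>x t. \<bar>x - x0\<bar> < r \<Longrightarrow> t0 - r\<^sup>2 < t \<Longrightarrow> t \<le> t0 \<Longrightarrow> (w1 x has_real_derivative w3 x t) (at t)"
    and M: "\<And>x t. x \<in> {x0 - r..x0 + r} \<Longrightarrow> t \<in> {t0 - r\<^sup>2..t0} \<Longrightarrow> \<bar>w x t\<bar> \<le> M"
  shows "\<bar>w1 x0 t0\<bar> \<le> 4 * M / r"
proof -
  have M0: "M \<ge> 0" using M[of x0 t0] r by simp
  \<comment> \<open>The cut-off z = A E vanishes on the lateral sides and at the initial time of the
    cylinder, where P then reduces to L w^2, and it is 1 at the centre (x0, t0).\<close>
  define A where "A x = 1 - ((x - x0) / r)\<^sup>2" for x
  define A1 where "A1 x = (- 2 / r\<^sup>2) * (x - x0)" for x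
  define E where "E t = 1 + 1 / r\<^sup>2 * (t - t0)" for t
  define z where "z x t = A x * E t" for x t
  have A': "(A has_real_derivative A1 x) (at x)" for x
    unfolding A_def A1_def using r by (auto intro!: derivative_eq_intros simp: power2_eq_square)
  have A1': "(A1 has_real_derivative - 2 / r\<^sup>2) (at x)" for x
    using DERIV_cmult[OF DERIV_diff[OF DERIV_ident DERIV_const], of "- 2 / r\<^sup>2"]
    unfolding A1_def by simp
  have E': "(E has_real_derivative 1 / r\<^sup>2) (at t)" for t
    using DERIV_add[OF DERIV_const DERIV_cmult[OF DERIV_diff[OF DERIV_ident DERIV_const], of "1 / r\<^sup>2"]]
    unfolding E_def by simp
  \<comment> \<open>The terms with w1^2 add up to at most 2 + 4 + 6 * 4 = 30 over r^2, which is 2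
    L.\<close>
  define L where "L = 15 / r\<^sup>2"
  define P where "P x t = (z x t)\<^sup>2 * (w1 x t)\<^sup>2 + L * (w x t)\<^sup>2" for x t
  define Px where "Px x t = 2 * z x t * (A1 x * E t) * (w1 x t)\<^sup>2 + (z x t)\<^sup>2 * (2 * w1 x t * w2 x t)
      + L * (2 * w x t * w1 x t)" for x t
  define Pxx where "Pxx x t = 2 * ((A1 x * E t)\<^sup>2 + z x t * (- 2 / r\<^sup>2 * E t)) * (w1 x t)\<^sup>2
      + 4 * z x t * (A1 x * E t) * (2 * w1 x t * w2 x t)
      + (z x t)\<^sup>2 * (2 * (w2 x t)\<^sup>2 + 2 * w1 x t * w3 x t) + L * (2 * (w1 x t)\<^sup>2 + 2 * w x t * w2 x t)" for x t
  define Pt where "Pt x t = 2 * z x t * (A x / r\<^sup>2) * (w1 x t)\<^sup>2 + (z x t)\<^sup>2 * (2 * w1 x t * w3 x t)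
      + L * (2 * w x t * w2 x t)" for x t
  have "P x0 t0 \<le> L * M\<^sup>2"
  proof (rule parabolic_maximum_principle[where lo = "x0 - r" and hi = "x0 + r" and ta = "t0 - r\<^sup>2" and tb = t0
        and P = P and Px = Px and Pxx = Pxx and Pt = Pt])
    show "continuous_on ({x0 - r..x0 + r} \<times> {t0 - r\<^sup>2..t0}) (\<lambda>(x, t). P x t)"
      using cw cw1 r unfolding P_def z_def A_def E_def case_prod_beta
      by (intro continuous_intros) auto
  next
    fix x t assume "x0 - r < x" "x < x0 + r" and t: "t0 - r\<^sup>2 < t" "t \<le> t0"
    then have x: "\<bar>x - x0\<bar> < r" by (simp add: abs_less_iff)
        show "((\<lambda>x. P x t) has_real_derivative Px x t) (at x)"
      unfolding P_def Px_def z_def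
      by (rule derivative_eq_intros A' A1' E' wx[OF x t] wxx[OF x t] refl)+ (simp add: algebra_simps power2_eq_square)
    show "((\<lambda>x. Px x t) has_real_derivative Pxx x t) (at x)"
      unfolding Px_def Pxx_def z_def
      by (rule derivative_eq_intros A' A1' E' wx[OF x t] wxx[OF x t] wxxx[OF x t] refl)+ (simp add: algebra_simps power2_eq_square)
    show "(P x has_real_derivative Pt x t) (at t)"
      unfolding P_def[abs_def] Pt_def z_def
      by (rule derivative_eq_intros A' A1' E' wt[OF x t] wxt[OF x t] refl)+ (simp add: algebra_simps power2_eq_square)
    have zr: "\<bar>(x - x0) / r\<bar> \<le> 1" using x r by simp
    then have "((x - x0) / r)\<^sup>2 \<le> 1" using abs_square_le_1 by blast
    then have A01: "0 \<le> A x" "A x \<le> 1" by (auto simp: A_def)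
    have E01: "0 \<le> E t" "E t \<le> 1" using t r by (auto simp: E_def field_simps)
    have z01: "0 \<le> z x t" "z x t \<le> 1" using A01 E01 by (auto simp: z_def mult_le_one)
    have A1b: "(A1 x * E t)\<^sup>2 \<le> 4 / r\<^sup>2"
    proof -
      have "(A1 x * E t)\<^sup>2 = 4 / r\<^sup>2 * (((x - x0) / r)\<^sup>2 * (E t)\<^sup>2)"
        using r by (simp add: A1_def power2_eq_square field_simps)
      also have "\<dots> \<le> 4 / r\<^sup>2 * 1"
      proof (intro mult_left_mono)
        have "(E t)\<^sup>2 \<le> 1" using E01 by (intro power_le_one)
        then show "((x - x0) / r)\<^sup>2 * (E t)\<^sup>2 \<le> 1"
          using \<open>((x - x0) / r)\<^sup>2 \<le> 1\<close> mult_le_one zero_le_power2 by blast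
      qed simp
      finally show ?thesis by simp
    qed
    have zA: "z x t * (A x / r\<^sup>2) \<le> 1 / r\<^sup>2"
      using mult_le_one[OF z01(2) A01(1,2)] r by (simp add: divide_right_mono)
    have zE: "z x t * (2 / r\<^sup>2 * E t) \<le> 2 / r\<^sup>2"
      using mult_le_one[OF z01(2) E01(1,2)] r by (simp add: divide_right_mono field_simps)
    \<comment> \<open>By the heat equation the third derivatives and the terms w w2 cancel. The
      mixed term w1 w2 is absorbed by completing a square, at the price of 8 (A1 E)^2 w1^2.\<close>
    have "Pt x t - Pxx x t = (2 * (z x t * (A x / r\<^sup>2)) - 2 * (A1 x * E t)\<^sup>2 + 2 * (z x t * (2 / r\<^sup>2 * E t))
        + 8 * (A1 x * E t)\<^sup>2 - 2 * L) * (w1 x t)\<^sup>2 - 2 * (z x t * w2 x t + 2 * (A1 x * E t) * w1 x t)\<^sup>2"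
      unfolding Pt_def Pxx_def by (simp add: power2_eq_square algebra_simps)
    also have "\<dots> \<le> 0"
    proof -
      have "2 * (z x t * (A x / r\<^sup>2)) - 2 * (A1 x * E t)\<^sup>2 + 2 * (z x t * (2 / r\<^sup>2 * E t))
        + 8 * (A1 x * E t)\<^sup>2 - 2 * L \<le> 0"
        using zA zE A1b unfolding L_def by simp
      then have "(2 * (z x t * (A x / r\<^sup>2)) - 2 * (A1 x * E t)\<^sup>2 + 2 * (z x t * (2 / r\<^sup>2 * E t))
        + 8 * (A1 x * E t)\<^sup>2 - 2 * L) * (w1 x t)\<^sup>2 \<le> 0"
        by (intro mult_nonpos_nonneg) auto
      moreover have "0 \<le> (z x t * w2 x t + 2 * (A1 x * E t) * w1 x t)\<^sup>2" by simp
      ultimately show ?thesis by linarith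
    qed
    finally show "Pt x t \<le> Pxx x t" by simp
  next
    fix x t assume x: "x \<in> {x0 - r..x0 + r}" and t: "t \<in> {t0 - r\<^sup>2..t0}"
      and bd: "x = x0 - r \<or> x = x0 + r \<or> t = t0 - r\<^sup>2"
    have "z x t = 0" using bd r by (auto simp: z_def A_def E_def)
    moreover have "(w x t)\<^sup>2 \<le> M\<^sup>2" using M[OF x t] by (simp add: abs_le_square_iff[symmetric] M0)
    ultimately show "P x t \<le> L * M\<^sup>2" by (simp add: P_def L_def mult_left_mono divide_right_mono)
  qed (use r in auto)
  moreover have "z x0 t0 = 1" by (simp add: z_def A_def E_def)
  moreover have "0 \<le> L * (w x0 t0)\<^sup>2" by (simp add: L_def)
  ultimately have "(w1 x0 t0)\<^sup>2 \<le> L * M\<^sup>2" by (simp add: P_def)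
  \<comment> \<open>Here 15 is rounded up to 16, a perfect square.\<close>
  also have "\<dots> \<le> (4 * M / r)\<^sup>2" using r by (simp add: L_def power_divide power_mult_distrib divide_right_mono mult_right_mono)
  finally show ?thesis using M0 r by (simp add: abs_le_square_iff[symmetric])
qed

section \<open>Solutions of the heat equation with bounded derivatives\<close>

lemma mvt_within:
  fixes f f' :: "real \<Rightarrow> real"
  assumes "p < q" "{p..q} \<subseteq> S"
    and d: "\<And>y. y \<in> S \<Longrightarrow> (f has_real_derivative f' y) (at y within S)"
  shows "\<exists>z\<in>{p<..<q}. f q - f p = f' z * (q - p)"
proof -
  have d': "(f has_real_derivative f' y) (at y within {p..q})" if "y \<in> {p..q}" for y
    using d assms(2) that by (meson has_field_derivative_subset subsetD)
  have "continuous_on {p..q} f" using d' by (meson DERIV_continuous_on)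
  moreover have "(f has_derivative (*) (f' y)) (at y)" if "p < y" "y < q" for y
    using d'[of y] that by (simp add: at_within_Icc_at has_field_derivative_def)
  ultimately show ?thesis using mvt[OF assms(1), of f "\<lambda>y. (*) (f' y)"] by (metis greaterThanLessThan_iff)
qed

lemma mvt_bound:
  fixes f f' :: "real \<Rightarrow> real"
  assumes "continuous_on {p..q} f" "\<And>z. p < z \<Longrightarrow> z < q \<Longrightarrow> (f has_real_derivative f' z) (at z)"
    and "\<And>z. p < z \<Longrightarrow> z < q \<Longrightarrow> \<bar>f' z\<bar> \<le> B" and "p \<le> q"
  shows "\<bar>f q - f p\<bar> \<le> B * (q - p)"
proof (cases "p = q")
  case False
  then have "\<exists>z\<in>{p<..<q}. f q - f p = f' z * (q - p)"
    using mvt[of p q f "\<lambda>z. (*) (f' z)"] assms unfolding has_field_derivative_def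
    by (metis greaterThanLessThan_iff le_neq_trans)
  then obtain z where z: "p < z" "z < q" "f q - f p = f' z * (q - p)" by auto
  then show ?thesis using assms(3)[OF z(1,2)] assms(4) by (simp add: abs_mult mult_right_mono)
qed simp

text \<open>A Landau--Kolmogorov type interpolation inequality.\<close>

lemma derivative_interpolation:
  fixes f f' :: "real \<Rightarrow> real"
  assumes d: "\<And>y. y \<in> {lo..hi} \<Longrightarrow> (f has_real_derivative f' y) (at y within {lo..hi})"
    and \<eta>: "\<And>y. y \<in> {lo..hi} \<Longrightarrow> \<bar>f y\<bar> \<le> \<eta>"
    and L: "\<And>y z. y \<in> {lo..hi} \<Longrightarrow> z \<in> {lo..hi} \<Longrightarrow> \<bar>f' y - f' z\<bar> \<le> L * \<bar>y - z\<bar>"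
    and h: "0 < h" "2 * h \<le> hi - lo" and x: "x \<in> {lo..hi}" and L0: "L \<ge> 0"
  shows "\<bar>f' x\<bar> \<le> 2 * \<eta> / h + L * h"
proof -
  obtain p where p: "p \<in> {lo..hi}" "p + h \<in> {lo..hi}" "x = p \<or> x = p + h"
  proof (cases "x + h \<le> hi")
    case True then show ?thesis using that[of x] x h by auto
  next
    case False then show ?thesis using that[of "x - h"] x h by auto
  qed
  obtain z where z: "p < z" "z < p + h" "f (p + h) - f p = f' z * (p + h - p)"
    using mvt_within[of p "p + h" "{lo..hi}" f f', OF _ _ d] h p by auto
  then have "\<bar>f' z\<bar> * h = \<bar>f (p + h) - f p\<bar>" using h by (simp add: abs_mult)
  also have "\<dots> \<le> 2 * \<eta>" using \<eta>[OF p(1)] \<eta>[OF p(2)] by linarith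
  finally have "\<bar>f' z\<bar> \<le> 2 * \<eta> / h" using h by (simp add: field_simps)
  moreover have "\<bar>f' x - f' z\<bar> \<le> L * \<bar>x - z\<bar>" using p z x by (intro L) auto
  moreover have "L * \<bar>x - z\<bar> \<le> L * h" using p z L0 by (intro mult_left_mono) auto
  ultimately show ?thesis by linarith
qed

lemma continuous_on_section:
  assumes "continuous_on (A \<times> B) (\<lambda>(x, t). f x t)"
  shows "t \<in> B \<Longrightarrow> continuous_on A (\<lambda>x. f x t)" "x \<in> A \<Longrightarrow> continuous_on B (\<lambda>t. f x t)"
proof -
  assume t: "t \<in> B"
  have "continuous_on A ((\<lambda>(x, t). f x t) \<circ> (\<lambda>x. (x, t)))"
    by (intro continuous_on_compose continuous_on_subset[OF assms] continuous_intros) (use t in auto)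
  then show "continuous_on A (\<lambda>x. f x t)" by (simp add: o_def)
next
  assume x: "x \<in> A"
  have "continuous_on B ((\<lambda>(x, t). f x t) \<circ> (\<lambda>t. (x, t)))"
    by (intro continuous_on_compose continuous_on_subset[OF assms] continuous_intros) (use x in auto)
  then show "continuous_on B (\<lambda>t. f x t)" by (simp add: o_def)
qed

lemma le_on_Omega:
  assumes "continuous_on Omega h" "\<And>x. 0 < x \<Longrightarrow> x < 2 * pi \<Longrightarrow> h x \<le> (c :: real)" "x \<in> Omega"
  shows "h x \<le> c"
proof -
  have "closure {0<..<2 * pi} = Omega" by (simp add: Omega_def)
  then show ?thesis using continuous_le_on_closure[of "{0<..<2 * pi}" h x c] assms by auto
qed

lemma eq_on_Omega:
  assumes "continuous_on Omega h" "\<And>x. 0 < x \<Longrightarrow> x < 2 * pi \<Longrightarrow> h x = (0 :: real)" "x \<in> Omega"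
  shows "h x = 0"
  using le_on_Omega[of h 0 x] le_on_Omega[of "\<lambda>x. - h x" 0 x] assms by (auto intro: continuous_intros)

text \<open>The integral identity is stable under limits and holds up to the ends of the time
  interval, so it yields the one-sided derivatives there too.\<close>

lemma derivative_from_interior:
  fixes f g :: "real \<Rightarrow> real"
  assumes "\<And>t. t \<in> {0..T} \<Longrightarrow> f t - f 0 = integral {0..t} g" "continuous_on {0..T} g" "t \<in> {0..T}"
  shows "(f has_real_derivative g t) (at t within {0..T})"
proof -
  have "((\<lambda>t. integral {0..t} g) has_real_derivative g t) (at t within {0..T})"
    by (rule integral_has_real_derivative) (use assms in auto)
  then have "((\<lambda>t. integral {0..t} g + f 0) has_real_derivative g t) (at t within {0..T})"
    by (auto intro!: derivative_eq_intros)
  then show ?thesis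
  proof (rule has_field_derivative_transform_within[where d = 1])
    show "integral {0..s} g + f 0 = f s" if "s \<in> {0..T}" for s
      unfolding assms(1)[OF that, symmetric] by simp
  qed (use assms(3) in auto)
qed

text \<open>Later m = k + l + 2. Beyond the equation itself, only weak x-derivatives of the single
  time slices are bounded. All classical derivatives and all regularity in time are derived below by
  mollification in x.\<close>

locale bounded_heat =
  fixes T :: real and m :: nat and M :: real and u0 :: "real \<Rightarrow> real" and u :: "real \<Rightarrow> real \<Rightarrow> real"
  assumes T: "T > 0" and m: "4 \<le> m" and heat: "heat_solution T u0 u"
    and weak: "\<And>t i. t \<in> {0..T} \<Longrightarrow> i \<le> m \<Longrightarrow>
        \<exists>g. weak_deriv i (\<lambda>x. u x t) g \<and> (AE x in lebesgue_on Omega. \<bar>g x\<bar> \<le> M)"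
begin

lemma u_cont: "continuous_on (Omega \<times> {0..T}) (\<lambda>(x, t). u x t)"
  using heat by (simp add: heat_solution_def)

lemma u_cont_x: "t \<in> {0..T} \<Longrightarrow> continuous_on Omega (\<lambda>x. u x t)"
  by (rule continuous_on_section(1)[OF u_cont])

definition \<delta> :: "nat \<Rightarrow> real" where "\<delta> n = 1 / (real n + 2)"
definition shrink :: "nat \<Rightarrow> real" where "shrink n = 1 - 2 * \<delta> n / pi"
text \<open>An affine contraction of \<open>Omega\<close> about pi onto
  [2 \<delta>, 2 pi - 2 \<delta>], so that the mollification is evaluated only where its kernel fits
  inside \<open>Omega\<close>.\<close>

definition squeeze :: "nat \<Rightarrow> real \<Rightarrow> real" where "squeeze n x = shrink n * x + 2 * \<delta> n"
definition U :: "nat \<Rightarrow> nat \<Rightarrow> real \<Rightarrow> real \<Rightarrow> real" where "U n i x t = mconv (\<delta> n) i (\<lambda>y. u y t) x"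
text \<open>Two regularisations are used: \<open>U\<close> solves the heat equation but is
  controlled only away from the end points, whereas its pull-back \<open>V\<close>, with the chain
  rule factor, is controlled on all of \<open>Omega\<close> and yields uniform convergence up to the
  boundary.\<close>

definition V :: "nat \<Rightarrow> nat \<Rightarrow> real \<Rightarrow> real \<Rightarrow> real" where "V n i x t = shrink n ^ i * U n i (squeeze n x) t"

lemma \<delta>_pos: "\<delta> n > 0" by (simp add: \<delta>_def)

lemma \<delta>_lim: "\<delta> \<longlonglongrightarrow> 0"
  unfolding \<delta>_def by real_asymp

lemma eventually_\<delta>: "e > 0 \<Longrightarrow> eventually (\<lambda>n. \<delta> n < e) sequentially"
  using order_tendstoD(2)[OF \<delta>_lim] by simp

lemma shrink_range: "0 < shrink n" "shrink n \<le> 1"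
proof -
  have "2 * \<delta> n \<le> 1" unfolding \<delta>_def by (simp add: field_simps)
  then show "0 < shrink n" using pi_ge_two unfolding shrink_def by (simp add: field_simps)
  show "shrink n \<le> 1" using \<delta>_pos[of n] by (simp add: shrink_def)
qed

lemma squeeze_range:
  assumes "x \<in> Omega"
  shows "2 * \<delta> n \<le> squeeze n x" "squeeze n x \<le> 2 * pi - 2 * \<delta> n" "\<bar>squeeze n x - x\<bar> \<le> 2 * \<delta> n"
proof -
  have x: "0 \<le> x" "x \<le> 2 * pi" using assms by (auto simp: Omega_def)
  show "2 * \<delta> n \<le> squeeze n x" using x shrink_range[of n] by (simp add: squeeze_def)
  have "shrink n * x \<le> shrink n * (2 * pi)" using x shrink_range[of n] by (intro mult_left_mono) auto
  also have "\<dots> = 2 * pi - 4 * \<delta> n" by (simp add: shrink_def field_simps)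
  finally show "squeeze n x \<le> 2 * pi - 2 * \<delta> n" by (simp add: squeeze_def)
  have "squeeze n x - x = 2 * \<delta> n * (1 - x / pi)" by (simp add: squeeze_def shrink_def field_simps)
  moreover have "\<bar>1 - x / pi\<bar> \<le> 1" using x by (auto simp: abs_le_iff field_simps)
  ultimately show "\<bar>squeeze n x - x\<bar> \<le> 2 * \<delta> n"
    using \<delta>_pos[of n] by (simp add: abs_mult mult_left_le)
qed

lemma U_deriv: "t \<in> {0..T} \<Longrightarrow> ((\<lambda>x. U n i x t) has_real_derivative U n (Suc i) x t) (at x)"
  unfolding U_def by (rule mconv_deriv[OF u_cont_x])

lemma U_bound: "i \<le> m \<Longrightarrow> t \<in> {0..T} \<Longrightarrow> \<delta> n < x \<Longrightarrow> x < 2 * pi - \<delta> n \<Longrightarrow> \<bar>U n i x t\<bar> \<le> M"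
  unfolding U_def using mconv_weak_bound[OF u_cont_x _ _ \<delta>_pos] weak by blast

lemma U_cont: "continuous_on (UNIV \<times> {0..T}) (\<lambda>(x, t). U n i x t)"
proof -
  have "continuous_on (UNIV \<times> {0..T}) (\<lambda>p. integral (cbox 0 (2 * pi)) (\<lambda>y. u y (snd p) * dmoll (\<delta> n) i (fst p - y)))"
  proof (rule integral_continuous_on_param)
    have "continuous_on ((UNIV \<times> {0..T}) \<times> cbox 0 (2 * pi)) (\<lambda>q. u (snd q) (snd (fst q)))"
      using continuous_on_compose2[OF u_cont, of "(UNIV \<times> {0..T}) \<times> cbox 0 (2 * pi)" "\<lambda>q. (snd q, snd (fst q))"]
      by (force intro: continuous_intros simp: Omega_def)
    then show "continuous_on ((UNIV \<times> {0..T}) \<times> cbox 0 (2 * pi)) (\<lambda>(p, y). u y (snd p) * dmoll (\<delta> n) i (fst p - y))"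
      unfolding case_prod_beta by (intro continuous_intros)
  qed
  then show ?thesis unfolding U_def mconv_def by (simp add: Omega_def case_prod_beta)
qed

lemma U_cont_on: "S \<subseteq> {0..T} \<Longrightarrow> continuous_on (R \<times> S) (\<lambda>(x, t). U n i x t)"
  by (rule continuous_on_subset[OF U_cont]) auto

lemma U_cont_t: "continuous_on {0..T} (\<lambda>t. U n i x t)"
  by (rule continuous_on_section(2)[OF U_cont]) simp

lemma V_deriv:
  assumes "t \<in> {0..T}"
  shows "((\<lambda>x. V n i x t) has_real_derivative V n (Suc i) x t) (at x within S)"
proof -
  have "(squeeze n has_real_derivative shrink n) (at x within S)"
    unfolding squeeze_def[abs_def] by (auto intro!: derivative_eq_intros)
  from DERIV_cmult[OF DERIV_chain2[OF U_deriv[OF assms] this], of "shrink n ^ i"]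
  show ?thesis unfolding V_def by (simp add: ac_simps)
qed

lemma M_nonneg: "M \<ge> 0"
proof -
  have "\<delta> 0 = 1 / 2" by (simp add: \<delta>_def)
  then have "\<bar>U 0 0 1 0\<bar> \<le> M" using T pi_ge_two by (intro U_bound) auto
  then show ?thesis by linarith
qed

lemma V_bound: "i \<le> m \<Longrightarrow> t \<in> {0..T} \<Longrightarrow> x \<in> Omega \<Longrightarrow> \<bar>V n i x t\<bar> \<le> M"
proof -
  assume i: "i \<le> m" "t \<in> {0..T}" "x \<in> Omega"
  have "\<bar>U n i (squeeze n x) t\<bar> \<le> M"
    using squeeze_range[OF i(3), of n] \<delta>_pos[of n] by (intro U_bound i) auto
  moreover have "\<bar>shrink n ^ i\<bar> \<le> 1" using shrink_range[of n] by (simp add: power_le_one)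
  ultimately have "\<bar>shrink n ^ i\<bar> * \<bar>U n i (squeeze n x) t\<bar> \<le> 1 * M"
    by (intro mult_mono) auto
  then show "\<bar>V n i x t\<bar> \<le> M" by (simp add: V_def abs_mult)
qed

lemma V_cont: "continuous_on (Omega \<times> {0..T}) (\<lambda>(x, t). V n i x t)"
proof -
  have "continuous_on (Omega \<times> {0..T}) (\<lambda>p. U n i (squeeze n (fst p)) (snd p))"
    using continuous_on_compose2[OF U_cont, of "Omega \<times> {0..T}" "\<lambda>p. (squeeze n (fst p), snd p)"]
    by (force intro: continuous_intros simp: squeeze_def)
  then show ?thesis unfolding V_def case_prod_beta by (intro continuous_intros)
qed

lemma V_0_limit: "uniform_limit (Omega \<times> {0..T}) (\<lambda>n (x, t). V n 0 x t) (\<lambda>(x, t). u x t) sequentially"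
proof (rule uniform_limitI)
  fix e :: real assume e: "e > 0"
  have "compact (Omega \<times> {0..T})" unfolding Omega_def by (intro compact_Times compact_Icc)
  then have "uniformly_continuous_on (Omega \<times> {0..T}) (\<lambda>(x, t). u x t)"
    using u_cont compact_uniformly_continuous by blast
  then obtain d where d: "d > 0" "\<And>p q. p \<in> Omega \<times> {0..T} \<Longrightarrow> q \<in> Omega \<times> {0..T} \<Longrightarrow> dist q p < d \<Longrightarrow>
      dist ((\<lambda>(x, t). u x t) q) ((\<lambda>(x, t). u x t) p) < e / 2"
    using e unfolding uniformly_continuous_on_def by (metis half_gt_zero)
  \<comment> \<open>A point within \<delta> of \<open>squeeze n x\<close> is within 3 \<delta> of
    x.\<close>
  have "eventually (\<lambda>n. \<delta> n < d / 3) sequentially" using d by (intro eventually_\<delta>) simp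
  then show "eventually (\<lambda>n. \<forall>p\<in>Omega \<times> {0..T}. dist ((\<lambda>(x, t). V n 0 x t) p) ((\<lambda>(x, t). u x t) p) < e) sequentially"
  proof eventually_elim
    case (elim n)
    have "\<bar>V n 0 x t - u x t\<bar> < e" if "x \<in> Omega" "t \<in> {0..T}" for x t
    proof -
      note sq = squeeze_range[OF that(1), of n]
      have "\<bar>mconv (\<delta> n) 0 (\<lambda>y. u y t) (squeeze n x) - u x t\<bar> \<le> e / 2"
      proof (rule mconv_0_close[OF u_cont_x[OF that(2)] \<delta>_pos])
        show "\<delta> n \<le> squeeze n x" "squeeze n x \<le> 2 * pi - \<delta> n" using sq \<delta>_pos[of n] by auto
        fix y assume y: "y \<in> Omega" "\<bar>y - squeeze n x\<bar> \<le> \<delta> n"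
        have "dist (y, t) (x, t) < d" using y sq elim by (simp add: dist_Pair_Pair dist_real_def)
        then show "\<bar>u y t - u x t\<bar> \<le> e / 2" using d(2)[of "(x, t)" "(y, t)"] y that
          by (simp add: dist_real_def)
      qed
      then show ?thesis using e by (simp add: V_def U_def)
    qed
    then show ?case by (auto simp: dist_real_def)
  qed
qed

lemma V_Lipschitz:
  assumes "Suc i \<le> m" "t \<in> {0..T}" "x \<in> Omega" "y \<in> Omega"
  shows "\<bar>V n i x t - V n i y t\<bar> \<le> M * \<bar>x - y\<bar>"
  using field_differentiable_bound[of Omega "\<lambda>x. V n i x t" "\<lambda>x. V n (Suc i) x t" M x y]
    V_deriv[OF assms(2)] V_bound[OF assms(1,2)] assms(3,4) by (simp add: Omega_def)

text \<open>Induction by interpolation: differences of order i are small, the derivatives of order i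
  + 1 are Lipschitz uniformly in n, hence differences of order i + 1 are small. The Lipschitz bound
  uses one order more, which is why the range ends at m - 1.\<close>

lemma V_Cauchy: "i \<le> m - 1 \<Longrightarrow> uniformly_Cauchy_on (Omega \<times> {0..T}) (\<lambda>n (x, t). V n i x t)"
proof (induction i)
  case 0
  then show ?case
    using V_0_limit uniformly_convergent_Cauchy uniformly_convergent_on_def by blast
next
  case (Suc i)
  show ?case
  proof (rule uniformly_Cauchy_onI)
    fix e :: real assume e: "e > 0"
    \<comment> \<open>The bound pi keeps an interval of length 2 h inside \<open>Omega\<close>. The
      two interpolation terms become at most e/2 and, with \<eta> below, e/4; the added 1 covers M =
      0.\<close>
    define h where "h = min pi (e / (4 * M + 1))"
    have h: "0 < h" "h \<le> pi" "2 * M * h < e / 2 + e / 4"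
    proof -
      show "0 < h" "h \<le> pi" using e M_nonneg by (auto simp: h_def)
      have "2 * M * h \<le> 2 * M * (e / (4 * M + 1))" using M_nonneg by (intro mult_left_mono) (auto simp: h_def)
      also have "\<dots> \<le> e / 2" using e M_nonneg by (simp add: field_simps)
      finally show "2 * M * h < e / 2 + e / 4" using e by simp
    qed
    define \<eta> where "\<eta> = e * h / 8"
    have "\<eta> > 0" using e h by (simp add: \<eta>_def)
    then obtain N where N: "\<And>p n k. p \<in> Omega \<times> {0..T} \<Longrightarrow> n \<ge> N \<Longrightarrow> k \<ge> N \<Longrightarrow>
        dist ((\<lambda>(x, t). V n i x t) p) ((\<lambda>(x, t). V k i x t) p) < \<eta>"
      using Suc unfolding uniformly_Cauchy_on_def by (meson Suc_leD)
    show "\<exists>N. \<forall>p\<in>Omega \<times> {0..T}. \<forall>n\<ge>N. \<forall>k\<ge>N.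
        dist ((\<lambda>(x, t). V n (Suc i) x t) p) ((\<lambda>(x, t). V k (Suc i) x t) p) < e"
    proof (intro exI[of _ N] ballI allI impI)
      fix p n k assume p: "p \<in> Omega \<times> {0..T}" and nk: "n \<ge> N" "k \<ge> N"
      obtain x t where xt: "p = (x, t)" "x \<in> Omega" "t \<in> {0..T}" using p by auto
      have "\<bar>V n (Suc i) x t - V k (Suc i) x t\<bar> \<le> 2 * \<eta> / h + 2 * M * h"
      proof (rule derivative_interpolation[where lo = 0 and hi = "2 * pi"
            and f = "\<lambda>x. V n i x t - V k i x t" and f' = "\<lambda>x. V n (Suc i) x t - V k (Suc i) x t"])
        show "((\<lambda>x. V n i x t - V k i x t) has_real_derivative V n (Suc i) y t - V k (Suc i) y t) (at y within {0..2 * pi})"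
          for y by (intro DERIV_diff V_deriv xt)
        show "\<bar>V n i y t - V k i y t\<bar> \<le> \<eta>" if "y \<in> {0..2 * pi}" for y
          using N[of "(y, t)", OF _ nk] that xt by (simp add: Omega_def dist_real_def)
        fix y z assume yz: "y \<in> {0..2 * pi}" "z \<in> {0..2 * pi}"
        have "\<bar>V n (Suc i) y t - V n (Suc i) z t\<bar> \<le> M * \<bar>y - z\<bar>" "\<bar>V k (Suc i) y t - V k (Suc i) z t\<bar> \<le> M * \<bar>y - z\<bar>"
          using Suc.prems m yz xt by (auto intro!: V_Lipschitz simp: Omega_def)
        then show "\<bar>V n (Suc i) y t - V k (Suc i) y t - (V n (Suc i) z t - V k (Suc i) z t)\<bar> \<le> 2 * M * \<bar>y - z\<bar>"
          by linarith
      qed (use h xt M_nonneg in \<open>auto simp: Omega_def\<close>)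
      also have "2 * \<eta> / h = e / 4" using h by (simp add: \<eta>_def)
      finally show "dist ((\<lambda>(x, t). V n (Suc i) x t) p) ((\<lambda>(x, t). V k (Suc i) x t) p) < e"
        using h xt by (simp add: dist_real_def)
    qed
  qed
qed

text \<open>The classical x-derivative of order i of u for i <= m - 1, see \<open>D_0\<close> and
  \<open>D_deriv\<close>. The order m survives only in the Lipschitz constant of
  \<open>D (m - 1)\<close>.\<close>

definition D :: "nat \<Rightarrow> real \<Rightarrow> real \<Rightarrow> real" where
  "D i x t = lim (\<lambda>n. V n i x t)"

lemma D_limit:
  assumes "i \<le> m - 1"
  shows "uniform_limit (Omega \<times> {0..T}) (\<lambda>n (x, t). V n i x t) (\<lambda>(x, t). D i x t) sequentially"
proof -
  have "uniformly_convergent_on (Omega \<times> {0..T}) (\<lambda>n (x, t). V n i x t)"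
    using V_Cauchy[OF assms] Cauchy_uniformly_convergent by blast
  then show ?thesis
    unfolding uniformly_convergent_uniform_limit_iff D_def by (simp add: case_prod_beta')
qed

lemma D_tendsto:
  assumes "i \<le> m - 1" "x \<in> Omega" "t \<in> {0..T}"
  shows "(\<lambda>n. V n i x t) \<longlonglongrightarrow> D i x t"
  using tendsto_uniform_limitI[OF D_limit[OF assms(1)], of "(x, t)"] assms by simp

lemma D_0: "x \<in> Omega \<Longrightarrow> t \<in> {0..T} \<Longrightarrow> D 0 x t = u x t"
  using tendsto_uniform_limitI[OF V_0_limit, of "(x, t)"] D_tendsto[of 0 x t] LIMSEQ_unique by auto

lemma D_cont: "i \<le> m - 1 \<Longrightarrow> continuous_on (Omega \<times> {0..T}) (\<lambda>(x, t). D i x t)"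
  by (rule uniform_limit_theorem[OF _ D_limit]) (auto intro: V_cont always_eventually)

lemma D_cont_x: "i \<le> m - 1 \<Longrightarrow> t \<in> {0..T} \<Longrightarrow> continuous_on Omega (\<lambda>x. D i x t)"
  by (rule continuous_on_section(1)[OF D_cont])

lemma D_cont_t: "i \<le> m - 1 \<Longrightarrow> x \<in> Omega \<Longrightarrow> continuous_on {0..T} (\<lambda>t. D i x t)"
  by (rule continuous_on_section(2)[OF D_cont])

lemma D_bound: "i \<le> m - 1 \<Longrightarrow> x \<in> Omega \<Longrightarrow> t \<in> {0..T} \<Longrightarrow> \<bar>D i x t\<bar> \<le> M"
  by (rule Lim_bounded[where M = 0, OF tendsto_rabs[OF D_tendsto]]) (auto intro: V_bound)

lemma D_Lipschitz:
  assumes "i \<le> m - 1" "x \<in> Omega" "y \<in> Omega" "t \<in> {0..T}"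
  shows "\<bar>D i x t - D i y t\<bar> \<le> M * \<bar>x - y\<bar>"
  by (rule Lim_bounded[where M = 0, OF tendsto_rabs[OF tendsto_diff[OF D_tendsto D_tendsto]]])
    (use assms m in \<open>auto intro: V_Lipschitz\<close>)

lemma D_deriv:
  assumes i: "Suc i \<le> m - 1" and x: "x \<in> Omega" and t: "t \<in> {0..T}"
  shows "((\<lambda>x. D i x t) has_real_derivative D (Suc i) x t) (at x within Omega)"
proof -
  have "\<exists>g. \<forall>x\<in>Omega. (\<lambda>n. V n i x t) \<longlonglongrightarrow> g x \<and> (g has_derivative (*) (D (Suc i) x t)) (at x within Omega)"
  proof (rule has_derivative_sequence)
    show "convex Omega" by (simp add: Omega_def)
    show "((\<lambda>x. V n i x t) has_derivative (*) (V n (Suc i) x t)) (at x within Omega)" for n x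
      using V_deriv[OF t] by (simp add: has_field_derivative_def)
    show "0 \<in> Omega" by (simp add: Omega_def)
    then show "(\<lambda>n. V n i 0 t) \<longlonglongrightarrow> D i 0 t" using D_tendsto t i by auto
    fix e :: real assume "e > 0"
    from uniform_limitD[OF D_limit[OF i] this]
    show "\<forall>\<^sub>F n in sequentially. \<forall>x\<in>Omega. \<forall>h. norm (V n (Suc i) x t * h - D (Suc i) x t * h) \<le> e * norm h"
    proof eventually_elim
      case (elim n)
      have "norm (V n (Suc i) x t * h - D (Suc i) x t * h) \<le> e * norm h" if "x \<in> Omega" for x h
      proof -
        have "\<bar>V n (Suc i) x t - D (Suc i) x t\<bar> \<le> e"
          using bspec[OF elim, of "(x, t)"] that t by (simp add: dist_real_def)
        then show ?thesis by (simp add: abs_mult mult_right_mono flip: left_diff_distrib)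
      qed
      then show ?case by blast
    qed
  qed
  then obtain g where g: "\<And>x. x \<in> Omega \<Longrightarrow> (\<lambda>n. V n i x t) \<longlonglongrightarrow> g x"
      "\<And>x. x \<in> Omega \<Longrightarrow> (g has_derivative (*) (D (Suc i) x t)) (at x within Omega)" by blast
  have "g y = D i y t" if "y \<in> Omega" for y
    using g(1)[OF that] D_tendsto[of i y t] i t that LIMSEQ_unique by auto
  then show ?thesis using g(2)[OF x] x
    unfolding has_field_derivative_def by (rule_tac has_derivative_transform) auto
qed

section \<open>Identification with \<open>dx\<close>, and regularity in time\<close>

lemma vector_derivative_Omega:
  assumes "x \<in> Omega" "\<And>y. y \<in> Omega \<Longrightarrow> f y = g y" "(g has_real_derivative d) (at x within Omega)"
  shows "vector_derivative f (at x within Omega) = d"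
proof -
  have "(f has_vector_derivative d) (at x within Omega)"
    using has_vector_derivative_transform[of x Omega f g d] assms
    by (simp add: has_real_derivative_iff_has_vector_derivative)
  then show ?thesis using assms(1) unfolding Omega_def
    by (intro vector_derivative_within_closed_interval) auto
qed

lemma dx_u: "x \<in> Omega \<Longrightarrow> t \<in> {0..T} \<Longrightarrow> dx u x t = D 1 x t"
  unfolding dx_def using m D_deriv[of 0 x t]
  by (intro vector_derivative_Omega[where g = "\<lambda>x. D 0 x t"]) (auto simp: D_0)

lemma dx_dx_u: "x \<in> Omega \<Longrightarrow> t \<in> {0..T} \<Longrightarrow> dx (dx u) x t = D 2 x t"
  unfolding dx_def[of "dx u"] using m D_deriv[of 1 x t]
  by (intro vector_derivative_Omega[where g = "\<lambda>x. D 1 x t"]) (auto simp: dx_u numeral_2_eq_2)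

lemma u_deriv_t:
  assumes "x \<in> Omega" "0 < t" "t < T"
  shows "(u x has_real_derivative D 2 x t) (at t)"
proof -
  have "(u x has_real_derivative dx (dx u) x t) (at t within {0..T})"
    using heat assms unfolding heat_solution_def by simp
  then show ?thesis using dx_dx_u[OF assms(1), of t] assms by (simp add: at_within_Icc_at)
qed

text \<open>Differentiation under the integral replaces u by its second x-derivative, and two
  integrations by parts move both derivatives onto the kernel: mollification in x preserves the heat
  equation, for every order i.\<close>

lemma U_deriv_t:
  assumes t: "0 < t" "t < T" and x: "\<delta> n < x" "x < 2 * pi - \<delta> n"
  shows "(U n i x has_real_derivative U n (Suc (Suc i)) x t) (at t)"
proof -
  have "((\<lambda>t. integral (cbox 0 (2 * pi)) (\<lambda>y. u y t * dmoll (\<delta> n) i (x - y))) has_field_derivative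
      integral (cbox 0 (2 * pi)) (\<lambda>y. D 2 y t * dmoll (\<delta> n) i (x - y))) (at t within {0<..<T})"
  proof (rule leibniz_rule_field_derivative)
    show "((\<lambda>t. u y t * dmoll (\<delta> n) i (x - y)) has_real_derivative D 2 y s * dmoll (\<delta> n) i (x - y)) (at s within {0<..<T})"
      if "s \<in> {0<..<T}" "y \<in> cbox 0 (2 * pi)" for s y
      using DERIV_cmult_right[OF has_field_derivative_at_within[OF u_deriv_t[of y s]]] that by (simp add: Omega_def)
    show "(\<lambda>y. u y s * dmoll (\<delta> n) i (x - y)) integrable_on cbox 0 (2 * pi)" if "s \<in> {0<..<T}" for s
      using u_cont_x[of s] that by (intro integrable_continuous continuous_intros) (auto simp: Omega_def)
    have "continuous_on ({0<..<T} \<times> cbox 0 (2 * pi)) (\<lambda>q. D 2 (snd q) (fst q))"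
      using continuous_on_compose2[OF D_cont[of 2], of "{0<..<T} \<times> cbox 0 (2 * pi)" "\<lambda>q. (snd q, fst q)"] m
      by (force intro: continuous_intros simp: Omega_def)
    then show "continuous_on ({0<..<T} \<times> cbox 0 (2 * pi)) (\<lambda>(s, y). D 2 y s * dmoll (\<delta> n) i (x - y))"
      unfolding case_prod_beta by (intro continuous_intros)
  qed (use t in auto)
  moreover have "at t within {0<..<T} = at t" by (rule at_within_open) (use t in auto)
  moreover have "(\<lambda>t. integral (cbox 0 (2 * pi)) (\<lambda>y. u y t * dmoll (\<delta> n) i (x - y))) = U n i x"
    by (rule ext) (simp only: U_def mconv_def Omega_def cbox_interval)
  moreover have "integral (cbox 0 (2 * pi)) (\<lambda>y. D 2 y t * dmoll (\<delta> n) i (x - y)) = mconv (\<delta> n) i (\<lambda>y. D 2 y t) x"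
    by (simp only: mconv_def Omega_def cbox_interval)
  ultimately have "(U n i x has_real_derivative mconv (\<delta> n) i (\<lambda>y. D 2 y t) x) (at t)"
    by (simp only:)
  moreover have "mconv (\<delta> n) i (\<lambda>y. D 2 y t) x = mconv (\<delta> n) (Suc (Suc i)) (\<lambda>y. D 0 y t) x"
  proof -
    have "mconv (\<delta> n) i (\<lambda>y. D 2 y t) x = mconv (\<delta> n) (Suc i) (\<lambda>y. D 1 y t) x"
      using m t D_deriv[of 1 _ t] D_cont_x[of 2 t]
      by (intro mconv_by_parts[OF _ _ \<delta>_pos x]) (auto simp: numeral_2_eq_2)
    also have "\<dots> = mconv (\<delta> n) (Suc (Suc i)) (\<lambda>y. D 0 y t) x"
      using m t D_deriv[of 0 _ t] D_cont_x[of 1 t]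
      by (intro mconv_by_parts[OF _ _ \<delta>_pos x]) auto
    finally show ?thesis .
  qed
  moreover have "mconv (\<delta> n) (Suc (Suc i)) (\<lambda>y. D 0 y t) x = U n (Suc (Suc i)) x t"
    unfolding U_def mconv_def using t by (intro integral_cong) (simp add: D_0)
  ultimately show ?thesis by simp
qed

text \<open>\<open>U\<close> and \<open>V\<close> differ by the displacement of x under
  \<open>squeeze\<close>, at most 2 \<delta>, and by the factor \<open>shrink n ^ i\<close>. Both
  effects vanish uniformly in t.\<close>

lemma U_limit:
  assumes i: "i \<le> m - 1" and x: "0 < x" "x < 2 * pi"
  shows "uniform_limit {0..T} (\<lambda>n t. U n i x t) (\<lambda>t. D i x t) sequentially"
proof (rule uniform_limitI)
  fix e :: real assume e: "e > 0"
  have xO: "x \<in> Omega" using x by (simp add: Omega_def)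
  have "(\<lambda>n. M * (2 * \<delta> n) + (1 - shrink n ^ i) * M) \<longlonglongrightarrow> M * (2 * 0) + (1 - (1 - 2 * 0 / pi) ^ i) * M"
    unfolding shrink_def by (intro tendsto_intros \<delta>_lim) auto
  then have "eventually (\<lambda>n. M * (2 * \<delta> n) + (1 - shrink n ^ i) * M < e / 2) sequentially"
    by (rule order_tendstoD(2)) (use e in simp)
  moreover have "eventually (\<lambda>n. \<delta> n < min x (2 * pi - x)) sequentially" using x by (intro eventually_\<delta>) simp
  moreover have "eventually (\<lambda>n. \<forall>p\<in>Omega \<times> {0..T}. dist ((\<lambda>(x, t). V n i x t) p) ((\<lambda>(x, t). D i x t) p) < e / 2) sequentially"
    by (rule uniform_limitD[OF D_limit[OF i]]) (use e in simp)
  ultimately show "eventually (\<lambda>n. \<forall>t\<in>{0..T}. dist (U n i x t) (D i x t) < e) sequentially"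
  proof eventually_elim
    case (elim n)
    show ?case
    proof
      fix t assume t: "t \<in> {0..T}"
      define z where "z = squeeze n x"
      have zr: "\<delta> n < z" "z < 2 * pi - \<delta> n" "\<bar>z - x\<bar> \<le> 2 * \<delta> n"
        using squeeze_range[OF xO, of n] \<delta>_pos[of n] by (auto simp: z_def)
      have "\<bar>U n i x t - U n i z t\<bar> \<le> M * \<bar>x - z\<bar>"
        using field_differentiable_bound[of "{\<delta> n<..<2 * pi - \<delta> n}" "\<lambda>x. U n i x t" "\<lambda>x. U n (Suc i) x t" M x z]
          U_deriv[OF t] U_bound[of "Suc i" t n] i m t zr elim(2) by (auto simp: has_field_derivative_at_within)
      also have "\<dots> \<le> M * (2 * \<delta> n)" using zr M_nonneg by (intro mult_left_mono) auto
      finally have 1: "\<bar>U n i x t - U n i z t\<bar> \<le> M * (2 * \<delta> n)" .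
      have p1: "shrink n ^ i \<le> 1" using shrink_range[of n] by (simp add: power_le_one)
      have "U n i z t - V n i x t = (1 - shrink n ^ i) * U n i z t" by (simp add: V_def z_def algebra_simps)
      moreover have "\<bar>(1 - shrink n ^ i) * U n i z t\<bar> \<le> (1 - shrink n ^ i) * M"
        using p1 U_bound[of i t n z] zr i t by (simp add: abs_mult mult_left_mono)
      ultimately have 2: "\<bar>U n i z t - V n i x t\<bar> \<le> (1 - shrink n ^ i) * M" by simp
      have "\<bar>V n i x t - D i x t\<bar> < e / 2" using bspec[OF elim(3), of "(x, t)"] xO t by (simp add: dist_real_def)
      then show "dist (U n i x t) (D i x t) < e" using 1 2 elim(1) unfolding dist_real_def by linarith
    qed
  qed
qed

lemma U_tendsto: "i \<le> m - 1 \<Longrightarrow> 0 < x \<Longrightarrow> x < 2 * pi \<Longrightarrow> t \<in> {0..T} \<Longrightarrow> (\<lambda>n. U n i x t) \<longlonglongrightarrow> D i x t"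
  using tendsto_uniform_limitI[OF U_limit] by blast

text \<open>The fundamental theorem for \<open>U\<close> at an interior x survives the uniform
  limit, and continuity in x extends it to the end points of \<open>Omega\<close>. The integral form
  also includes the times 0 and T.\<close>

lemma D_integral_t:
  assumes i: "Suc (Suc i) \<le> m - 1" and x: "x \<in> Omega" and t: "t \<in> {0..T}"
  shows "D i x t - D i x 0 = integral {0..t} (\<lambda>s. D (Suc (Suc i)) x s)"
proof -
  have interior: "D i x t - D i x 0 = integral {0..t} (\<lambda>s. D (Suc (Suc i)) x s)" if x: "0 < x" "x < 2 * pi" for x
  proof -
    have "uniform_limit {0..t} (\<lambda>n s. U n (Suc (Suc i)) x s) (\<lambda>s. D (Suc (Suc i)) x s) sequentially"
      by (rule uniform_limit_on_subset[OF U_limit[OF i x]]) (use t in auto)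
    then obtain J K where J: "\<And>n. ((\<lambda>s. U n (Suc (Suc i)) x s) has_integral J n) {0..t}"
      and K: "((\<lambda>s. D (Suc (Suc i)) x s) has_integral K) {0..t}" and JK: "J \<longlonglongrightarrow> K"
      by (rule uniform_limit_integral) (use t in \<open>auto intro: continuous_on_subset[OF U_cont_t]\<close>)
    have "eventually (\<lambda>n. \<delta> n < min x (2 * pi - x)) sequentially" using x by (intro eventually_\<delta>) simp
    then have "eventually (\<lambda>n. J n = U n i x t - U n i x 0) sequentially"
    proof eventually_elim
      case (elim n)
      have "((\<lambda>s. U n (Suc (Suc i)) x s) has_integral U n i x t - U n i x 0) {0..t}"
      proof (rule fundamental_theorem_of_calculus_interior)
        show "continuous_on {0..t} (U n i x)" by (rule continuous_on_subset[OF U_cont_t]) (use t in auto)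
        show "(U n i x has_vector_derivative U n (Suc (Suc i)) x s) (at s)" if "s \<in> {0<..<t}" for s
          using U_deriv_t[of s n x i] that t elim
          by (simp add: has_real_derivative_iff_has_vector_derivative)
      qed (use t in simp)
      then show ?case using J has_integral_unique by blast
    qed
    then have "(\<lambda>n. U n i x t - U n i x 0) \<longlonglongrightarrow> K" using JK by (rule Lim_transform_eventually[rotated])
    moreover have "(\<lambda>n. U n i x t - U n i x 0) \<longlonglongrightarrow> D i x t - D i x 0"
      by (intro tendsto_diff U_tendsto) (use i x t T in auto)
    ultimately have "K = D i x t - D i x 0" using LIMSEQ_unique by blast
    then show ?thesis using K by (simp add: integral_unique)
  qed
  have "continuous_on Omega (\<lambda>x. integral (cbox 0 t) (\<lambda>s. D (Suc (Suc i)) x s))"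
    by (rule integral_continuous_on_param, rule continuous_on_subset[OF D_cont[OF i]]) (use t in auto)
  then have "continuous_on Omega (\<lambda>x. D i x t - D i x 0 - integral {0..t} (\<lambda>s. D (Suc (Suc i)) x s))"
    using i t T by (intro continuous_intros D_cont_x) auto
  from eq_on_Omega[OF this _ x] show ?thesis using interior by simp
qed

lemma D_deriv_t:
  assumes "Suc (Suc i) \<le> m - 1" "x \<in> Omega" "t \<in> {0..T}"
  shows "((\<lambda>t. D i x t) has_real_derivative D (Suc (Suc i)) x t) (at t within {0..T})"
  by (rule derivative_from_interior) (use assms D_integral_t D_cont_t in auto)

text \<open>The time derivative of \<open>D (m - 2)\<close> would have order m, where no classical
  derivative is at hand. Its mollification \<open>U n m\<close> is bounded by M uniformly in n, so
  the mean value estimate passes to the limit.\<close>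

lemma D_Lipschitz_t:
  assumes x: "x \<in> Omega" and t: "s \<in> {0..T}" "t \<in> {0..T}"
  shows "\<bar>D (m - 2) x t - D (m - 2) x s\<bar> \<le> M * \<bar>t - s\<bar>"
proof -
  have *: "\<bar>D (m - 2) x t - D (m - 2) x s\<bar> \<le> M * \<bar>t - s\<bar>"
    if t: "s \<in> {0..T}" "t \<in> {0..T}" "s \<le> t" for s t
  proof (rule le_on_Omega[of "\<lambda>x. \<bar>D (m - 2) x t - D (m - 2) x s\<bar>", OF _ _ x])
    show "continuous_on Omega (\<lambda>x. \<bar>D (m - 2) x t - D (m - 2) x s\<bar>)"
      using t by (intro continuous_intros D_cont_x) auto
    fix x assume x: "0 < x" "x < 2 * pi"
    have "eventually (\<lambda>n. \<delta> n < min x (2 * pi - x)) sequentially" using x by (intro eventually_\<delta>) simp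
    then have "eventually (\<lambda>n. \<bar>U n (m - 2) x t - U n (m - 2) x s\<bar> \<le> M * \<bar>t - s\<bar>) sequentially"
    proof eventually_elim
      case (elim n)
      have "\<bar>U n (m - 2) x t - U n (m - 2) x s\<bar> \<le> M * (t - s)"
      proof (rule mvt_bound[where f' = "\<lambda>z. U n m x z"])
        show "continuous_on {s..t} (U n (m - 2) x)" by (rule continuous_on_subset[OF U_cont_t]) (use t in auto)
        show "(U n (m - 2) x has_real_derivative U n m x z) (at z)" if "s < z" "z < t" for z
          using U_deriv_t[of z n x "m - 2"] that t elim m by (simp add: numeral_2_eq_2 Suc_diff_Suc)
        show "\<bar>U n m x z\<bar> \<le> M" if "s < z" "z < t" for z using that t elim by (intro U_bound) auto
      qed (use t in simp)
      then show ?case using t by simp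
    qed
    moreover have "(\<lambda>n. \<bar>U n (m - 2) x t - U n (m - 2) x s\<bar>) \<longlonglongrightarrow> \<bar>D (m - 2) x t - D (m - 2) x s\<bar>"
      by (intro tendsto_intros U_tendsto) (use x t in auto)
    ultimately show "\<bar>D (m - 2) x t - D (m - 2) x s\<bar> \<le> M * \<bar>t - s\<bar>"
      by (intro tendsto_upperbound) auto
  qed
  show ?thesis using *[of s t] *[of t s] t by (cases "s \<le> t") (auto simp: abs_minus_commute)
qed

text \<open>Interpolation between the Lipschitz bound in time for order m - 2 and the Lipschitz
  bound in space for order m - 1. The step h = sqrt |t - s| balances the two terms at 2 M h each; if
  it does not fit into \<open>Omega\<close>, the trivial bound 2 M is already sufficient.\<close>

lemma D_Hoelder_t:
  assumes x: "x \<in> Omega" and t: "s \<in> {0..T}" "t \<in> {0..T}"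
  shows "\<bar>D (m - 1) x t - D (m - 1) x s\<bar> \<le> 4 * M * sqrt \<bar>t - s\<bar>"
proof (cases "s = t \<or> sqrt \<bar>t - s\<bar> > pi")
  case True
  then show ?thesis
  proof
    assume "sqrt \<bar>t - s\<bar> > pi"
    then have "1 \<le> 2 * sqrt \<bar>t - s\<bar>" using pi_ge_two by linarith
    then have "2 * M * 1 \<le> 2 * M * (2 * sqrt \<bar>t - s\<bar>)" using M_nonneg by (intro mult_left_mono) auto
    moreover have "\<bar>D (m - 1) x t - D (m - 1) x s\<bar> \<le> 2 * M"
      using D_bound[of "m - 1" x t] D_bound[of "m - 1" x s] x t by simp
    ultimately show ?thesis by simp
  qed simp
next
  case False
  define h where "h = sqrt \<bar>t - s\<bar>"
  have h: "0 < h" "h \<le> pi" "h * h = \<bar>t - s\<bar>" using False by (auto simp: h_def)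
  have m': "m - 1 = Suc (m - 2)" using m by simp
  have "\<bar>D (m - 1) x t - D (m - 1) x s\<bar> \<le> 2 * (M * \<bar>t - s\<bar>) / h + 2 * M * h"
  proof (rule derivative_interpolation[where lo = 0 and hi = "2 * pi"
        and f = "\<lambda>x. D (m - 2) x t - D (m - 2) x s" and f' = "\<lambda>x. D (m - 1) x t - D (m - 1) x s"])
    show "((\<lambda>x. D (m - 2) x t - D (m - 2) x s) has_real_derivative D (m - 1) y t - D (m - 1) y s) (at y within {0..2 * pi})"
      if "y \<in> {0..2 * pi}" for y
      using that t m unfolding m' Omega_def[symmetric] by (intro DERIV_diff D_deriv) auto
    show "\<bar>D (m - 2) y t - D (m - 2) y s\<bar> \<le> M * \<bar>t - s\<bar>" if "y \<in> {0..2 * pi}" for y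
      using that t by (intro D_Lipschitz_t) (auto simp: Omega_def)
    fix y z assume yz: "y \<in> {0..2 * pi}" "z \<in> {0..2 * pi}"
    have "\<bar>D (m - 1) y t - D (m - 1) z t\<bar> \<le> M * \<bar>y - z\<bar>" "\<bar>D (m - 1) y s - D (m - 1) z s\<bar> \<le> M * \<bar>y - z\<bar>"
      using yz t by (auto intro!: D_Lipschitz simp: Omega_def)
    then show "\<bar>D (m - 1) y t - D (m - 1) y s - (D (m - 1) z t - D (m - 1) z s)\<bar> \<le> 2 * M * \<bar>y - z\<bar>"
      by linarith
  qed (use h x M_nonneg in \<open>auto simp: Omega_def\<close>)
  also have "2 * (M * \<bar>t - s\<bar>) / h = 2 * M * h" using h by (simp flip: h(3))
  finally show ?thesis by (simp add: h_def)
qed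

section \<open>Estimates away from the parabolic boundary\<close>

lemma U_interior_gradient:
  assumes \<rho>: "\<rho> > 0" "\<delta> n < x - \<rho>" "x + \<rho> < 2 * pi - \<delta> n" and t: "\<rho>\<^sup>2 \<le> t" "t < T"
    and B: "\<And>y s. \<bar>y - x\<bar> \<le> \<rho> \<Longrightarrow> t - \<rho>\<^sup>2 \<le> s \<Longrightarrow> s \<le> t \<Longrightarrow> \<bar>U n i y s\<bar> \<le> B"
  shows "\<bar>U n (Suc i) x t\<bar> \<le> 4 * B / \<rho>"
proof (rule heat_interior_gradient[where w = "U n i" and ?w1.0 = "U n (Suc i)" and ?w2.0 = "U n (Suc (Suc i))"
      and ?w3.0 = "U n (Suc (Suc (Suc i)))" and ?x0.0 = x and ?t0.0 = t and r = \<rho> and M = B])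
  show "continuous_on ({x - \<rho>..x + \<rho>} \<times> {t - \<rho>\<^sup>2..t}) (\<lambda>(x, t). U n i x t)"
    "continuous_on ({x - \<rho>..x + \<rho>} \<times> {t - \<rho>\<^sup>2..t}) (\<lambda>(x, t). U n (Suc i) x t)"
    using t by (intro U_cont_on, force)+
  fix y s assume y: "\<bar>y - x\<bar> < \<rho>" and s: "t - \<rho>\<^sup>2 < s" "s \<le> t"
  have s': "s \<in> {0..T}" "0 < s" "s < T" and y': "\<delta> n < y" "y < 2 * pi - \<delta> n"
    using s t y \<rho> by auto
  show "((\<lambda>x. U n i x s) has_real_derivative U n (Suc i) y s) (at y)"
    "((\<lambda>x. U n (Suc i) x s) has_real_derivative U n (Suc (Suc i)) y s) (at y)"
    "((\<lambda>x. U n (Suc (Suc i)) x s) has_real_derivative U n (Suc (Suc (Suc i))) y s) (at y)"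
    by (rule U_deriv[OF s'(1)])+
  show "(U n i y has_real_derivative U n (Suc (Suc i)) y s) (at s)"
    "(U n (Suc i) y has_real_derivative U n (Suc (Suc (Suc i))) y s) (at s)"
    by (rule U_deriv_t[OF s'(2,3) y'])+
next
  fix y s assume "y \<in> {x - \<rho>..x + \<rho>}" "s \<in> {t - \<rho>\<^sup>2..t}"
  then show "\<bar>U n i y s\<bar> \<le> B" by (intro B) (auto simp: abs_le_iff)
qed (rule \<rho>)

text \<open>Bernstein's estimate on a cylinder of radius r/4 gives 4 M / (r/4). The margin r/2 + r/4
  leaves r/2 for the mollifier; \<open>U_interior_2\<close> applies the estimate once more on a
  second cylinder of radius r/4, starting at distance r.\<close>

lemma U_interior_1:
  assumes r: "r > 0" and n: "\<delta> n < r / 2" and x: "r / 2 + r / 4 \<le> x" "x \<le> 2 * pi - (r / 2 + r / 4)"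
    and t: "(r / 4)\<^sup>2 \<le> t" "t < T"
  shows "\<bar>U n (Suc m) x t\<bar> \<le> 16 * M / r"
proof -
  have "\<bar>U n (Suc m) x t\<bar> \<le> 4 * M / (r / 4)"
  proof (rule U_interior_gradient)
    fix y s assume y: "\<bar>y - x\<bar> \<le> r / 4" and s: "t - (r / 4)\<^sup>2 \<le> s" "s \<le> t"
    have "x - r / 4 \<le> y" "y \<le> x + r / 4" using y by linarith+
    then show "\<bar>U n m y s\<bar> \<le> M" using s t n x r by (intro U_bound) auto
  qed (use r n x t in auto)
  then show ?thesis by simp
qed

lemma U_interior_2:
  assumes r: "r > 0" and n: "\<delta> n < r / 2" and x: "r \<le> x" "x \<le> 2 * pi - r" and t: "r\<^sup>2 \<le> t" "t < T"
  shows "\<bar>U n (Suc (Suc m)) x t\<bar> \<le> 256 * M / r\<^sup>2"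
proof -
  have "\<bar>U n (Suc (Suc m)) x t\<bar> \<le> 4 * (16 * M / r) / (r / 4)"
  proof (rule U_interior_gradient)
    have "(r / 4)\<^sup>2 + (r / 4)\<^sup>2 \<le> r\<^sup>2" by (simp add: power2_eq_square)
    then show "\<bar>U n (Suc m) y s\<bar> \<le> 16 * M / r" if "\<bar>y - x\<bar> \<le> r / 4" "t - (r / 4)\<^sup>2 \<le> s" "s \<le> t" for y s
    proof -
      have "x - r / 4 \<le> y" "y \<le> x + r / 4" using that(1) by linarith+
      then show ?thesis using that(2,3) \<open>(r / 4)\<^sup>2 + (r / 4)\<^sup>2 \<le> r\<^sup>2\<close> x t by (intro U_interior_1[OF r n]) auto
    qed
    show "(r / 4)\<^sup>2 \<le> t" using \<open>(r / 4)\<^sup>2 + (r / 4)\<^sup>2 \<le> r\<^sup>2\<close> t zero_le_power2[of "r / 4"] by linarith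
  qed (use r n x t in auto)
  then show ?thesis by (simp add: power2_eq_square field_simps)
qed

lemma D_interior_t:
  assumes r: "r > 0" and x: "r \<le> x" "x \<le> 2 * pi - r" and t: "r\<^sup>2 \<le> s" "s \<le> t" "t \<le> T"
  shows "\<bar>D (m - 1) x t - D (m - 1) x s\<bar> \<le> 16 * M / r * (t - s)"
proof -
  have t0: "0 \<le> s" using t zero_le_power2[of r] by linarith
  have "eventually (\<lambda>n. \<delta> n < r / 2) sequentially" using r by (intro eventually_\<delta>) simp
  then have "eventually (\<lambda>n. \<bar>U n (m - 1) x t - U n (m - 1) x s\<bar> \<le> 16 * M / r * (t - s)) sequentially"
  proof eventually_elim
    case (elim n)
    show ?case
    proof (rule mvt_bound[where f' = "\<lambda>z. U n (Suc m) x z"])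
      show "continuous_on {s..t} (U n (m - 1) x)" by (rule continuous_on_subset[OF U_cont_t]) (use t t0 in auto)
      fix z assume z: "s < z" "z < t"
      show "(U n (m - 1) x has_real_derivative U n (Suc m) x z) (at z)"
        using U_deriv_t[of z n x "m - 1"] z t t0 elim m x r by simp
      have "(r / 4)\<^sup>2 \<le> r\<^sup>2" by (simp add: power2_eq_square)
      then have "(r / 4)\<^sup>2 \<le> z" using z t by linarith
      then show "\<bar>U n (Suc m) x z\<bar> \<le> 16 * M / r" using z t x r elim by (intro U_interior_1) auto
    qed (use t in simp)
  qed
  moreover have "(\<lambda>n. \<bar>U n (m - 1) x t - U n (m - 1) x s\<bar>) \<longlonglongrightarrow> \<bar>D (m - 1) x t - D (m - 1) x s\<bar>"
    by (intro tendsto_intros U_tendsto) (use x t t0 r in auto)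
  ultimately show ?thesis by (intro tendsto_upperbound) auto
qed

text \<open>A mixed second difference: the difference in x raises the order from m - 1 to m and the
  one in time to m + 2, which \<open>U_interior_2\<close> bounds.\<close>

lemma D_interior_tx:
  assumes r: "r > 0" and x: "r \<le> x" "x \<le> y" "y \<le> 2 * pi - r" and t: "r\<^sup>2 \<le> s" "s \<le> t" "t \<le> T"
  shows "\<bar>(D (m - 1) y t - D (m - 1) y s) - (D (m - 1) x t - D (m - 1) x s)\<bar> \<le> 256 * M / r\<^sup>2 * (t - s) * (y - x)"
proof -
  have t0: "0 \<le> s" using t zero_le_power2[of r] by linarith
  have "eventually (\<lambda>n. \<delta> n < r / 2) sequentially" using r by (intro eventually_\<delta>) simp
  then have "eventually (\<lambda>n. \<bar>(U n (m - 1) y t - U n (m - 1) y s) - (U n (m - 1) x t - U n (m - 1) x s)\<bar>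
      \<le> 256 * M / r\<^sup>2 * (t - s) * (y - x)) sequentially"
  proof eventually_elim
    case (elim n)
    have d: "((\<lambda>x. U n (m - 1) x t - U n (m - 1) x s) has_real_derivative U n m z t - U n m z s) (at z within S)" for z S
      using U_deriv[of t n "m - 1" z] U_deriv[of s n "m - 1" z] t t0 m
      by (intro DERIV_diff) (auto intro: has_field_derivative_at_within)
    show ?case
    proof (rule mvt_bound[where f' = "\<lambda>z. U n m z t - U n m z s"])
      show "continuous_on {x..y} (\<lambda>x. U n (m - 1) x t - U n (m - 1) x s)" by (rule DERIV_continuous_on[OF d])
      fix z assume z: "x < z" "z < y"
      show "((\<lambda>x. U n (m - 1) x t - U n (m - 1) x s) has_real_derivative U n m z t - U n m z s) (at z)" by (rule d)
      show "\<bar>U n m z t - U n m z s\<bar> \<le> 256 * M / r\<^sup>2 * (t - s)"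
      proof (rule mvt_bound[where f' = "\<lambda>q. U n (Suc (Suc m)) z q"])
        show "continuous_on {s..t} (U n m z)" by (rule continuous_on_subset[OF U_cont_t]) (use t t0 in auto)
        fix q assume q: "s < q" "q < t"
        show "(U n m z has_real_derivative U n (Suc (Suc m)) z q) (at q)"
          using U_deriv_t[of q n z m] q t t0 elim x r z by simp
        show "\<bar>U n (Suc (Suc m)) z q\<bar> \<le> 256 * M / r\<^sup>2" using z x t q r elim by (intro U_interior_2) auto
      qed (use t in simp)
    qed (use x in simp)
  qed
  moreover have "(\<lambda>n. \<bar>(U n (m - 1) y t - U n (m - 1) y s) - (U n (m - 1) x t - U n (m - 1) x s)\<bar>)
      \<longlonglongrightarrow> \<bar>(D (m - 1) y t - D (m - 1) y s) - (D (m - 1) x t - D (m - 1) x s)\<bar>"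
    by (intro tendsto_intros U_tendsto) (use x t t0 r in auto)
  ultimately show ?thesis by (intro tendsto_upperbound) auto
qed

end

text \<open>A missing weak derivative makes the norm infinite, so finiteness provides all of them.
  The witness is the very \<open>SOME\<close> occurring in the norm, so that its essential supremum
  is one of the maximised values.\<close>

lemma Winf_norm_imp_weak:
  assumes "Winf_norm_unif T m u < \<infinity>" "t \<in> {0..T}" "i \<le> m"
  shows "\<exists>g. weak_deriv i (\<lambda>x. u x t) g \<and>
    (AE x in lebesgue_on Omega. \<bar>g x\<bar> \<le> real_of_ereal (Winf_norm_unif T m u))"
proof -
  let ?W = "Winf_norm_unif T m u"
  have le: "Winf_norm m (\<lambda>x. u x t) \<le> ?W"
    unfolding Winf_norm_unif_def using assms(2) by (intro SUP_upper)
  then have ex: "\<forall>i\<le>m. \<exists>g. weak_deriv i (\<lambda>x. u x t) g"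
    using assms(1) unfolding Winf_norm_def by (auto split: if_splits)
  define g where "g = (SOME g. weak_deriv i (\<lambda>x. u x t) g)"
  have g: "weak_deriv i (\<lambda>x. u x t) g" unfolding g_def
    by (rule someI_ex[of "weak_deriv i (\<lambda>x. u x t)"]) (rule ex[rule_format, OF assms(3)])
  have "Linf_norm g \<le> Winf_norm m (\<lambda>x. u x t)"
  proof -
    define F where "F = (\<lambda>i. Linf_norm (SOME g. weak_deriv i (\<lambda>x. u x t) g))"
    have "Winf_norm m (\<lambda>x. u x t) = Max (F ` {..m})"
      unfolding Winf_norm_def F_def by (rule if_P) (rule ex)
    moreover have "F i \<le> Max (F ` {..m})" using assms(3) by (intro Max_ge) auto
    moreover have "F i = Linf_norm g" by (simp only: F_def g_def)
    ultimately show ?thesis by simp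
  qed
  then have "Linf_norm g \<le> ?W" using le by simp
  then have ae: "AE x in lebesgue_on Omega. ereal \<bar>g x\<bar> \<le> ?W"
    using esssup_AE[of "\<lambda>x. ereal \<bar>g x\<bar>" "lebesgue_on Omega"] unfolding Linf_norm_def
    by (auto elim!: eventually_mono intro: order_trans)
  have "\<bar>g x\<bar> \<le> real_of_ereal ?W" if "ereal \<bar>g x\<bar> \<le> ?W" for x
    using that assms(1) by (cases ?W) auto
  then show ?thesis using g ae by (intro exI[of _ g]) (auto elim!: eventually_mono)
qed

section \<open>The error equations\<close>

text \<open>Merges unbarred and barred corrections into one sum over the powers of the half cell
  size.\<close>

lemma sum_odd_even:
  fixes f :: "nat \<Rightarrow> real"
  shows "(\<Sum>i=1..(l + 1) div 2. f (2 * i - 1)) + (\<Sum>i=1..l div 2. f (2 * i)) = (\<Sum>n=1..l. f n)"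
proof (induction l)
  case (Suc l)
  show ?case
  proof (cases "even l")
    case True
    then obtain r where r: "l = 2 * r" by (elim evenE)
    then have e: "(Suc l + 1) div 2 = Suc r" "(l + 1) div 2 = r" "Suc l div 2 = r" "l div 2 = r" by auto
    show ?thesis using Suc.IH unfolding e by (simp add: r)
  next
    case False
    then obtain r where r: "l = 2 * r + 1" by (elim oddE)
    then have e: "(Suc l + 1) div 2 = Suc r" "(l + 1) div 2 = Suc r" "Suc l div 2 = Suc r" "l div 2 = r" by auto
    have "2 * Suc r = Suc l" using r by simp
    then show ?thesis using Suc.IH unfolding e by (simp add: r)
  qed
qed simp

lemma mesh_mono:
  assumes "mesh N xs" "i \<le> j" "j \<le> N"
  shows "xs i \<le> xs j"
  using assms(2,3)
proof (induction j rule: dec_induct)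
  case (step j)
  then show ?case using assms(1) unfolding mesh_def by (meson Suc_le_lessD less_imp_le order.trans less_le)
qed simp

lemma refint_legendre_sum_cint:
  assumes c: "mesh_cell xs j" and f: "continuous_on {xs j..xs (Suc j)} f" and w: "degree w \<le> k"
  shows "refint (legendre_sum k (\<lambda>r. cint xs j f (legendre_poly r)) * w) = cint xs j f w"
proof -
  have e: "w = (\<Sum>r\<le>k. smult ((2 * real r + 1) / 2 * refint (w * legendre_poly r)) (legendre_poly r))"
    using legendre_expansion[OF w] by (simp add: legendre_sum_def)
  show ?thesis
    by (subst (1 2) e) (auto simp: mesh_cell.cint_sum_right[OF c f] sum_distrib_left refint_sum refint_smult
        refint_legendre_sum intro!: sum.cong)
qed

text \<open>The numerical flux of an error: it wraps around in the periodic case and is 0 where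
  boundary data are prescribed, since exact and discrete solution share them.\<close>

fun hat :: "nat \<Rightarrow> bool \<Rightarrow> real \<Rightarrow> (nat \<Rightarrow> real poly) \<Rightarrow> nat \<Rightarrow> real" where
  "hat N per s E i =
     (if s = 1 then (if i = 0 then (if per then poly (E (N - 1)) 1 else 0) else poly (E (i - 1)) 1)
      else (if i = N then (if per then poly (E 0) (-1) else 0) else poly (E i) (-1)))"

definition dgform :: "nat \<Rightarrow> bool \<Rightarrow> real \<Rightarrow> (nat \<Rightarrow> real poly) \<Rightarrow> nat \<Rightarrow> real poly \<Rightarrow> real" where
  "dgform N per s E j w = - refint (E j * pderiv w) + hat N per s E (Suc j) * poly w 1 - hat N per s E j * poly w (-1)"

text \<open>Discrete integration by parts: with opposite one-sided fluxes for the two arguments, the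
  cell contributions telescope in \<phi>. Its values at both ends agree, by periodicity or because
  each contains a factor 0.\<close>

lemma dgform_adjoint_aux:
  assumes "N > 0"
  shows "(\<Sum>j<N. dgform N per 1 V j (Q j)) = - (\<Sum>j<N. dgform N per (-1) Q j (V j))"
proof -
  define \<phi> where "\<phi> j = hat N per (-1) Q j * hat N per 1 V j" for j
  have "dgform N per 1 V j (Q j) + dgform N per (-1) Q j (V j) = \<phi> (Suc j) - \<phi> j" if j: "j < N" for j
  proof -
    have "refint (V j * pderiv (Q j)) + refint (Q j * pderiv (V j)) = poly (V j) 1 * poly (Q j) 1 - poly (V j) (-1) * poly (Q j) (-1)"
      using refint_by_parts[of "V j" "Q j"] by (simp add: mult.commute)
    then show ?thesis using j by (simp add: dgform_def \<phi>_def algebra_simps)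
  qed
  then have "(\<Sum>j<N. dgform N per 1 V j (Q j)) + (\<Sum>j<N. dgform N per (-1) Q j (V j)) = (\<Sum>j<N. \<phi> (Suc j) - \<phi> j)"
    unfolding sum.distrib[symmetric] by (intro sum.cong) auto
  also have "\<dots> = \<phi> N - \<phi> 0" by (rule sum_lessThan_telescope)
  also have "\<dots> = 0" using assms by (simp add: \<phi>_def)
  finally show ?thesis by simp
qed

lemma dgform_adjoint:
  assumes "N > 0" "s = 1 \<or> s = -1"
  shows "(\<Sum>j<N. dgform N per s V j (Q j)) = - (\<Sum>j<N. dgform N per (-s) Q j (V j))"
  using dgform_adjoint_aux[OF assms(1), of per V Q] dgform_adjoint_aux[OF assms(1), of per Q V] assms(2) by auto

lemma dgform_0 [simp]: "dgform N per s E j 0 = 0"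
  by (simp add: dgform_def)

lemma dgform_sum_right:
  "dgform N per s E j (\<Sum>i\<in>A. smult (c i) (w i)) = (\<Sum>i\<in>A. c i * dgform N per s E j (w i))"
  unfolding dgform_def
  by (simp add: pderiv_sum pderiv_smult sum_distrib_left refint_sum refint_smult poly_sum sum.distrib
      sum_subtractf sum_negf algebra_simps)

lemma dgform_sum_left:
  assumes "finite A"
  shows "dgform N per s (\<lambda>j. \<Sum>i\<in>A. smult (c i) (E i j)) j w = (\<Sum>i\<in>A. c i * dgform N per s (E i) j w)"
proof -
  have h: "hat N per s (\<lambda>j. \<Sum>i\<in>A. smult (c i) (E i j)) n = (\<Sum>i\<in>A. c i * hat N per s (E i) n)" for n
    by (simp add: poly_sum)
  show ?thesis unfolding dgform_def h
    by (simp add: sum_distrib_right refint_sum refint_smult sum.distrib sum_subtractf sum_negf algebra_simps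
        sum_distrib_left del: hat.simps)
qed

lemma dgform_cong:
  assumes "\<And>i. i < N \<Longrightarrow> E i = E' i" "j < N"
  shows "dgform N per s E j w = dgform N per s E' j w"
  using assms by (auto simp: dgform_def)

subsection \<open>Lagrange interpolation\<close>

text \<open>k + 1 distinct points in [0, 1), hence in the open reference cell, where the discrete
  solution is known to be differentiable in time.\<close>

definition lag_pt :: "nat \<Rightarrow> nat \<Rightarrow> real" where
  "lag_pt k r = real r / real (Suc k)"

definition lagrange :: "nat \<Rightarrow> nat \<Rightarrow> real poly" where
  "lagrange k r = (\<Prod>q\<in>{..k} - {r}. smult (1 / (lag_pt k r - lag_pt k q)) [:- lag_pt k q, 1:])"

lemma poly_lagrange: "r \<le> k \<Longrightarrow> q \<le> k \<Longrightarrow> poly (lagrange k r) (lag_pt k q) = (if q = r then 1 else 0)"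
  unfolding lagrange_def poly_prod
  by (auto simp: lag_pt_def divide_simps intro!: prod.neutral)

lemma degree_lagrange: "r \<le> k \<Longrightarrow> degree (lagrange k r) \<le> k"
  unfolding lagrange_def
  by (rule order_trans[OF degree_prod_sum_le], simp,
      rule order_trans[OF sum_mono[where g = "\<lambda>_. 1"]])
    (auto intro: order_trans[OF degree_smult_le])

lemma lagrange_interpolation:
  assumes "degree p \<le> k"
  shows "p = (\<Sum>r\<le>k. smult (poly p (lag_pt k r)) (lagrange k r))"
proof (rule poly_eqI_degree)
  have inj: "inj_on (lag_pt k) {..k}" by (auto simp: inj_on_def lag_pt_def)
  show "degree p < card (lag_pt k ` {..k})" using assms by (simp add: card_image[OF inj])
  have "degree (\<Sum>r\<le>k. smult (poly p (lag_pt k r)) (lagrange k r)) \<le> k"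
    by (intro degree_sum_le) (auto intro!: order_trans[OF degree_smult_le] degree_lagrange)
  then show "degree (\<Sum>r\<le>k. smult (poly p (lag_pt k r)) (lagrange k r)) < card (lag_pt k ` {..k})"
    by (simp add: card_image[OF inj])
  fix x assume "x \<in> lag_pt k ` {..k}"
  then obtain q where q: "x = lag_pt k q" "q \<le> k" by auto
  have "poly (\<Sum>r\<le>k. smult (poly p (lag_pt k r)) (lagrange k r)) x = (\<Sum>r\<le>k. if r = q then poly p x else 0)"
    unfolding poly_sum by (intro sum.cong) (auto simp: q poly_lagrange)
  then show "poly p x = poly (\<Sum>r\<le>k. smult (poly p (lag_pt k r)) (lagrange k r)) x" using q by simp
qed

definition flux_sign :: "flux \<Rightarrow> real" where
  "flux_sign fl = (case fl of Flux_I \<Rightarrow> 1 | Flux_II \<Rightarrow> -1)"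

lemma flux_sign_cases: "flux_sign fl = 1 \<or> flux_sign fl = -1"
  by (cases fl) (auto simp: flux_sign_def)

locale ldg_error = bounded_heat T "k + l + 2" M u0 u
  for T M :: real and u0 :: "real \<Rightarrow> real" and u :: "real \<Rightarrow> real \<Rightarrow> real" and k l :: nat +
  fixes N :: nat and xs :: "nat \<Rightarrow> real" and fl :: flux and b :: bc and uh qh :: "real \<Rightarrow> real \<Rightarrow> real"
  assumes l1: "1 \<le> l" and lk: "l \<le> k" and mesh: "mesh N xs" and bc: "boundary_condition fl b T u"
    and ldg: "ldg_solution k N xs fl b T uh qh"
    and init: "\<And>j x. j < N \<Longrightarrow> x \<in> cell xs j \<Longrightarrow> uh x 0 = u_interp fl k l N xs T u x 0"
begin

abbreviation s :: real where "s \<equiv> flux_sign fl"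
abbreviation per :: bool where "per \<equiv> b = Periodic"

lemma k1: "1 \<le> k" using l1 lk by simp
lemma N0: "0 < N" using mesh by (simp add: mesh_def)

lemma s_cases: "s = 1 \<or> s = -1" by (rule flux_sign_cases)

text \<open>The end point at which the derivative of order n is interpolated. Derivatives of even
  order behave like u and odd ones like q, whose flux comes from the other side.\<close>

definition sg :: "nat \<Rightarrow> real" where "sg n = s * (-1) ^ n"

lemma sg_cases: "sg n = 1 \<or> sg n = -1"
  using s_cases by (cases "even n") (auto simp: sg_def)

lemma sg_simps [simp]: "sg 0 = s" "sg (Suc n) = - sg n"
  by (simp_all add: sg_def)

lemma mc: "j < N \<Longrightarrow> mesh_cell xs j"
  using mesh by (auto simp: mesh_def mesh_cell_def)

lemma hb_pos: "j < N \<Longrightarrow> half_size xs j > 0"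
  by (rule mesh_cell.hb_pos[OF mc])

lemma cell_Omega: "j < N \<Longrightarrow> {xs j..xs (Suc j)} \<subseteq> Omega"
  using mesh_mono[OF mesh, of 0 j] mesh_mono[OF mesh, of "Suc j" N] mesh by (auto simp: Omega_def mesh_def)

lemma cell_end_Omega: "j < N \<Longrightarrow> cell_end xs j r \<in> Omega"
  using cell_Omega mesh_cell.cell_end_mem[OF mc] by blast

lemma D_cont_cell: "j < N \<Longrightarrow> n \<le> k + l + 1 \<Longrightarrow> t \<in> {0..T} \<Longrightarrow> continuous_on {xs j..xs (Suc j)} (\<lambda>x. D n x t)"
  using D_cont_x[of n t] cell_Omega[of j] by (auto intro: continuous_on_subset)

text \<open>Since a time derivative raises the order by two, all \<open>G_coeff\<close> and
  \<open>Q_coeff\<close> are members of this single sequence: even n for u and odd n for q.\<close>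

definition cf :: "nat \<Rightarrow> nat \<Rightarrow> real \<Rightarrow> real" where
  "cf n j t = kap (sg n) k xs j (\<lambda>x. D n x t)"

lemma cint_deriv:
  assumes j: "j < N" and n: "n + 2 \<le> k + l + 1" and t: "t \<in> {0..T}"
  shows "((\<lambda>t. cint xs j (\<lambda>x. D n x t) w) has_real_derivative cint xs j (\<lambda>x. D (n + 2) x t) w) (at t within {0..T})"
proof -
  have "((\<lambda>t. integral (cbox (xs j) (xs (Suc j))) (\<lambda>x. D n x t * poly w (cellmap xs j x))) has_field_derivative
      integral (cbox (xs j) (xs (Suc j))) (\<lambda>x. D (n + 2) x t * poly w (cellmap xs j x))) (at t within {0..T})"
  proof (rule leibniz_rule_field_derivative)
    show "((\<lambda>t. D n x t * poly w (cellmap xs j x)) has_real_derivative D (n + 2) x t * poly w (cellmap xs j x))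
        (at t within {0..T})" if "t \<in> {0..T}" "x \<in> cbox (xs j) (xs (Suc j))" for t x
      using D_deriv_t[of n x t] n that cell_Omega[OF j] by (intro DERIV_cmult_right) (auto simp: numeral_2_eq_2)
    show "(\<lambda>x. D n x t * poly w (cellmap xs j x)) integrable_on cbox (xs j) (xs (Suc j))" if "t \<in> {0..T}" for t
      using mesh_cell.integrable_times_poly[OF mc[OF j] D_cont_cell[OF j _ that]] n by simp
    have "continuous_on ({0..T} \<times> cbox (xs j) (xs (Suc j))) (\<lambda>q. D (n + 2) (snd q) (fst q))"
      using continuous_on_compose2[OF D_cont[of "n + 2"], of "{0..T} \<times> cbox (xs j) (xs (Suc j))" "\<lambda>q. (snd q, fst q)"]
        n cell_Omega[OF j] by (force intro: continuous_intros)
    moreover have "continuous_on ({0..T} \<times> cbox (xs j) (xs (Suc j))) (\<lambda>q. poly w (cellmap xs j (snd q)))"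
      by (rule continuous_on_compose2[where f = snd, OF mesh_cell.continuous_on_poly_\<xi>[OF mc[OF j], of UNIV]])
        (auto intro: continuous_intros)
    ultimately show "continuous_on ({0..T} \<times> cbox (xs j) (xs (Suc j))) (\<lambda>(t, x). D (n + 2) x t * poly w (cellmap xs j x))"
      unfolding case_prod_beta by (rule continuous_on_mult)
  qed (use t in auto)
  then show ?thesis unfolding cint_def integral_cell
    using DERIV_cdivide by fastforce
qed

lemma cf_deriv:
  assumes j: "j < N" and n: "n + 2 \<le> k + l + 1" and t: "t \<in> {0..T}"
  shows "(cf n j has_real_derivative cf (n + 2) j t) (at t within {0..T})"
proof -
  have d: "((\<lambda>t. D n (cell_end xs j (sg n)) t) has_real_derivative D (n + 2) (cell_end xs j (sg n)) t) (at t within {0..T})"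
    using D_deriv_t[of n _ t] n t cell_end_Omega[OF j] by (simp add: numeral_2_eq_2)
  have sg2: "sg (n + 2) = sg n" by (simp add: sg_def)
  show ?thesis
    unfolding cf_def[abs_def] kap_def radau_coeff_def sg2
    by (intro DERIV_cmult DERIV_diff DERIV_sum DERIV_cmult_right cint_deriv[OF j n t] d)
qed

lemma dt_eq:
  assumes "t \<in> {0..T}" "\<And>r. r \<in> {0..T} \<Longrightarrow> f r = g r" "(g has_real_derivative d) (at t within {0..T})"
  shows "dt T f t = d"
proof -
  have "(f has_vector_derivative d) (at t within {0..T})"
    using has_vector_derivative_transform[of t "{0..T}" f g d] assms
    by (simp add: has_real_derivative_iff_has_vector_derivative)
  then show ?thesis using assms(1) T unfolding dt_def
    by (intro vector_derivative_within_closed_interval) auto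
qed

lemma dt_cf:
  assumes j: "j < N" and f: "\<And>t. t \<in> {0..T} \<Longrightarrow> f t = cf n j t"
  shows "n + 2 * i \<le> k + l + 1 \<Longrightarrow> t \<in> {0..T} \<Longrightarrow> (dt T ^^ i) f t = cf (n + 2 * i) j t"
proof (induction i arbitrary: t)
  case (Suc i)
  have "dt T ((dt T ^^ i) f) t = cf (n + 2 * i + 2) j t"
    by (rule dt_eq[OF Suc.prems(2) _ cf_deriv[OF j]]) (use Suc in auto)
  then show ?case by simp
qed (simp add: f)

lemma coeff_eq:
  assumes j: "j < N" and v: "\<And>x. x \<in> Omega \<Longrightarrow> v x = D n x t" and n: "n \<le> k + l + 1" "t \<in> {0..T}"
  shows "(if sg n = 1 then coeff_bar else coeff_tilde) k xs j v = cf n j t"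
proof -
  have "\<forall>x\<in>cell xs j. v x = D n x t"
    using cell_Omega[OF j] mesh_cell.cell_subset[OF mc[OF j]] v by force
  then show ?thesis
    using mesh_cell.coeff_bar_eq[OF mc[OF j] _ D_cont_cell[OF j n], of v k]
      mesh_cell.coeff_tilde_eq[OF mc[OF j] _ D_cont_cell[OF j n], of v k] sg_cases[of n]
    by (auto simp: cf_def)
qed

lemma G_coeff_eq:
  assumes j: "j < N" and i: "2 * i \<le> k + l + 1" and t: "t \<in> {0..T}"
  shows "G_coeff fl k xs T u j i t = cf (2 * i) j t"
proof -
  have "G_coeff fl k xs T u j i t
      = (dt T ^^ i) (\<lambda>t. (if s = 1 then coeff_bar else coeff_tilde) k xs j (\<lambda>x. u x t)) t"
    by (cases fl) (simp_all add: flux_sign_def)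
  also have "\<dots> = cf (0 + 2 * i) j t"
    by (rule dt_cf[OF j]) (use coeff_eq[OF j, of "\<lambda>x. u x _" 0] i t in \<open>auto simp: D_0\<close>)
  finally show ?thesis by simp
qed

lemma Q_coeff_eq:
  assumes j: "j < N" and i: "2 * i + 1 \<le> k + l + 1" and t: "t \<in> {0..T}"
  shows "Q_coeff fl k xs T (dx u) j i t = cf (2 * i + 1) j t"
proof -
  have "Q_coeff fl k xs T (dx u) j i t
      = (dt T ^^ i) (\<lambda>t. (if - s = 1 then coeff_bar else coeff_tilde) k xs j (\<lambda>x. dx u x t)) t"
    by (cases fl) (simp_all add: flux_sign_def)
  also have "\<dots> = cf (1 + 2 * i) j t"
    by (rule dt_cf[OF j]) (use coeff_eq[OF j, of "\<lambda>x. dx u x _" 1] i t in \<open>auto simp: dx_u\<close>)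
  finally show ?thesis by simp
qed

text \<open>The interpolant of the derivative of order p: p = 0 is \<open>u_interp\<close>, p = 1 is
  \<open>q_interp\<close>, and p = 2 is the time derivative of the former. The summand n = 0 turns
  the L^2 projection into the Gauss--Radau projection, so projection and corrections form one
  sum.\<close>

definition P :: "nat \<Rightarrow> nat \<Rightarrow> real \<Rightarrow> real poly" where
  "P p j t = legendre_sum k (\<lambda>r. cint xs j (\<lambda>x. D p x t) (legendre_poly r))
     - (\<Sum>n\<le>l. smult (half_size xs j ^ n * cf (p + n) j t) (corr (sg p) k n))"

lemma degree_P: "degree (P p j t) \<le> k"
  unfolding P_def
  by (intro degree_diff_le degree_legendre_sum degree_sum_le order_trans[OF degree_smult_le] degree_corr) auto

lemma P_radau:
  "P p j t = mesh_cell.radau xs j (sg p) k (\<lambda>x. D p x t)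
     - (\<Sum>n=1..l. smult (half_size xs j ^ n * cf (p + n) j t) (corr (sg p) k n))" if "j < N"
proof -
  have "(\<Sum>n\<le>l. smult (half_size xs j ^ n * cf (p + n) j t) (corr (sg p) k n))
      = smult (cf p j t) (legendre_poly k) + (\<Sum>n=1..l. smult (half_size xs j ^ n * cf (p + n) j t) (corr (sg p) k n))"
    unfolding atMost_atLeast0 sum.atLeast_Suc_atMost[OF le0] by simp
  then show ?thesis
    unfolding P_def mesh_cell.radau_def[OF mc[OF that]] radau_from_moments_def cf_def kap_def by simp
qed

lemma poly_P_end: "j < N \<Longrightarrow> poly (P p j t) (sg p) = D p (cell_end xs j (sg p)) t"
  using sg_cases[of p] lk unfolding P_radau mesh_cell.radau_def[OF mc]
  by (simp add: poly_radau_from_moments poly_sum poly_corr_end)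

text \<open>Odd powers carry q with i - 1 time derivatives and even powers carry u with i of them;
  in both cases the exponent equals the order of the x-derivative. In \<open>W1_eq\<close> the order
  is one higher than the exponent.\<close>

lemma W2_eq:
  assumes j: "j < N" and t: "t \<in> {0..T}"
  shows "W2 fl k l xs T u (dx u) j x t
    = (\<Sum>n=1..l. half_size xs j ^ n * cf n j t * poly (corr s k n) (cellmap xs j x))"
proof -
  let ?f = "\<lambda>n. half_size xs j ^ n * cf n j t * poly (corr s k n) (cellmap xs j x)"
  note F = mesh_cell.F1_eq[OF mc[OF j] k1] mesh_cell.F2_eq[OF mc[OF j] k1]
    mesh_cell.F1_bar_eq[OF mc[OF j] k1] mesh_cell.F2_bar_eq[OF mc[OF j] k1]
  have even: "half_size xs j ^ (2 * i) * G_coeff fl k xs T u j i t * (if s = 1 then F1_bar else F2_bar) k xs j i x = ?f (2 * i)"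
    if i: "i \<in> {1..l div 2}" for i
  proof -
    obtain r where r: "i = Suc r" using i by (cases i) auto
    have "G_coeff fl k xs T u j i t = cf (2 * i) j t" using i lk by (intro G_coeff_eq j t) auto
    moreover have "(if s = 1 then F1_bar else F2_bar) k xs j i x = poly (corr s k (2 * i)) (cellmap xs j x)"
      using s_cases by (auto simp: r F simp del: corr.simps)
    ultimately show ?thesis by simp
  qed
  have odd: "half_size xs j ^ (2 * i - 1) * Q_coeff fl k xs T (dx u) j (i - 1) t * (if s = 1 then F2 else F1) k xs j i x = ?f (2 * i - 1)"
    if i: "i \<in> {1..(l + 1) div 2}" for i
  proof -
    obtain r where r: "i = Suc r" using i by (cases i) auto
    have "Q_coeff fl k xs T (dx u) j (i - 1) t = cf (2 * (i - 1) + 1) j t" using i lk l1 by (intro Q_coeff_eq j t) auto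
    moreover have "(if s = 1 then F2 else F1) k xs j i x = poly (corr s k (2 * i - 1)) (cellmap xs j x)"
      using s_cases by (auto simp: r F simp del: corr.simps)
    ultimately show ?thesis by (simp add: r)
  qed
  have "W2 fl k l xs T u (dx u) j x t
      = (\<Sum>i=1..(l + 1) div 2. half_size xs j ^ (2 * i - 1) * Q_coeff fl k xs T (dx u) j (i - 1) t * (if s = 1 then F2 else F1) k xs j i x)
      + (\<Sum>i=1..l div 2. half_size xs j ^ (2 * i) * G_coeff fl k xs T u j i t * (if s = 1 then F1_bar else F2_bar) k xs j i x)"
    by (cases fl) (simp_all add: flux_sign_def)
  also have "\<dots> = (\<Sum>i=1..(l + 1) div 2. ?f (2 * i - 1)) + (\<Sum>i=1..l div 2. ?f (2 * i))"
    using odd even by (intro arg_cong2[where f = "(+)"] sum.cong refl) blast+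
  also have "\<dots> = (\<Sum>n=1..l. ?f n)" by (rule sum_odd_even)
  finally show ?thesis .
qed

lemma W1_eq:
  assumes j: "j < N" and t: "t \<in> {0..T}"
  shows "W1 fl k l xs T u (dx u) j x t
    = (\<Sum>n=1..l. half_size xs j ^ n * cf (Suc n) j t * poly (corr (- s) k n) (cellmap xs j x))"
proof -
  let ?f = "\<lambda>n. half_size xs j ^ n * cf (Suc n) j t * poly (corr (- s) k n) (cellmap xs j x)"
  note F = mesh_cell.F1_eq[OF mc[OF j] k1] mesh_cell.F2_eq[OF mc[OF j] k1]
    mesh_cell.F1_bar_eq[OF mc[OF j] k1] mesh_cell.F2_bar_eq[OF mc[OF j] k1]
  have even: "half_size xs j ^ (2 * i) * Q_coeff fl k xs T (dx u) j i t * (if s = 1 then F2_bar else F1_bar) k xs j i x = ?f (2 * i)"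
    if i: "i \<in> {1..l div 2}" for i
  proof -
    obtain r where r: "i = Suc r" using i by (cases i) auto
    have "Q_coeff fl k xs T (dx u) j i t = cf (2 * i + 1) j t" using i lk by (intro Q_coeff_eq j t) auto
    moreover have "(if s = 1 then F2_bar else F1_bar) k xs j i x = poly (corr (- s) k (2 * i)) (cellmap xs j x)"
      using s_cases by (auto simp: r F simp del: corr.simps)
    ultimately show ?thesis by simp
  qed
  have odd: "half_size xs j ^ (2 * i - 1) * G_coeff fl k xs T u j i t * (if s = 1 then F1 else F2) k xs j i x = ?f (2 * i - 1)"
    if i: "i \<in> {1..(l + 1) div 2}" for i
  proof -
    obtain r where r: "i = Suc r" using i by (cases i) auto
    have "G_coeff fl k xs T u j i t = cf (2 * i) j t" using i lk l1 by (intro G_coeff_eq j t) auto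
    moreover have "(if s = 1 then F1 else F2) k xs j i x = poly (corr (- s) k (2 * i - 1)) (cellmap xs j x)"
      using s_cases by (auto simp: r F simp del: corr.simps)
    ultimately show ?thesis by (simp add: r)
  qed
  have "W1 fl k l xs T u (dx u) j x t
      = (\<Sum>i=1..(l + 1) div 2. half_size xs j ^ (2 * i - 1) * G_coeff fl k xs T u j i t * (if s = 1 then F1 else F2) k xs j i x)
      + (\<Sum>i=1..l div 2. half_size xs j ^ (2 * i) * Q_coeff fl k xs T (dx u) j i t * (if s = 1 then F2_bar else F1_bar) k xs j i x)"
    by (cases fl) (simp_all add: flux_sign_def)
  also have "\<dots> = (\<Sum>i=1..(l + 1) div 2. ?f (2 * i - 1)) + (\<Sum>i=1..l div 2. ?f (2 * i))"
    using odd even by (intro arg_cong2[where f = "(+)"] sum.cong refl) blast+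
  also have "\<dots> = (\<Sum>n=1..l. ?f n)" by (rule sum_odd_even)
  finally show ?thesis .
qed

lemma cell_disjoint:
  assumes "i < N" "j < N" "x \<in> cell xs i" "x \<in> cell xs j"
  shows "i = j"
proof -
  have False if "i < j" "i < N" "j < N" "x \<in> cell xs i" "x \<in> cell xs j" for i j
    using mesh_mono[OF mesh, of "Suc i" j] that by (auto simp: cell_def)
  then show ?thesis using assms by (metis linorder_neqE_nat)
qed

lemma sum_indicat_cell:
  assumes "j < N" "x \<in> cell xs j"
  shows "(\<Sum>i<N. indicat_real (cell xs i) x * f i) = f j"
proof -
  have "(\<Sum>i<N. indicat_real (cell xs i) x * f i) = (\<Sum>i<N. if i = j then f j else 0)"
    using assms cell_disjoint by (intro sum.cong) (auto simp: indicator_def)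
  then show ?thesis using assms by simp
qed

lemma u_interp_eq:
  assumes j: "j < N" and x: "x \<in> cell xs j" and t: "t \<in> {0..T}"
  shows "u_interp fl k l N xs T u x t = poly (P 0 j t) (cellmap xs j x)"
proof -
  have v: "\<forall>x\<in>cell xs j. u x t = D 0 x t"
    using cell_Omega[OF j] mesh_cell.cell_subset[OF mc[OF j]] D_0 t by force
  have "radau_u fl k xs j (\<lambda>y. u y t) x = poly (mesh_cell.radau xs j s k (\<lambda>x. D 0 x t)) (cellmap xs j x)"
    using mesh_cell.radau_minus_eq[OF mc[OF j] k1 v D_cont_cell[OF j _ t]] mesh_cell.radau_plus_eq[OF mc[OF j] k1 v D_cont_cell[OF j _ t]]
    by (cases fl) (auto simp: radau_u_def flux_sign_def)
  then show ?thesis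
    unfolding u_interp_def sum_indicat_cell[OF j x] W2_eq[OF j t] P_radau[OF j] by (simp add: poly_sum)
qed

lemma q_interp_eq:
  assumes j: "j < N" and x: "x \<in> cell xs j" and t: "t \<in> {0..T}"
  shows "q_interp fl k l N xs T u x t = poly (P 1 j t) (cellmap xs j x)"
proof -
  have v: "\<forall>x\<in>cell xs j. dx u x t = D 1 x t"
    using cell_Omega[OF j] mesh_cell.cell_subset[OF mc[OF j]] dx_u t by force
  have "radau_q fl k xs j (\<lambda>y. dx u y t) x = poly (mesh_cell.radau xs j (- s) k (\<lambda>x. D 1 x t)) (cellmap xs j x)"
    using mesh_cell.radau_minus_eq[OF mc[OF j] k1 v D_cont_cell[OF j _ t]] mesh_cell.radau_plus_eq[OF mc[OF j] k1 v D_cont_cell[OF j _ t]] k1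
    by (cases fl) (auto simp: radau_q_def flux_sign_def)
  then show ?thesis
    unfolding q_interp_def sum_indicat_cell[OF j x] W1_eq[OF j t] P_radau[OF j] by (simp add: poly_sum)
qed

text \<open>The corrections cancel all but the last residual.\<close>

lemma P_consistency:
  assumes j: "j < N" and p: "Suc p \<le> k + l + 1" and t: "t \<in> {0..T}" and w: "degree w \<le> k"
  shows "half_size xs j * refint (P (Suc p) j t * w)
    = D p (xs (Suc j)) t * poly w 1 - D p (xs j) t * poly w (-1) - refint (P p j t * pderiv w)
      - half_size xs j ^ Suc l * cf (Suc p + l) j t * refint (corr (sg (Suc p)) k l * w)"
proof -
  let ?h = "half_size xs j"
  have h: "?h \<noteq> 0" using hb_pos[OF j] by simp
  have expand: "refint (P r j t * v) = cint xs j (\<lambda>x. D r x t) v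
      - (\<Sum>n\<le>l. ?h ^ n * cf (r + n) j t * refint (corr (sg r) k n * v))"
    if "r \<le> k + l + 1" "degree v \<le> k" for r v
    unfolding P_def left_diff_distrib refint_diff refint_legendre_sum_cint[OF mc[OF j] D_cont_cell[OF j that(1) t] that(2)]
    by (simp add: sum_distrib_right refint_sum refint_smult)
  have "degree (pderiv w) \<le> k" using w by (simp add: degree_pderiv)
  \<comment> \<open>The term n = 0 drops out since L_k is orthogonal to the derivative of w; the
    others are shifted by one index and matched with the mass terms.\<close>
  have "(\<Sum>n\<le>l. ?h ^ n * cf (p + n) j t * refint (corr (sg p) k n * pderiv w))
      = (\<Sum>n<l. ?h ^ Suc n * cf (Suc p + n) j t * refint (corr (sg p) k (Suc n) * pderiv w))"
    using refint_corr_0_pderiv[of k w "sg p"] k1 w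
    unfolding lessThan_Suc_atMost[symmetric] sum.lessThan_Suc_shift by simp
  also have "\<dots> = - (\<Sum>n<l. ?h ^ Suc n * cf (Suc p + n) j t * refint (corr (sg (Suc p)) k n * w))"
    unfolding sum_negf[symmetric] using lk w by (intro sum.cong) (auto simp: refint_corr_Suc_pderiv simp del: corr.simps)
  finally have 1: "refint (P p j t * pderiv w) = cint xs j (\<lambda>x. D p x t) (pderiv w)
      + (\<Sum>n<l. ?h ^ Suc n * cf (Suc p + n) j t * refint (corr (sg (Suc p)) k n * w))"
    using expand[of p "pderiv w"] p \<open>degree (pderiv w) \<le> k\<close> by simp
  have "cint xs j (\<lambda>x. D (Suc p) x t) w
      = (D p (xs (Suc j)) t * poly w 1 - D p (xs j) t * poly w (-1) - cint xs j (\<lambda>x. D p x t) (pderiv w)) / ?h"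
  proof (rule mesh_cell.cint_by_parts[OF mc[OF j]])
    show "((\<lambda>x. D p x t) has_real_derivative D (Suc p) x t) (at x within {xs j..xs (Suc j)})"
      if "x \<in> {xs j..xs (Suc j)}" for x
      by (rule has_field_derivative_subset[OF D_deriv cell_Omega[OF j]]) (use p t that cell_Omega[OF j] in auto)
  qed (use D_cont_cell[OF j _ t] p in auto)
  then have 2: "?h * refint (P (Suc p) j t * w)
      = D p (xs (Suc j)) t * poly w 1 - D p (xs j) t * poly w (-1) - cint xs j (\<lambda>x. D p x t) (pderiv w)
      - (\<Sum>n\<le>l. ?h ^ Suc n * cf (Suc p + n) j t * refint (corr (sg (Suc p)) k n * w))"
    unfolding expand[OF p w] right_diff_distrib sum_distrib_left using h by (simp add: mult_ac)
  show ?thesis unfolding 2 1 by (simp add: lessThan_Suc_atMost[symmetric] algebra_simps)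
qed

subsection \<open>The discrete solution in reference coordinates\<close>

definition node :: "nat \<Rightarrow> nat \<Rightarrow> real" where
  "node j r = midpt xs j + half_size xs j * lag_pt k r"

text \<open>Recovers the polynomial of a discrete function in a cell from its values at fixed nodes.
  This reduces differentiation in time of the whole polynomial to that of point values.\<close>

definition interp :: "(real \<Rightarrow> real) \<Rightarrow> nat \<Rightarrow> real poly" where
  "interp v j = (\<Sum>r\<le>k. smult (v (node j r)) (lagrange k r))"

lemma cellmap_node: "j < N \<Longrightarrow> cellmap xs j (node j r) = lag_pt k r"
  using hb_pos[of j] by (simp add: cellmap_def node_def)

lemma node_cell:
  assumes j: "j < N" and r: "r \<le> k"
  shows "node j r \<in> cell xs j"
proof -
  have "0 \<le> lag_pt k r" "lag_pt k r < 1" using r by (auto simp: lag_pt_def)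
  then have "0 \<le> half_size xs j * lag_pt k r" "half_size xs j * lag_pt k r < half_size xs j"
    using hb_pos[OF j] by auto
  moreover have "xs j = midpt xs j - half_size xs j" "xs (Suc j) = midpt xs j + half_size xs j"
    by (simp_all add: midpt_def half_size_def cell_size_def field_simps)
  ultimately show ?thesis using hb_pos[OF j] unfolding cell_def node_def by simp
qed

lemma degree_interp: "degree (interp v j) \<le> k"
  unfolding interp_def by (intro degree_sum_le) (auto intro!: order_trans[OF degree_smult_le] degree_lagrange)

lemma interp_unique:
  assumes j: "j < N" and p: "degree p \<le> k" "\<And>x. x \<in> cell xs j \<Longrightarrow> v x = poly p (cellmap xs j x)"
  shows "interp v j = p"
  unfolding interp_def
  by (subst lagrange_interpolation[OF p(1)]) (auto intro!: sum.cong simp: p(2) node_cell[OF j] cellmap_node[OF j])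

lemma dg_eq_interp:
  assumes j: "j < N" and v: "v \<in> dg_space k N xs" and x: "x \<in> cell xs j"
  shows "v x = poly (interp v j) (cellmap xs j x)"
proof -
  obtain p where p: "degree p \<le> k" "\<forall>x\<in>cell xs j. v x = poly p x"
    using v j unfolding dg_space_def by blast
  obtain q where q: "degree q = degree p" "\<forall>x. poly p x = poly q (cellmap xs j x)"
    using mesh_cell.ex_poly_\<xi>[OF mc[OF j]] by blast
  have "interp v j = q" by (rule interp_unique[OF j]) (use p q in auto)
  then show ?thesis using p q x by simp
qed

definition Uh :: "nat \<Rightarrow> real \<Rightarrow> real poly" where "Uh j t = interp (\<lambda>x. uh x t) j"
definition Uh' :: "nat \<Rightarrow> real \<Rightarrow> real poly" where "Uh' j t = interp (\<lambda>x. dt T (uh x) t) j"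
definition Qh :: "nat \<Rightarrow> real \<Rightarrow> real poly" where "Qh j t = interp (\<lambda>x. qh x t) j"

lemma uh_eq: "j < N \<Longrightarrow> t \<in> {0..T} \<Longrightarrow> x \<in> cell xs j \<Longrightarrow> uh x t = poly (Uh j t) (cellmap xs j x)"
  and qh_eq: "j < N \<Longrightarrow> t \<in> {0..T} \<Longrightarrow> x \<in> cell xs j \<Longrightarrow> qh x t = poly (Qh j t) (cellmap xs j x)"
  unfolding Uh_def Qh_def using ldg dg_eq_interp[of j "\<lambda>x. uh x t" x] dg_eq_interp[of j "\<lambda>x. qh x t" x]
  by (auto simp: ldg_solution_def)

lemma uh_deriv:
  assumes j: "j < N" and t: "t \<in> {0..T}" and x: "x \<in> cell xs j"
  shows "(uh x has_real_derivative dt T (uh x) t) (at t within {0..T})"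
proof -
  have "uh x differentiable (at t within {0..T})"
    using ldg j t x unfolding ldg_solution_def differentiable_on_def by blast
  then obtain d where d: "(uh x has_real_derivative d) (at t within {0..T})"
    by (auto simp: real_differentiable_def)
  then show ?thesis using dt_eq[OF t _ d, of "uh x"] by simp
qed

lemma Uh_deriv:
  assumes j: "j < N" and t: "t \<in> {0..T}"
  shows "((\<lambda>t. refint (Uh j t * w)) has_real_derivative refint (Uh' j t * w)) (at t within {0..T})"
  unfolding Uh_def Uh'_def interp_def sum_distrib_right mult_smult_left refint_sum refint_smult
  by (intro DERIV_sum DERIV_cmult_right uh_deriv[OF j t] node_cell[OF j]) simp

text \<open>That the time derivative is again polynomial in each cell is not part of
  \<open>ldg_solution\<close>; it follows from the representation by nodal values.\<close>

lemma dt_uh_eq: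
  assumes j: "j < N" and t: "t \<in> {0..T}" and x: "x \<in> cell xs j"
  shows "dt T (uh x) t = poly (Uh' j t) (cellmap xs j x)"
proof (rule dt_eq[OF t])
  show "uh x r = poly (Uh j r) (cellmap xs j x)" if "r \<in> {0..T}" for r by (rule uh_eq[OF j that x])
  show "((\<lambda>r. poly (Uh j r) (cellmap xs j x)) has_real_derivative poly (Uh' j t) (cellmap xs j x)) (at t within {0..T})"
    unfolding Uh_def Uh'_def interp_def poly_sum poly_smult
    by (intro DERIV_sum DERIV_cmult_right uh_deriv[OF j t] node_cell[OF j]) simp
qed

lemma integral_cell_poly:
  assumes j: "j < N" and "\<And>x. x \<in> cell xs j \<Longrightarrow> f x = poly p (cellmap xs j x) * poly w (cellmap xs j x)"
  shows "integral (cell xs j) f = half_size xs j * refint (p * w)"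
proof -
  have "integral (cell xs j) f = integral (cell xs j) (\<lambda>x. poly p (cellmap xs j x) * poly w (cellmap xs j x))"
    by (rule integral_cong) (rule assms(2))
  then show ?thesis using mesh_cell.cint_poly[OF mc[OF j], of p w] hb_pos[OF j] by (simp add: cint_def field_simps)
qed

lemma scheme:
  assumes j: "j < N" and t: "t \<in> {0..T}" and w: "degree w \<le> k"
  shows "half_size xs j * refint (Uh' j t * w) = - refint (Qh j t * pderiv w)
      + q_hat fl b N xs qh (Suc j) t * poly w 1 - q_hat fl b N xs qh j t * poly w (-1)"
    and "half_size xs j * refint (Qh j t * w) = - refint (Uh j t * pderiv w)
      + u_hat fl b N xs uh (Suc j) t * poly w 1 - u_hat fl b N xs uh j t * poly w (-1)"
proof -
  \<comment> \<open>A single polynomial on the whole line is an admissible test function, because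
    the scheme is stated cell by cell.\<close>
  define v where "v x = poly w (cellmap xs j x)" for x
  obtain p where p: "degree p = degree w" "\<forall>x. poly p x = v x"
    using mesh_cell.ex_poly_unscaled[OF mc[OF j]] unfolding v_def by blast
  have vdg: "v \<in> dg_space k N xs" unfolding dg_space_def
  proof (intro CollectI allI impI exI[of _ p] conjI ballI)
    show "degree p \<le> k" using p w by simp
    show "v x = poly p x" for x using p by simp
  qed
  have cv: "continuous_on S v" for S
    unfolding v_def[abs_def] by (rule mesh_cell.continuous_on_poly_\<xi>[OF mc[OF j]])
  have tr: "trace_left xs v (Suc j) = poly w 1" "trace_right xs v j = poly w (-1)"
    using mesh_cell.trace_left_eq[OF mc[OF j] _ cv, of v] mesh_cell.trace_right_eq[OF mc[OF j] _ cv, of v]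
      mesh_cell.\<xi>_a[OF mc[OF j]] mesh_cell.\<xi>_b[OF mc[OF j]] by (auto simp: v_def)
  have dv: "deriv v x = poly (smult (1 / half_size xs j) (pderiv w)) (cellmap xs j x)" for x
    unfolding v_def[abs_def] using DERIV_imp_deriv[OF mesh_cell.poly_\<xi>_deriv[OF mc[OF j], of w x UNIV]] by simp
  have i: "integral (cell xs j) (\<lambda>x. dt T (uh x) t * v x) = half_size xs j * refint (Uh' j t * w)"
    "integral (cell xs j) (\<lambda>x. qh x t * v x) = half_size xs j * refint (Qh j t * w)"
    "integral (cell xs j) (\<lambda>x. qh x t * deriv v x) = half_size xs j * refint (Qh j t * smult (1 / half_size xs j) (pderiv w))"
    "integral (cell xs j) (\<lambda>x. uh x t * deriv v x) = half_size xs j * refint (Uh j t * smult (1 / half_size xs j) (pderiv w))"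
    unfolding dv by (rule integral_cell_poly[OF j], simp add: dt_uh_eq[OF j t] uh_eq[OF j t] qh_eq[OF j t] v_def)+
  have e: "half_size xs j * refint (q * smult (1 / half_size xs j) (pderiv w)) = refint (q * pderiv w)" for q
    using hb_pos[OF j] by (simp add: refint_smult)
  have "integral (cell xs j) (\<lambda>x. dt T (uh x) t * v x)
        = - integral (cell xs j) (\<lambda>x. qh x t * deriv v x)
          + q_hat fl b N xs qh (Suc j) t * trace_left xs v (Suc j)
          - q_hat fl b N xs qh j t * trace_right xs v j"
    "integral (cell xs j) (\<lambda>x. qh x t * v x)
        = - integral (cell xs j) (\<lambda>x. uh x t * deriv v x)
          + u_hat fl b N xs uh (Suc j) t * trace_left xs v (Suc j)
          - u_hat fl b N xs uh j t * trace_right xs v j"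
    using ldg t vdg j unfolding ldg_solution_def by blast+
  then show "half_size xs j * refint (Uh' j t * w) = - refint (Qh j t * pderiv w)
      + q_hat fl b N xs qh (Suc j) t * poly w 1 - q_hat fl b N xs qh j t * poly w (-1)"
    "half_size xs j * refint (Qh j t * w) = - refint (Uh j t * pderiv w)
      + u_hat fl b N xs uh (Suc j) t * poly w 1 - u_hat fl b N xs uh j t * poly w (-1)"
    unfolding i e tr by simp_all
qed

section \<open>Errors between interpolants and discrete solution\<close>

definition Eu :: "real \<Rightarrow> nat \<Rightarrow> real poly" where "Eu t j = P 0 j t - Uh j t"
definition Eq :: "real \<Rightarrow> nat \<Rightarrow> real poly" where "Eq t j = P 1 j t - Qh j t"
text \<open>The time derivative of \<open>Eu\<close>, see \<open>Eu_deriv\<close>: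
  \<open>P 2\<close> arises from \<open>P 0\<close> because every order is raised by two.\<close>

definition Eu' :: "real \<Rightarrow> nat \<Rightarrow> real poly" where "Eu' t j = P 2 j t - Uh' j t"

lemma degree_E: "degree (Eu t j) \<le> k" "degree (Eq t j) \<le> k" "degree (Eu' t j) \<le> k"
  unfolding Eu_def Eq_def Eu'_def Uh_def Qh_def Uh'_def
  by (intro degree_diff_le degree_P degree_interp)+

lemma traces:
  assumes t: "t \<in> {0..T}" and j: "j < N"
  shows "trace_left xs (\<lambda>x. uh x t) (Suc j) = poly (Uh j t) 1" "trace_right xs (\<lambda>x. uh x t) j = poly (Uh j t) (-1)"
    "trace_left xs (\<lambda>x. qh x t) (Suc j) = poly (Qh j t) 1" "trace_right xs (\<lambda>x. qh x t) j = poly (Qh j t) (-1)"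
proof -
  note c = mesh_cell.continuous_on_poly_\<xi>[OF mc[OF j]]
  have u: "\<forall>x\<in>cell xs j. uh x t = poly (Uh j t) (cellmap xs j x)" using uh_eq[OF j t] by blast
  have q: "\<forall>x\<in>cell xs j. qh x t = poly (Qh j t) (cellmap xs j x)" using qh_eq[OF j t] by blast
  show "trace_left xs (\<lambda>x. uh x t) (Suc j) = poly (Uh j t) 1" "trace_right xs (\<lambda>x. uh x t) j = poly (Uh j t) (-1)"
    "trace_left xs (\<lambda>x. qh x t) (Suc j) = poly (Qh j t) 1" "trace_right xs (\<lambda>x. qh x t) j = poly (Qh j t) (-1)"
    using mesh_cell.trace_left_eq[OF mc[OF j] u c] mesh_cell.trace_right_eq[OF mc[OF j] u c]
      mesh_cell.trace_left_eq[OF mc[OF j] q c] mesh_cell.trace_right_eq[OF mc[OF j] q c]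
      mesh_cell.\<xi>_a[OF mc[OF j]] mesh_cell.\<xi>_b[OF mc[OF j]] by auto
qed

lemma trace_N:
  assumes t: "t \<in> {0..T}"
  shows "trace_left xs (\<lambda>x. uh x t) N = poly (Uh (N - 1) t) 1" "trace_left xs (\<lambda>x. qh x t) N = poly (Qh (N - 1) t) 1"
  using traces(1,3)[OF t, of "N - 1"] N0 by simp_all

lemma xs_ends: "xs 0 = 0" "xs N = 2 * pi"
  using mesh by (auto simp: mesh_def)

lemma P_right: "j < N \<Longrightarrow> sg p = 1 \<Longrightarrow> poly (P p j t) 1 = D p (xs (Suc j)) t"
  using poly_P_end[of j p t] by (simp add: cell_end_def)

lemma P_left: "j < N \<Longrightarrow> sg p = -1 \<Longrightarrow> poly (P p j t) (-1) = D p (xs j) t"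
  using poly_P_end[of j p t] by (simp add: cell_end_def)

lemma Omega_ends: "0 \<in> Omega" "2 * pi \<in> Omega" by (auto simp: Omega_def)

lemma bc_D:
  assumes t: "t \<in> {0..T}"
  shows "per \<Longrightarrow> D 0 0 t = D 0 (2 * pi) t" "per \<Longrightarrow> D 1 0 t = D 1 (2 * pi) t"
    "b = Mixed g0 g1 \<Longrightarrow> s = 1 \<Longrightarrow> D 0 0 t = g0 t" "b = Mixed g0 g1 \<Longrightarrow> s = 1 \<Longrightarrow> D 1 (2 * pi) t = g1 t"
    "b = Mixed g0 g1 \<Longrightarrow> s = -1 \<Longrightarrow> D 1 0 t = g0 t" "b = Mixed g0 g1 \<Longrightarrow> s = -1 \<Longrightarrow> D 0 (2 * pi) t = g1 t"
proof -
  have D: "D 0 0 t = u 0 t" "D 0 (2 * pi) t = u (2 * pi) t" "D 1 0 t = dx u 0 t" "D 1 (2 * pi) t = dx u (2 * pi) t"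
    using D_0[OF _ t] dx_u[OF _ t] Omega_ends by auto
  show "per \<Longrightarrow> D 0 0 t = D 0 (2 * pi) t" "per \<Longrightarrow> D 1 0 t = D 1 (2 * pi) t"
    "b = Mixed g0 g1 \<Longrightarrow> s = 1 \<Longrightarrow> D 0 0 t = g0 t" "b = Mixed g0 g1 \<Longrightarrow> s = 1 \<Longrightarrow> D 1 (2 * pi) t = g1 t"
    "b = Mixed g0 g1 \<Longrightarrow> s = -1 \<Longrightarrow> D 1 0 t = g0 t" "b = Mixed g0 g1 \<Longrightarrow> s = -1 \<Longrightarrow> D 0 (2 * pi) t = g1 t"
    unfolding D using bc t by (cases fl; auto simp: flux_sign_def)+
qed

lemma u_hat_unfold:
  "u_hat fl b N xs uh i t = (if s = 1
     then (if i = 0 then (case b of Periodic \<Rightarrow> trace_left xs (\<lambda>x. uh x t) N | Mixed g0 g1 \<Rightarrow> g0 t)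
           else trace_left xs (\<lambda>x. uh x t) i)
     else (if i = N then (case b of Periodic \<Rightarrow> trace_right xs (\<lambda>x. uh x t) 0 | Mixed g0 g1 \<Rightarrow> g1 t)
           else trace_right xs (\<lambda>x. uh x t) i))"
  by (cases fl) (simp_all add: flux_sign_def)

lemma q_hat_unfold:
  "q_hat fl b N xs qh i t = (if s = 1
     then (if i = N then (case b of Periodic \<Rightarrow> trace_right xs (\<lambda>x. qh x t) 0 | Mixed g0 g1 \<Rightarrow> g1 t)
           else trace_right xs (\<lambda>x. qh x t) i)
     else (if i = 0 then (case b of Periodic \<Rightarrow> trace_left xs (\<lambda>x. qh x t) N | Mixed g0 g1 \<Rightarrow> g0 t)
           else trace_left xs (\<lambda>x. qh x t) i))"
  by (cases fl) (simp_all add: flux_sign_def)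

text \<open>On the side from which the flux takes its trace, \<open>P 0\<close> has the exact value
  of u: the projection interpolates there and the corrections vanish. So the flux error involves
  only the discrete error; likewise for q in \<open>q_hat_error\<close>.\<close>

lemma u_hat_error:
  assumes t: "t \<in> {0..T}" and i: "i \<le> N"
  shows "D 0 (xs i) t - u_hat fl b N xs uh i t = hat N per s (Eu t) i"
proof (cases "s = 1")
  case True
  then have sg: "sg 0 = 1" by simp
  show ?thesis
  proof (cases i)
    case 0
    then show ?thesis
      using True bc_D[OF t] xs_ends trace_N[OF t] P_right[OF _ sg, of "N - 1" t] N0
      unfolding u_hat_unfold by (cases b) (auto simp: Eu_def)
  next
    case (Suc j)
    then show ?thesis using True traces(1)[OF t, of j] P_right[OF _ sg, of j t] i
      unfolding u_hat_unfold by (simp add: Eu_def)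
  qed
next
  case False
  then have s: "s = -1" and sg: "sg 0 = -1" using s_cases by auto
  show ?thesis
  proof (cases "i = N")
    case True
    then show ?thesis
      using s bc_D[OF t] xs_ends traces(2)[OF t N0] P_left[OF _ sg, of 0 t] N0
      unfolding u_hat_unfold by (cases b) (auto simp: Eu_def)
  next
    case False
    then show ?thesis using s traces(2)[OF t, of i] P_left[OF _ sg, of i t] i
      unfolding u_hat_unfold by (simp add: Eu_def)
  qed
qed

lemma q_hat_error:
  assumes t: "t \<in> {0..T}" and i: "i \<le> N"
  shows "D 1 (xs i) t - q_hat fl b N xs qh i t = hat N per (- s) (Eq t) i"
proof (cases "s = 1")
  case True
  then have sg: "sg 1 = -1" by simp
  show ?thesis
  proof (cases "i = N")
    case i: True
    then show ?thesis
      using True bc_D[OF t] xs_ends traces(4)[OF t N0] P_left[OF _ sg, of 0 t] N0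
      unfolding q_hat_unfold by (cases b) (auto simp: Eq_def)
  next
    case False
    then show ?thesis using True traces(4)[OF t, of i] P_left[OF _ sg, of i t] i
      unfolding q_hat_unfold by (simp add: Eq_def)
  qed
next
  case False
  then have s: "s = -1" and sg: "sg 1 = 1" using s_cases by auto
  show ?thesis
  proof (cases i)
    case 0
    then show ?thesis
      using s bc_D[OF t] xs_ends trace_N[OF t] P_right[OF _ sg, of "N - 1" t] N0
      unfolding q_hat_unfold by (cases b) (auto simp: Eq_def)
  next
    case (Suc j)
    then show ?thesis using s traces(3)[OF t, of j] P_right[OF _ sg, of j t] i
      unfolding q_hat_unfold by (simp add: Eq_def)
  qed
qed

lemma error_q:
  assumes j: "j < N" and t: "t \<in> {0..T}" and w: "degree w \<le> k"
  shows "half_size xs j * refint (Eq t j * w) = dgform N per s (Eu t) j w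
      - half_size xs j ^ Suc l * cf (Suc l) j t * refint (corr (- s) k l * w)"
  using P_consistency[OF j _ t w, of 0] scheme(2)[OF j t w] k1 l1
  unfolding dgform_def u_hat_error[OF t less_imp_le[OF j], symmetric] u_hat_error[OF t Suc_leI[OF j], symmetric]
  by (simp add: Eq_def Eu_def left_diff_distrib refint_diff algebra_simps del: hat.simps)

lemma error_u:
  assumes j: "j < N" and t: "t \<in> {0..T}" and w: "degree w \<le> k"
  shows "half_size xs j * refint (Eu' t j * w) = dgform N per (- s) (Eq t) j w
      - half_size xs j ^ Suc l * cf (l + 2) j t * refint (corr s k l * w)"
  using P_consistency[OF j _ t w, of 1] scheme(1)[OF j t w] k1 l1
  unfolding dgform_def q_hat_error[OF t less_imp_le[OF j], symmetric] q_hat_error[OF t Suc_leI[OF j], symmetric]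
  by (simp add: Eq_def Eu'_def left_diff_distrib refint_diff algebra_simps numeral_2_eq_2 del: hat.simps)

lemma Eu_deriv:
  assumes j: "j < N" and t: "t \<in> {0..T}" and w: "degree w \<le> k"
  shows "((\<lambda>t. refint (Eu t j * w)) has_real_derivative refint (Eu' t j * w)) (at t within {0..T})"
proof -
  have P: "refint (P p j r * w) = cint xs j (\<lambda>x. D p x r) w
      - (\<Sum>n\<le>l. half_size xs j ^ n * cf (p + n) j r * refint (corr (sg p) k n * w))"
    if "p \<le> 2" "r \<in> {0..T}" for p r
  proof -
    have "p \<le> k + l + 1" using that k1 l1 by simp
    note refint_legendre_sum_cint[OF mc[OF j] D_cont_cell[OF j this that(2)] w]
    then show ?thesis unfolding P_def left_diff_distrib refint_diff
      by (simp add: sum_distrib_right refint_sum refint_smult)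
  qed
  have "((\<lambda>t. cint xs j (\<lambda>x. D 0 x t) w - (\<Sum>n\<le>l. half_size xs j ^ n * cf (0 + n) j t * refint (corr (sg 0) k n * w)))
     has_real_derivative (cint xs j (\<lambda>x. D (0 + 2) x t) w - (\<Sum>n\<le>l. half_size xs j ^ n * cf (0 + n + 2) j t * refint (corr (sg 0) k n * w))))
     (at t within {0..T})"
    by (intro DERIV_diff DERIV_sum DERIV_cmult_right DERIV_cmult cint_deriv cf_deriv j t) (use k1 l1 in auto)
  then have "((\<lambda>t. cint xs j (\<lambda>x. D 0 x t) w - (\<Sum>n\<le>l. half_size xs j ^ n * cf (0 + n) j t * refint (corr (sg 0) k n * w)))
     has_real_derivative refint (P 2 j t * w)) (at t within {0..T})"
    unfolding P[OF order_refl t] by (simp add: numeral_2_eq_2)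
  then have "((\<lambda>t. refint (P 0 j t * w)) has_real_derivative refint (P 2 j t * w)) (at t within {0..T})"
    by (rule has_field_derivative_transform_within[where d = 1]) (use P[of 0] t in auto)
  then show ?thesis
    unfolding Eu_def Eu'_def left_diff_distrib refint_diff by (intro DERIV_diff Uh_deriv j t)
qed

lemma Eu_0: "j < N \<Longrightarrow> Eu 0 j = 0"
proof -
  assume j: "j < N"
  have "interp (\<lambda>x. uh x 0) j = P 0 j 0"
    by (rule interp_unique[OF j degree_P]) (use init[OF j] u_interp_eq[OF j, of _ 0] T in auto)
  then show ?thesis by (simp add: Eu_def Uh_def)
qed

subsection \<open>Orthonormal coordinates\<close>

definition idx :: "(nat \<times> nat) set" where "idx = {..<N} \<times> {..k}"

text \<open>Normalises the Legendre polynomials in L^2 of the cell.\<close>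

definition nu :: "nat \<times> nat \<Rightarrow> real" where
  "nu i = sqrt ((2 * real (snd i) + 1) / (2 * half_size xs (fst i)))"

definition basis :: "nat \<times> nat \<Rightarrow> nat \<Rightarrow> real poly" where
  "basis i j = (if j = fst i then smult (nu i) (legendre_poly (snd i)) else 0)"

definition coords :: "(nat \<Rightarrow> real poly) \<Rightarrow> nat \<times> nat \<Rightarrow> real" where
  "coords E i = half_size xs (fst i) * refint (E (fst i) * basis i (fst i))"

definition dmat :: "nat \<times> nat \<Rightarrow> nat \<times> nat \<Rightarrow> real" where
  "dmat i i' = dgform N per s (basis i') (fst i) (basis i (fst i))"

text \<open>In the notation of \<open>mixed_error_system\<close>, \<rho> is
  \<open>resid s l\<close>, \<rho>' is \<open>resid s (l + 2)\<close> and \<gamma> is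
  \<open>resid (- s) (Suc l)\<close>. That \<rho>' is the derivative of \<rho> is again the shift of
  the order by two.\<close>

definition resid :: "real \<Rightarrow> nat \<Rightarrow> real \<Rightarrow> nat \<times> nat \<Rightarrow> real" where
  "resid \<sigma> n t i = - (half_size xs (fst i) ^ Suc l * cf n (fst i) t * refint (corr \<sigma> k l * basis i (fst i)))"

lemma finite_idx: "finite idx" by (simp add: idx_def)

lemma nu_square: "fst i < N \<Longrightarrow> nu i * nu i = (2 * real (snd i) + 1) / (2 * half_size xs (fst i))"
  unfolding nu_def using hb_pos[of "fst i"] by simp

lemma sum_idx: "(\<Sum>i\<in>idx. f i) = (\<Sum>j<N. \<Sum>r\<le>k. f (j, r))"
  unfolding idx_def by (simp add: sum.cartesian_product)

lemma degree_basis: "snd i \<le> k \<Longrightarrow> degree (basis i j) \<le> k"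
  unfolding basis_def by (auto intro!: order_trans[OF degree_smult_le] simp: degree_legendre)

lemma coords_expansion:
  assumes j: "j < N" and E: "degree (E j) \<le> k"
  shows "E j = (\<Sum>r\<le>k. smult (coords E (j, r)) (basis (j, r) j))"
proof -
  have "smult (coords E (j, r)) (basis (j, r) j) = smult ((2 * real r + 1) / 2 * refint (E j * legendre_poly r)) (legendre_poly r)" for r
  proof -
    have "coords E (j, r) * nu (j, r) = (nu (j, r) * nu (j, r)) * (half_size xs j * refint (E j * legendre_poly r))"
      by (simp add: coords_def basis_def refint_smult)
    also have "\<dots> = (2 * real r + 1) / 2 * refint (E j * legendre_poly r)"
      using nu_square[of "(j, r)"] j hb_pos[OF j] by simp
    finally show ?thesis by (simp only: basis_def fst_conv snd_conv simp_thms if_True smult_smult)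
  qed
  then show ?thesis using legendre_expansion[OF E] by (simp add: legendre_sum_def)
qed

lemma coords_expansion_idx:
  assumes E: "\<And>j. j < N \<Longrightarrow> degree (E j) \<le> k" and j: "j < N"
  shows "E j = (\<Sum>i\<in>idx. smult (coords E i) (basis i j))"
proof -
  have "(\<Sum>i\<in>idx. smult (coords E i) (basis i j)) = (\<Sum>j'<N. if j' = j then E j else 0)"
    unfolding sum_idx
  proof (intro sum.cong refl)
    fix j' assume "j' \<in> {..<N}"
    show "(\<Sum>r\<le>k. smult (coords E (j', r)) (basis (j', r) j)) = (if j' = j then E j else 0)"
      using coords_expansion[where E = E, OF j E[OF j]] by (auto simp: basis_def)
  qed
  then show ?thesis using j by simp
qed

lemma dgform_coords:
  assumes E: "\<And>j. j < N \<Longrightarrow> degree (E j) \<le> k" and i: "i \<in> idx"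
  shows "dgform N per s E (fst i) (basis i (fst i)) = mat_vec idx dmat (coords E) i"
proof -
  have j: "fst i < N" using i by (auto simp: idx_def)
  have "dgform N per s E (fst i) (basis i (fst i))
      = dgform N per s (\<lambda>j. \<Sum>i'\<in>idx. smult (coords E i') (basis i' j)) (fst i) (basis i (fst i))"
    by (rule dgform_cong[OF _ j]) (rule coords_expansion_idx[OF E])
  then show ?thesis unfolding dgform_sum_left[OF finite_idx] by (simp add: mat_vec_def dmat_def mult.commute)
qed

text \<open>A basis function lives in one cell, so the local form equals the sum over all cells, to
  which the adjoint identity applies. This is where the opposite fluxes for u and q produce the
  transpose with a minus sign.\<close>

lemma dgform_coords_adjoint:
  assumes E: "\<And>j. j < N \<Longrightarrow> degree (E j) \<le> k" and i: "i \<in> idx"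
  shows "dgform N per (- s) E (fst i) (basis i (fst i)) = - mat_vec idx (transp_mat dmat) (coords E) i"
proof -
  have j: "fst i < N" using i by (auto simp: idx_def)
  have "dgform N per (- s) E (fst i) (basis i (fst i)) = (\<Sum>j<N. if j = fst i then dgform N per (- s) E j (basis i j) else 0)"
    using j by simp
  also have "\<dots> = (\<Sum>j<N. dgform N per (- s) E j (basis i j))"
    by (intro sum.cong) (auto simp: basis_def)
  also have "\<dots> = - (\<Sum>j<N. dgform N per s (basis i) j (E j))"
    using dgform_adjoint[OF N0 s_cases, of per "basis i" E] by simp
  also have "(\<Sum>j<N. dgform N per s (basis i) j (E j)) = (\<Sum>j<N. \<Sum>r\<le>k. coords E (j, r) * dmat (j, r) i)"
  proof (intro sum.cong refl)
    fix j assume "j \<in> {..<N}"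
    then have "E j = (\<Sum>r\<le>k. smult (coords E (j, r)) (basis (j, r) j))"
      using coords_expansion[of j E] E by simp
    then have "dgform N per s (basis i) j (E j)
        = dgform N per s (basis i) j (\<Sum>r\<le>k. smult (coords E (j, r)) (basis (j, r) j))" by simp
    then show "dgform N per s (basis i) j (E j) = (\<Sum>r\<le>k. coords E (j, r) * dmat (j, r) i)"
      unfolding dgform_sum_right by (simp add: dmat_def)
  qed
  finally show ?thesis by (simp add: mat_vec_def transp_mat_def sum_idx mult.commute)
qed

lemma coords_Eu_deriv:
  assumes i: "i \<in> idx" and t: "t \<in> {0..T}"
  shows "((\<lambda>t. coords (Eu t) i) has_real_derivative
      - mat_vec idx (transp_mat dmat) (coords (Eq t)) i + resid s (l + 2) t i) (at t within {0..T})"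
proof -
  have j: "fst i < N" "snd i \<le> k" using i by (auto simp: idx_def)
  have "((\<lambda>t. coords (Eu t) i) has_real_derivative coords (Eu' t) i) (at t within {0..T})"
    unfolding coords_def by (intro DERIV_cmult Eu_deriv j t degree_basis)
  moreover have "coords (Eu' t) i = - mat_vec idx (transp_mat dmat) (coords (Eq t)) i + resid s (l + 2) t i"
    unfolding coords_def[of "Eu' t"] error_u[OF j(1) t degree_basis[OF j(2)]]
      dgform_coords_adjoint[OF degree_E(2) i] by (simp add: resid_def)
  ultimately show ?thesis by simp
qed

lemma coords_Eq:
  assumes i: "i \<in> idx" and t: "t \<in> {0..T}"
  shows "coords (Eq t) i = mat_vec idx dmat (coords (Eu t)) i + resid (- s) (Suc l) t i"
proof -
  have j: "fst i < N" "snd i \<le> k" using i by (auto simp: idx_def)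
  show ?thesis unfolding coords_def[of "Eq t"] error_q[OF j(1) t degree_basis[OF j(2)]]
      dgform_coords[OF degree_E(1) i] by (simp add: resid_def)
qed

lemma resid_deriv:
  assumes i: "i \<in> idx" and n: "n + 2 \<le> k + l + 1" and t: "t \<in> {0..T}"
  shows "((\<lambda>t. resid \<sigma> n t i) has_real_derivative resid \<sigma> (n + 2) t i) (at t within {0..T})"
  unfolding resid_def using i
  by (intro DERIV_minus DERIV_cmult DERIV_cmult_right cf_deriv n t) (auto simp: idx_def)

lemma coords_0: "i \<in> idx \<Longrightarrow> coords (Eu 0) i = 0"
  by (auto simp: coords_def Eu_0 idx_def)

lemma dotp_coords:
  assumes "\<And>j. j < N \<Longrightarrow> degree (E j) \<le> k"
  shows "dotp idx (coords E) (coords E) = (\<Sum>j<N. half_size xs j * refint (E j * E j))"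
  unfolding dotp_def sum_idx
proof (intro sum.cong refl)
  fix j assume "j \<in> {..<N}"
  then have j: "j < N" by simp
  have "coords E (j, r) * coords E (j, r) = half_size xs j * ((2 * real r + 1) / 2 * (refint (E j * legendre_poly r))\<^sup>2)" for r
  proof -
    have "coords E (j, r) * coords E (j, r)
        = (half_size xs j * refint (E j * legendre_poly r))\<^sup>2 * (nu (j, r) * nu (j, r))"
      by (simp add: coords_def basis_def refint_smult power2_eq_square mult_ac)
    then show ?thesis using nu_square[of "(j, r)"] j hb_pos[OF j] by (simp add: power2_eq_square)
  qed
  then show "(\<Sum>r\<le>k. coords E (j, r) * coords E (j, r)) = half_size xs j * refint (E j * E j)"
    unfolding refint_parseval[OF assms[OF j]] sum_distrib_left by (intro sum.cong refl)
qed

lemma L2_norm_coords: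
  assumes E: "\<And>j. j < N \<Longrightarrow> degree (E j) \<le> k"
    and f: "\<And>j x. j < N \<Longrightarrow> x \<in> cell xs j \<Longrightarrow> f x = poly (E j) (cellmap xs j x)"
  shows "L2_norm_Omega f = sqrt (dotp idx (coords E) (coords E))"
proof -
  have "(\<lambda>x. (f x)\<^sup>2) integrable_on {xs 0..xs n} \<and>
      integral {xs 0..xs n} (\<lambda>x. (f x)\<^sup>2) = (\<Sum>j<n. half_size xs j * refint (E j * E j))" if "n \<le> N" for n
    using that
  proof (induction n)
    case (Suc n)
    then have n: "n < N" by simp
    have le: "xs 0 \<le> xs n" "xs n \<le> xs (Suc n)" using mesh_mono[OF mesh] Suc.prems by auto
    have 1: "(\<lambda>x. (f x)\<^sup>2) integrable_on {xs n..xs (Suc n)}"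
    proof -
      have "(\<lambda>x. poly (E n) (cellmap xs n x) * poly (E n) (cellmap xs n x)) integrable_on cbox (xs n) (xs (Suc n))"
        using mesh_cell.integrable_times_poly[OF mc[OF n] mesh_cell.continuous_on_poly_\<xi>[OF mc[OF n]]] by simp
      then have "(\<lambda>x. (f x)\<^sup>2) integrable_on cbox (xs n) (xs (Suc n))"
        by (rule integrable_spike_interior[rotated]) (use f[OF n] in \<open>auto simp: cell_def power2_eq_square\<close>)
      then show ?thesis by simp
    qed
    have 2: "integral {xs n..xs (Suc n)} (\<lambda>x. (f x)\<^sup>2) = half_size xs n * refint (E n * E n)"
      unfolding integral_cell[symmetric] by (rule integral_cell_poly[OF n]) (simp add: f[OF n] power2_eq_square)
    have 3: "(\<lambda>x. (f x)\<^sup>2) integrable_on {xs 0..xs (Suc n)}"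
      using Henstock_Kurzweil_Integration.integrable_combine[OF le _ 1] Suc by simp
    show ?case using Henstock_Kurzweil_Integration.integral_combine[OF le 3] 3 Suc 2 by simp
  next
    case 0
    then show ?case using integrable_on_refl[of "\<lambda>x. (f x)\<^sup>2" "xs 0"] by simp
  qed
  moreover have "dotp idx (coords E) (coords E) = (\<Sum>j<N. half_size xs j * refint (E j * E j))"
    by (rule dotp_coords) (rule E)
  ultimately show ?thesis
    unfolding L2_norm_Omega_def Omega_def using xs_ends by (metis order_refl)
qed

end

section \<open>Bounds for the residuals\<close>

text \<open>Names the property in \<open>kap_bound\<close>, so that the constant can be fixed before
  mesh and solution and then be passed to a locale.\<close>

definition kap_const :: "nat \<Rightarrow> real \<Rightarrow> bool" where
  "kap_const k C \<longleftrightarrow> C > 0 \<and> (\<forall>s (xs :: nat \<Rightarrow> real) j f p B. (s = 1 \<or> s = -1) \<and> xs j < xs (Suc j) \<and>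
     continuous_on {xs j..xs (Suc j)} f \<and> degree p \<le> k \<and>
     (\<forall>x\<in>{xs j..xs (Suc j)}. \<bar>f x - poly p x\<bar> \<le> B) \<longrightarrow> \<bar>kap s k xs j f\<bar> \<le> C * B)"

definition corr_const :: "nat \<Rightarrow> nat \<Rightarrow> real" where
  "corr_const k l = (\<Sum>r\<le>k. (2 * real r + 1) / 2 * ((refint (corr 1 k l * legendre_poly r))\<^sup>2
     + (refint (corr (-1) k l * legendre_poly r))\<^sup>2))"

lemma corr_const_nonneg: "corr_const k l \<ge> 0"
  unfolding corr_const_def by (intro sum_nonneg) auto

lemma corr_const_bound:
  assumes "\<sigma> = 1 \<or> \<sigma> = -1"
  shows "(\<Sum>r\<le>k. (2 * real r + 1) / 2 * (refint (corr \<sigma> k l * legendre_poly r))\<^sup>2) \<le> corr_const k l"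
  unfolding corr_const_def using assms by (intro sum_mono mult_left_mono) auto

text \<open>From min(1, y) <= y^(1/4). An exponent below 1/2 is needed for the resulting power of r
  to be integrable at the boundary.\<close>

lemma min_powr_bound:
  fixes \<sigma> r :: real
  assumes "\<sigma> > 0" "r > 0"
  shows "min 1 (\<sigma> / r\<^sup>2) \<le> \<sigma> powr (1/4) * r powr (-1/2)"
proof -
  define y where "y = \<sigma> / r\<^sup>2"
  have y: "y > 0" using assms by (simp add: y_def)
  have "r\<^sup>2 = r powr 2" using assms by simp
  then have "r\<^sup>2 powr (1/4) = r powr (2 * (1/4))" by (simp only: powr_powr)
  moreover have "2 * (1/4 :: real) = 1/2" by simp
  ultimately have "r\<^sup>2 powr (1/4) = r powr (1/2)" by (simp only:)
  moreover have "r powr (-1/2) = 1 / r powr (1/2)"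
    using powr_minus_divide[of r "1/2"] by simp
  moreover have "y powr (1/4) = \<sigma> powr (1/4) / r\<^sup>2 powr (1/4)"
    unfolding y_def by (rule powr_divide)
  ultimately have "y powr (1/4) = \<sigma> powr (1/4) * r powr (-1/2)"
    by (simp only: mult_1_right times_divide_eq_right)
  moreover have "min 1 y \<le> y powr (1/4)"
  proof (cases "y \<le> 1")
    case True
    then show ?thesis using y powr_mono'[of "1/4" 1 y] by simp
  next
    case False
    then show ?thesis using ge_one_powr_ge_zero[of y "1/4"] by simp
  qed
  ultimately show ?thesis by (simp add: y_def)
qed

lemma sqrt_half_powr_le:
  fixes t :: real
  assumes "0 < t"
  shows "sqrt (t / 2) powr (-1/2) \<le> 2 * t powr (-1/4)"
proof -
  have half: "(2::real) powr (-1) = 1/2" using powr_minus_divide[of "2::real" 1] by simp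
  have "sqrt (t / 2) = (t / 2) powr (1/2)"
    by (rule powr_half_sqrt[symmetric]) (use assms in simp)
  then have "sqrt (t / 2) powr (-1/2) = (t / 2) powr (1/2 * (-1/2))" by (simp only: powr_powr)
  moreover have "(1/2 :: real) * (-1/2) = -1/4" by simp
  ultimately have "sqrt (t / 2) powr (-1/2) = (t / 2) powr (-1/4)" by (simp only:)
  also have "\<dots> = t powr (-1/4) / 2 powr (-1/4)" by (rule powr_divide)
  also have "\<dots> \<le> t powr (-1/4) / 2 powr (-1)"
    by (intro divide_left_mono powr_mono) (auto intro: mult_pos_pos)
  finally show ?thesis unfolding half by (simp only: divide_divide_eq_right div_by_1 mult.commute[of 2])
qed

text \<open>Compares a term of a Riemann sum of x^(-1/2), taken at the left end where the integrand
  is largest, with an increment of sqrt. The bound on y / x limits the loss.\<close>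

lemma sqrt_telescope_bound:
  fixes x y c :: real
  assumes "0 < x" "x \<le> y" "y \<le> (1 + c) * x" "c \<ge> 0"
  shows "(y - x) * x powr (-1/2) \<le> (2 + c) * (sqrt y - sqrt x)"
proof -
  have "sqrt y \<le> sqrt ((1 + c)\<^sup>2 * x)"
  proof (rule real_sqrt_le_mono)
    have "(1 + c) * x \<le> (1 + c) * ((1 + c) * x)" using assms by (simp add: field_simps)
    then have "y \<le> (1 + c) * ((1 + c) * x)" using assms(3) by linarith
    then show "y \<le> (1 + c)\<^sup>2 * x" by (simp only: power2_eq_square mult.assoc)
  qed
  also have "\<dots> = (1 + c) * sqrt x" using assms by (simp add: real_sqrt_mult)
  finally have sy: "sqrt y + sqrt x \<le> (2 + c) * sqrt x" by (simp add: algebra_simps)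
  have "y - x = (sqrt y - sqrt x) * (sqrt y + sqrt x)"
    using assms by (simp add: algebra_simps flip: power2_eq_square)
  also have "\<dots> \<le> (sqrt y - sqrt x) * ((2 + c) * sqrt x)"
    using assms sy by (intro mult_left_mono) auto
  finally have "(y - x) * (1 / sqrt x) \<le> (sqrt y - sqrt x) * ((2 + c) * sqrt x) * (1 / sqrt x)"
    using assms by (intro mult_right_mono) auto
  moreover have "x powr (-1/2) = 1 / sqrt x"
    using assms by (simp add: powr_minus powr_half_sqrt inverse_eq_divide)
  ultimately show ?thesis using assms by (simp add: mult_ac)
qed

locale ldg_bounds = ldg_error T M u0 u k l N xs fl b uh qh
  for T M :: real and u0 :: "real \<Rightarrow> real" and u :: "real \<Rightarrow> real \<Rightarrow> real" and k l N :: nat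
    and xs :: "nat \<Rightarrow> real" and fl :: flux and b :: bc and uh qh :: "real \<Rightarrow> real \<Rightarrow> real" +
  fixes c C1 :: real
  assumes quasi: "quasi_uniform c N xs" and C1: "kap_const k C1"
begin

abbreviation h :: real where "h \<equiv> mesh_size N xs"

lemma cell_size_pos: "j < N \<Longrightarrow> cell_size xs j > 0"
  using mesh by (simp add: mesh_def cell_size_def)

lemma cell_size_le: "j < N \<Longrightarrow> cell_size xs j \<le> h"
  unfolding mesh_size_def by (intro Max_ge) auto

lemma h_pos: "h > 0"
  using cell_size_pos[OF N0] cell_size_le[OF N0] by linarith

lemma h_quasi: "j < N \<Longrightarrow> h \<le> c * cell_size xs j"
  using quasi by (simp add: quasi_uniform_def)

lemma c_nonneg: "c \<ge> 0"
  using h_quasi[OF N0] h_pos cell_size_pos[OF N0] by (smt (verit) mult_nonneg_nonneg zero_le_mult_iff mult_less_0_iff)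

lemma half_size_le: "j < N \<Longrightarrow> half_size xs j \<le> cell_size xs j"
  using cell_size_pos[of j] by (simp add: half_size_def)

lemma sum_cell_size: "(\<Sum>j<N. cell_size xs j) = 2 * pi"
  unfolding cell_size_def sum_lessThan_telescope using xs_ends by simp

lemma h_le: "h \<le> 2 * pi"
proof -
  have "cell_size xs j \<le> 2 * pi" if "j < N" for j
    unfolding sum_cell_size[symmetric] using that cell_size_pos
    by (intro member_le_sum) (auto intro: less_imp_le)
  then show ?thesis unfolding mesh_size_def using N0 by (subst Max_le_iff) auto
qed

lemma kap_approx:
  assumes j: "j < N" and i: "i \<le> k" and \<sigma>: "\<sigma> = 1 \<or> \<sigma> = -1"
    and g: "\<And>q x. q < i \<Longrightarrow> x \<in> {xs j..xs (Suc j)} \<Longrightarrow>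
      (g q has_real_derivative g (Suc q) x) (at x within {xs j..xs (Suc j)})"
    and c0: "continuous_on {xs j..xs (Suc j)} (g 0)"
    and B: "\<And>x. x \<in> {xs j..xs (Suc j)} \<Longrightarrow> \<bar>g i x - a\<bar> \<le> B"
  shows "\<bar>kap \<sigma> k xs j (g 0)\<bar> \<le> C1 * (B * cell_size xs j ^ i)"
proof -
  have lt: "xs j < xs (Suc j)" using cell_size_pos[OF j] by (simp add: cell_size_def)
  obtain p where p: "degree p \<le> i" "\<forall>x\<in>{xs j..xs (Suc j)}. \<bar>g 0 x - poly p x\<bar> \<le> B * (xs (Suc j) - xs j) ^ i"
    using ex_poly_approx[of "xs j" "xs (Suc j)" i g a B] lt g B by auto
  have "degree p \<le> k" using p i by simp
  then show ?thesis using C1 p lt \<sigma> c0 unfolding kap_const_def cell_size_def by blast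
qed

lemma D_deriv_cell:
  assumes "j < N" "Suc n \<le> k + l + 1" "t \<in> {0..T}" "x \<in> {xs j..xs (Suc j)}"
  shows "((\<lambda>x. D n x t) has_real_derivative D (Suc n) x t) (at x within {xs j..xs (Suc j)})"
  by (rule has_field_derivative_subset[OF D_deriv cell_Omega[OF assms(1)]]) (use assms cell_Omega[OF assms(1)] in auto)

lemma cf_diff_bound:
  assumes j: "j < N" and i: "i \<le> k" and n: "n + i \<le> k + l + 1" and t: "t \<in> {0..T}" "t' \<in> {0..T}"
    and B: "\<And>x. x \<in> {xs j..xs (Suc j)} \<Longrightarrow> \<bar>(D (n + i) x t - D (n + i) x t') - a\<bar> \<le> B"
  shows "\<bar>cf n j t - cf n j t'\<bar> \<le> C1 * (B * cell_size xs j ^ i)"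
proof -
  have "cf n j t - cf n j t' = kap (sg n) k xs j (\<lambda>x. D (n + 0) x t - D (n + 0) x t')"
    unfolding cf_def using mesh_cell.kap_diff[OF mc[OF j] D_cont_cell[OF j _ t(1)] D_cont_cell[OF j _ t(2)]] n by simp
  also have "\<bar>\<dots>\<bar> \<le> C1 * (B * cell_size xs j ^ i)"
    by (rule kap_approx[OF j i sg_cases, where g = "\<lambda>q x. D (n + q) x t - D (n + q) x t'" and a = a])
      (use n B in \<open>auto intro!: DERIV_diff D_deriv_cell j t continuous_intros D_cont_cell\<close>)
  finally show ?thesis .
qed

lemma cf_bound:
  assumes j: "j < N" and t: "t \<in> {0..T}"
  shows "\<bar>cf (Suc l) j t\<bar> \<le> C1 * M * cell_size xs j ^ Suc k"
proof -
  have "\<bar>kap (sg (Suc l)) k xs j (\<lambda>x. D (Suc l + 0) x t)\<bar> \<le> C1 * ((M * cell_size xs j) * cell_size xs j ^ k)"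
  proof (rule kap_approx[OF j order_refl sg_cases, where g = "\<lambda>q x. D (Suc l + q) x t" and a = "D (Suc l + k) (xs j) t"])
    fix x assume x: "x \<in> {xs j..xs (Suc j)}"
    have "\<bar>D (Suc l + k) x t - D (Suc l + k) (xs j) t\<bar> \<le> M * \<bar>x - xs j\<bar>"
      using cell_Omega[OF j] x t by (intro D_Lipschitz) auto
    also have "\<dots> \<le> M * cell_size xs j" using x M_nonneg by (intro mult_left_mono) (auto simp: cell_size_def)
    finally show "\<bar>D (Suc l + k) x t - D (Suc l + k) (xs j) t\<bar> \<le> M * cell_size xs j" .
  qed (auto intro!: D_deriv_cell j t D_cont_cell simp: add.commute)
  then show ?thesis by (simp add: cf_def mult_ac)
qed

lemma C1_pos: "C1 > 0" using C1 by (simp add: kap_const_def)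

lemma power_cell_size_le: "j < N \<Longrightarrow> cell_size xs j ^ n \<le> h ^ n"
  using cell_size_le[of j] cell_size_pos[of j] by (intro power_mono) auto

text \<open>The order k + l is the highest with a Lipschitz bound in time up to the boundary.
  Stopping the approximation there trades one power of h for the full factor |t - t'|;
  \<open>\<gamma>_diff_Lipschitz\<close> trades two. Both serve the cells that touch the
  boundary.\<close>

lemma \<rho>_diff_Lipschitz:
  assumes j: "j < N" and t: "t \<in> {0..T}" "t' \<in> {0..T}"
  shows "\<bar>cf l j t - cf l j t'\<bar> \<le> C1 * M * \<bar>t - t'\<bar> * h ^ k"
proof -
  have "\<bar>cf l j t - cf l j t'\<bar> \<le> C1 * ((M * \<bar>t - t'\<bar>) * cell_size xs j ^ k)"
  proof (rule cf_diff_bound[OF j order_refl _ t, where a = 0])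
    fix x assume "x \<in> {xs j..xs (Suc j)}"
    then show "\<bar>D (l + k) x t - D (l + k) x t' - 0\<bar> \<le> M * \<bar>t - t'\<bar>"
      using D_Lipschitz_t[of x t' t] cell_Omega[OF j] t by (auto simp: add.commute)
  qed simp
  also have "\<dots> \<le> C1 * ((M * \<bar>t - t'\<bar>) * h ^ k)"
    using C1_pos M_nonneg by (intro mult_left_mono power_cell_size_le j) auto
  finally show ?thesis by (simp add: mult_ac)
qed

lemma \<rho>_diff_bound:
  assumes j: "j < N" and t: "t \<in> {0..T}" "t' \<in> {0..T}"
    and S: "\<And>x. x \<in> {xs j..xs (Suc j)} \<Longrightarrow> \<bar>D (k + l + 1) x t - D (k + l + 1) x t'\<bar> \<le> S"
  shows "\<bar>cf l j t - cf l j t'\<bar> \<le> C1 * S * h ^ Suc k"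
proof -
  have lt: "xs j < xs (Suc j)" using cell_size_pos[OF j] by (simp add: cell_size_def)
  have S0: "S \<ge> 0" using S[of "xs j"] lt by simp
  have "\<bar>cf l j t - cf l j t'\<bar> \<le> C1 * ((S * cell_size xs j) * cell_size xs j ^ k)"
  proof (rule cf_diff_bound[OF j order_refl _ t, where a = "D (l + k) (xs j) t - D (l + k) (xs j) t'"])
    fix x assume x: "x \<in> {xs j..xs (Suc j)}"
    have "norm ((D (l + k) x t - D (l + k) x t') - (D (l + k) (xs j) t - D (l + k) (xs j) t')) \<le> S * norm (x - xs j)"
    proof (rule field_differentiable_bound[where S = "{xs j..xs (Suc j)}"])
      show "((\<lambda>x. D (l + k) x t - D (l + k) x t') has_field_derivative D (k + l + 1) y t - D (k + l + 1) y t')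
          (at y within {xs j..xs (Suc j)})" if "y \<in> {xs j..xs (Suc j)}" for y
        using D_deriv_cell[OF j _ t(1) that, of "l + k"] D_deriv_cell[OF j _ t(2) that, of "l + k"]
        by (intro DERIV_diff) (auto simp: add.commute)
      show "norm (D (k + l + 1) y t - D (k + l + 1) y t') \<le> S" if "y \<in> {xs j..xs (Suc j)}" for y
        using S[OF that] by simp
    qed (use x lt in auto)
    also have "\<dots> \<le> S * cell_size xs j" using x S0 by (intro mult_left_mono) (auto simp: cell_size_def)
    finally show "\<bar>D (l + k) x t - D (l + k) x t' - (D (l + k) (xs j) t - D (l + k) (xs j) t')\<bar> \<le> S * cell_size xs j"
      by simp
  qed simp
  also have "\<dots> = C1 * S * cell_size xs j ^ Suc k" by simp
  also have "\<dots> \<le> C1 * S * h ^ Suc k"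
    using C1_pos S0 by (intro mult_left_mono power_cell_size_le j) auto
  finally show ?thesis .
qed

lemma \<gamma>_diff_bound:
  assumes j: "j < N" and t: "t \<in> {0..T}" "t' \<in> {0..T}" and L: "L \<ge> 0"
    and V: "\<And>x. x \<in> {xs j..xs (Suc j)} \<Longrightarrow>
      \<bar>(D (k + l + 1) x t - D (k + l + 1) x t') - (D (k + l + 1) (xs j) t - D (k + l + 1) (xs j) t')\<bar> \<le> L * cell_size xs j"
  shows "\<bar>cf (Suc l) j t - cf (Suc l) j t'\<bar> \<le> C1 * L * h ^ Suc k"
proof -
  have "\<bar>cf (Suc l) j t - cf (Suc l) j t'\<bar> \<le> C1 * ((L * cell_size xs j) * cell_size xs j ^ k)"
    by (rule cf_diff_bound[OF j order_refl _ t, where a = "D (k + l + 1) (xs j) t - D (k + l + 1) (xs j) t'"])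
      (use V in \<open>auto simp: add.commute\<close>)
  also have "\<dots> = C1 * L * cell_size xs j ^ Suc k" by simp
  also have "\<dots> \<le> C1 * L * h ^ Suc k"
    using C1_pos L by (intro mult_left_mono power_cell_size_le j) auto
  finally show ?thesis .
qed

lemma \<gamma>_diff_Lipschitz:
  assumes j: "j < N" and t: "t \<in> {0..T}" "t' \<in> {0..T}"
  shows "\<bar>cf (Suc l) j t - cf (Suc l) j t'\<bar> \<le> C1 * M * \<bar>t - t'\<bar> * h ^ (k - 1)"
proof -
  have kl: "Suc l + (k - 1) = k + l" using k1 by simp
  have "\<bar>cf (Suc l) j t - cf (Suc l) j t'\<bar> \<le> C1 * ((M * \<bar>t - t'\<bar>) * cell_size xs j ^ (k - 1))"
  proof (rule cf_diff_bound[OF j _ _ t, where a = 0], unfold kl)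
    fix x assume "x \<in> {xs j..xs (Suc j)}"
    then show "\<bar>D (k + l) x t - D (k + l) x t' - 0\<bar> \<le> M * \<bar>t - t'\<bar>"
      using D_Lipschitz_t[of x t' t] cell_Omega[OF j] t by auto
  qed auto
  also have "\<dots> \<le> C1 * ((M * \<bar>t - t'\<bar>) * h ^ (k - 1))"
    using C1_pos M_nonneg by (intro mult_left_mono power_cell_size_le j) auto
  finally show ?thesis by (simp add: mult_ac)
qed

subsection \<open>Distance to the boundary\<close>

definition dist_bd :: "nat \<Rightarrow> real" where
  "dist_bd j = min (xs j) (2 * pi - xs (Suc j))"

text \<open>The value r^(-1/2) for the distance r of the cell to the boundary, with h in place of r
  in the two end cells, whose distance is 0.\<close>

definition weight :: "nat \<Rightarrow> real" where
  "weight j = (if j = 0 \<or> j = N - 1 then h powr (-1/2) else dist_bd j powr (-1/2))"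

lemma dist_bd_pos:
  assumes "0 < j" "j < N - 1"
  shows "dist_bd j > 0"
proof -
  have "xs (Suc 0) \<le> xs j" "xs (Suc j) \<le> xs (N - 1)" using assms by (auto intro: mesh_mono[OF mesh])
  moreover have "xs 0 < xs (Suc 0)" using mesh N0 unfolding mesh_def by blast
  moreover have "xs (N - 1) < xs N"
  proof -
    have "N - 1 < N" "Suc (N - 1) = N" using N0 by auto
    then show ?thesis using mesh unfolding mesh_def by metis
  qed
  ultimately show ?thesis using xs_ends by (simp add: dist_bd_def)
qed

text \<open>A Riemann sum of r^(-1/2), telescoped from the left (\<open>A\<close>) and from the
  right (\<open>B\<close>). The first and the last cell lie between cell j and the boundary, so
  quasi-uniformity bounds h by c times the distance. With sqrt (2 pi) <= 3, each side gives 3 (2 +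
  c) and each end cell 3.\<close>

lemma sum_weight: "(\<Sum>j<N. cell_size xs j * weight j) \<le> 18 + 6 * c"
proof -
  have s3: "sqrt (2 * pi) \<le> 3"
    using pi_less_4 by (intro real_le_lsqrt) auto
  define A where "A j = (2 + c) * (sqrt (xs (Suc j)) - sqrt (xs j))" for j
  define B where "B j = (2 + c) * (sqrt (2 * pi - xs j) - sqrt (2 * pi - xs (Suc j)))" for j
  have xr: "0 \<le> xs j" "xs j \<le> xs (Suc j)" "xs (Suc j) \<le> 2 * pi" if "j < N" for j
    using mesh_mono[OF mesh, of 0 j] mesh_mono[OF mesh, of "Suc j" N] cell_size_pos[OF that] xs_ends that
    by (auto simp: cell_size_def)
  have AB0: "0 \<le> A j" "0 \<le> B j" if "j < N" for j
    using xr[OF that] c_nonneg by (auto simp: A_def B_def)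
  have bdry: "cell_size xs j * h powr (-1/2) \<le> 3" if "j < N" for j
  proof -
    have "cell_size xs j * h powr (-1/2) \<le> h * h powr (-1/2)"
      using cell_size_le[OF that] by (intro mult_right_mono) auto
    also have "\<dots> = sqrt h" using h_pos powr_mult_base[of h "-1/2"] by (simp add: powr_half_sqrt)
    also have "\<dots> \<le> sqrt (2 * pi)" using h_le by simp
    finally show ?thesis using s3 by simp
  qed
  have cellw: "cell_size xs j * weight j \<le> A j + B j + (if j = 0 then 3 else 0) + (if j = N - 1 then 3 else 0)"
    if j: "j < N" for j
  proof (cases "j = 0 \<or> j = N - 1")
    case True
    then show ?thesis using bdry[OF j] AB0[OF j] by (auto simp: weight_def)
  next
    case False
    then have j': "0 < j" "j < N - 1" using j by auto
    have size0: "h \<le> c * xs j"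
    proof -
      have "h \<le> c * cell_size xs 0" by (rule h_quasi[OF N0])
      also have "\<dots> \<le> c * xs j"
        using mesh_mono[OF mesh, of "Suc 0" j] j j' xs_ends c_nonneg by (intro mult_left_mono) (auto simp: cell_size_def)
      finally show ?thesis .
    qed
    have sizeN: "h \<le> c * (2 * pi - xs (Suc j))"
    proof -
      have "h \<le> c * cell_size xs (N - 1)" using N0 by (intro h_quasi) simp
      also have "\<dots> \<le> c * (2 * pi - xs (Suc j))"
        using mesh_mono[OF mesh, of "Suc j" "N - 1"] j j' xs_ends c_nonneg N0 by (intro mult_left_mono) (auto simp: cell_size_def)
      finally show ?thesis .
    qed
    have le: "cell_size xs j \<le> h" by (rule cell_size_le[OF j])
    have pos: "0 < xs j" "0 < 2 * pi - xs (Suc j)" using dist_bd_pos[OF j'] by (auto simp: dist_bd_def)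
    have "dist_bd j powr (-1/2) \<le> xs j powr (-1/2) + (2 * pi - xs (Suc j)) powr (-1/2)"
      unfolding dist_bd_def by (cases "xs j \<le> 2 * pi - xs (Suc j)") (auto simp: min_def)
    then have "cell_size xs j * weight j \<le> cell_size xs j * (xs j powr (-1/2) + (2 * pi - xs (Suc j)) powr (-1/2))"
      using False cell_size_pos[OF j] by (simp add: weight_def)
    also have "\<dots> = (xs (Suc j) - xs j) * xs j powr (-1/2)
        + ((2 * pi - xs j) - (2 * pi - xs (Suc j))) * (2 * pi - xs (Suc j)) powr (-1/2)"
      by (simp add: cell_size_def algebra_simps)
    also have "\<dots> \<le> A j + B j"
      unfolding A_def B_def using pos xr[OF j] c_nonneg size0 sizeN le
      by (intro add_mono sqrt_telescope_bound) (auto simp: cell_size_def algebra_simps)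
    finally show ?thesis using j' by simp
  qed
  have "(\<Sum>j<N. cell_size xs j * weight j)
      \<le> (\<Sum>j<N. A j + B j + (if j = 0 then 3 else 0) + (if j = N - 1 then 3 else 0))"
    by (intro sum_mono cellw) simp
  also have "\<dots> = (\<Sum>j<N. A j) + (\<Sum>j<N. B j) + 6"
    using N0 by (simp add: sum.distrib)
  also have "(\<Sum>j<N. A j) = (2 + c) * sqrt (2 * pi)"
    unfolding A_def sum_distrib_left[symmetric] sum_lessThan_telescope[of "\<lambda>j. sqrt (xs j)"] using xs_ends by simp
  also have "(\<Sum>j<N. B j) = (2 + c) * sqrt (2 * pi)"
    unfolding B_def sum_distrib_left[symmetric] sum_lessThan_telescope'[of "\<lambda>j. sqrt (2 * pi - xs j)"] using xs_ends by simp
  also have "(2 + c) * sqrt (2 * pi) + (2 + c) * sqrt (2 * pi) + 6 \<le> (2 + c) * 3 + (2 + c) * 3 + 6"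
    using s3 c_nonneg by (intro add_mono mult_left_mono) auto
  finally show ?thesis by simp
qed

text \<open>In a cell at distance \<open>r\<close> from the parabolic boundary, the time increments over \<open>\<sigma>\<close> gain a factor
  \<open>\<sigma> / r\<^sup>2\<close> over the global estimates; cells touching the boundary behave like \<open>r = h\<close>.\<close>

lemma increments:
  assumes t: "0 < t" "t \<le> T" and \<sigma>: "0 < \<sigma>" "\<sigma> < t / 2" and j: "j < N"
  shows "\<exists>r>0. r powr (-1/2) \<le> weight j + 2 * t powr (-1/4) \<and>
    \<bar>cf l j (t - \<sigma>) - cf l j t\<bar> \<le> 16 * C1 * M * h ^ Suc k * sqrt (\<sigma> * min 1 (\<sigma> / r\<^sup>2)) \<and>
    \<bar>cf (Suc l) j (t - \<sigma>) - cf (Suc l) j t\<bar> \<le> 256 * C1 * M * h ^ Suc k * min 1 (\<sigma> / r\<^sup>2)"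
proof -
  have tr: "t \<in> {0..T}" "t - \<sigma> \<in> {0..T}" using t \<sigma> by auto
  have hk: "0 \<le> C1 * M * h ^ Suc k" using C1_pos M_nonneg h_pos by simp
  have \<rho>1: "\<bar>cf l j (t - \<sigma>) - cf l j t\<bar> \<le> 16 * C1 * M * h ^ Suc k * sqrt \<sigma>"
  proof -
    have "\<bar>cf l j (t - \<sigma>) - cf l j t\<bar> \<le> C1 * (4 * M * sqrt \<sigma>) * h ^ Suc k"
      by (rule \<rho>_diff_bound[OF j tr(2,1)])
        (use D_Hoelder_t[of _ t "t - \<sigma>"] cell_Omega[OF j] tr \<sigma> in auto)
    also have "\<dots> = 4 * (C1 * M * h ^ Suc k * sqrt \<sigma>)" by simp
    also have "\<dots> \<le> 16 * (C1 * M * h ^ Suc k * sqrt \<sigma>)"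
      using \<sigma> by (intro mult_right_mono mult_nonneg_nonneg[OF hk]) auto
    finally show ?thesis by (simp only: mult_ac)
  qed
  have \<gamma>1: "\<bar>cf (Suc l) j (t - \<sigma>) - cf (Suc l) j t\<bar> \<le> 256 * C1 * M * h ^ Suc k"
  proof -
    have "\<bar>cf (Suc l) j r\<bar> \<le> C1 * M * h ^ Suc k" if "r \<in> {0..T}" for r
    proof -
      have "\<bar>cf (Suc l) j r\<bar> \<le> C1 * M * cell_size xs j ^ Suc k" by (rule cf_bound[OF j that])
      also have "\<dots> \<le> C1 * M * h ^ Suc k"
        using C1_pos M_nonneg by (intro mult_left_mono power_cell_size_le j) auto
      finally show ?thesis .
    qed
    from this[OF tr(1)] this[OF tr(2)] show ?thesis using hk by simp
  qed
  show ?thesis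
  proof (cases "j = 0 \<or> j = N - 1")
    case True
    \<comment> \<open>In an end cell, the powers of h traded for Lipschitz continuity in time appear
      as \<sigma> / h and \<sigma> / h^2, as if the cell were at distance h.\<close>
    have hS: "h ^ Suc k = h * h ^ k" "h ^ Suc k = h\<^sup>2 * h ^ (k - 1)"
      using k1 by (cases k; simp add: power2_eq_square)+
    have \<rho>2: "\<bar>cf l j (t - \<sigma>) - cf l j t\<bar> \<le> 16 * C1 * M * h ^ Suc k * (\<sigma> / h)"
    proof -
      have "\<bar>cf l j (t - \<sigma>) - cf l j t\<bar> \<le> C1 * M * \<bar>(t - \<sigma>) - t\<bar> * h ^ k" by (rule \<rho>_diff_Lipschitz[OF j tr(2,1)])
      also have "\<dots> = C1 * M * h ^ Suc k * (\<sigma> / h)" using h_pos \<sigma> by (simp add: hS(1))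
      also have "\<dots> \<le> 16 * (C1 * M * h ^ Suc k * (\<sigma> / h))"
      proof -
        have "0 \<le> C1 * M * h ^ Suc k * (\<sigma> / h)"
          by (rule mult_nonneg_nonneg[OF hk]) (use \<sigma> h_pos in simp)
        from mult_right_mono[OF _ this, of 1 16] show ?thesis unfolding mult_1_left by simp
      qed
      finally show ?thesis by (simp only: mult_ac)
    qed
    have \<gamma>2: "\<bar>cf (Suc l) j (t - \<sigma>) - cf (Suc l) j t\<bar> \<le> 256 * C1 * M * h ^ Suc k * (\<sigma> / h\<^sup>2)"
    proof -
      have "\<bar>cf (Suc l) j (t - \<sigma>) - cf (Suc l) j t\<bar> \<le> C1 * M * \<bar>(t - \<sigma>) - t\<bar> * h ^ (k - 1)"
        by (rule \<gamma>_diff_Lipschitz[OF j tr(2,1)])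
      also have "\<dots> = C1 * M * h ^ Suc k * (\<sigma> / h\<^sup>2)" using h_pos \<sigma> unfolding hS(2) by simp
      also have "\<dots> \<le> 256 * (C1 * M * h ^ Suc k * (\<sigma> / h\<^sup>2))"
      proof -
        have "0 \<le> C1 * M * h ^ Suc k * (\<sigma> / h\<^sup>2)"
          by (rule mult_nonneg_nonneg[OF hk]) (use \<sigma> h_pos in simp)
        from mult_right_mono[OF _ this, of 1 256] show ?thesis unfolding mult_1_left by simp
      qed
      finally show ?thesis by (simp only: mult_ac)
    qed
    have "sqrt (\<sigma> * (\<sigma> / h\<^sup>2)) = \<sigma> / h" using \<sigma> h_pos by (simp add: real_sqrt_divide real_sqrt_mult)
    then show ?thesis using \<rho>1 \<rho>2 \<gamma>1 \<gamma>2 h_pos True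
      by (intro exI[of _ h]) (auto simp: weight_def min_def simp del: power_Suc)
  next
    case False
    then have j': "0 < j" "j < N - 1" using j by auto
    \<comment> \<open>The second entry keeps the interior estimates clear of the initial time:
      \<sigma> < t/2 and r^2 <= t/2 give r^2 <= t - \<sigma>.\<close>
    define r where "r = min (dist_bd j) (sqrt (t / 2))"
    have r: "r > 0" using dist_bd_pos[OF j'] t by (simp add: r_def)
    have "r\<^sup>2 \<le> (sqrt (t / 2))\<^sup>2" using r by (intro power_mono) (auto simp: r_def)
    then have r2: "r\<^sup>2 \<le> t - \<sigma>" using t \<sigma> by simp
    have xr: "r \<le> x" "x \<le> 2 * pi - r" if "x \<in> {xs j..xs (Suc j)}" for x
      using that by (auto simp: r_def dist_bd_def)
    have rw: "r powr (-1/2) \<le> weight j + 2 * t powr (-1/4)"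
    proof -
      have "r powr (-1/2) \<le> dist_bd j powr (-1/2) + sqrt (t / 2) powr (-1/2)"
        by (cases "dist_bd j \<le> sqrt (t / 2)") (auto simp: r_def min_def)
      moreover have "sqrt (t / 2) powr (-1/2) \<le> 2 * t powr (-1/4)" by (rule sqrt_half_powr_le[OF t(1)])
      moreover have "weight j = dist_bd j powr (-1/2)" unfolding weight_def if_not_P[OF False] by (rule refl)
      ultimately show ?thesis by linarith
    qed
    have \<rho>2: "\<bar>cf l j (t - \<sigma>) - cf l j t\<bar> \<le> 16 * C1 * M * h ^ Suc k * (\<sigma> / r)"
    proof -
      have "\<bar>cf l j (t - \<sigma>) - cf l j t\<bar> \<le> C1 * (16 * M / r * \<sigma>) * h ^ Suc k"
      proof (rule \<rho>_diff_bound[OF j tr(2,1)])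
        fix x assume x: "x \<in> {xs j..xs (Suc j)}"
        show "\<bar>D (k + l + 1) x (t - \<sigma>) - D (k + l + 1) x t\<bar> \<le> 16 * M / r * \<sigma>"
          using D_interior_t[OF r xr[OF x] r2, of t] t \<sigma> by (simp add: abs_minus_commute)
      qed
      then show ?thesis by (simp add: mult_ac)
    qed
    have \<gamma>2: "\<bar>cf (Suc l) j (t - \<sigma>) - cf (Suc l) j t\<bar> \<le> 256 * C1 * M * h ^ Suc k * (\<sigma> / r\<^sup>2)"
    proof -
      have "\<bar>cf (Suc l) j (t - \<sigma>) - cf (Suc l) j t\<bar> \<le> C1 * (256 * M / r\<^sup>2 * \<sigma>) * h ^ Suc k"
      proof (rule \<gamma>_diff_bound[OF j tr(2,1)])
        show "0 \<le> 256 * M / r\<^sup>2 * \<sigma>" using M_nonneg \<sigma> by simp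
        fix x assume x: "x \<in> {xs j..xs (Suc j)}"
        have "\<bar>(D (k + l + 1) x t - D (k + l + 1) x (t - \<sigma>)) - (D (k + l + 1) (xs j) t - D (k + l + 1) (xs j) (t - \<sigma>))\<bar>
            \<le> 256 * M / r\<^sup>2 * \<sigma> * (x - xs j)"
          using D_interior_tx[OF r xr(1)[of "xs j"] _ xr(2)[OF x] r2, of t] x t \<sigma> by simp
        also have "\<dots> \<le> 256 * M / r\<^sup>2 * \<sigma> * cell_size xs j"
          using x M_nonneg \<sigma> by (intro mult_left_mono) (auto simp: cell_size_def)
        finally show "\<bar>D (k + l + 1) x (t - \<sigma>) - D (k + l + 1) x t - (D (k + l + 1) (xs j) (t - \<sigma>) - D (k + l + 1) (xs j) t)\<bar>
            \<le> 256 * M / r\<^sup>2 * \<sigma> * cell_size xs j" by linarith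
      qed
      then show ?thesis by (simp add: mult_ac)
    qed
    have "sqrt (\<sigma> * (\<sigma> / r\<^sup>2)) = \<sigma> / r" using \<sigma> r by (simp add: real_sqrt_divide real_sqrt_mult)
    then show ?thesis using \<rho>1 \<rho>2 \<gamma>1 \<gamma>2 r rw
      by (intro exI[of _ r]) (auto simp: min_def simp del: power_Suc)
  qed
qed

subsection \<open>Error estimates\<close>

text \<open>A normalised basis function contributes an inverse cell size to the square, leaving 2 l
  + 1 powers. Of these, 2 l go into the rate and the last remains in the sum over cells, so that
  \<open>Y\<close> is summed like an integral.\<close>

lemma resid_norm:
  assumes \<sigma>: "\<sigma> = 1 \<or> \<sigma> = -1" and A: "A \<ge> 0" and z: "\<And>j. j < N \<Longrightarrow> (z j)\<^sup>2 \<le> A * (h ^ Suc k)\<^sup>2 * Y j"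
    and v: "\<And>i. i \<in> idx \<Longrightarrow> v i = - (half_size xs (fst i) ^ Suc l * z (fst i) * refint (corr \<sigma> k l * basis i (fst i)))"
  shows "dotp idx v v \<le> corr_const k l * A * (h ^ (k + l + 1))\<^sup>2 * (\<Sum>j<N. cell_size xs j * Y j)"
proof -
  have "(\<Sum>r\<le>k. v (j, r) * v (j, r)) \<le> corr_const k l * A * (h ^ (k + l + 1))\<^sup>2 * (cell_size xs j * Y j)" if j: "j < N" for j
  proof -
    let ?g = "half_size xs j"
    have g: "0 < ?g" by (rule hb_pos[OF j])
    have "v (j, r) * v (j, r) = ?g ^ (2 * l + 1) * (z j)\<^sup>2 * ((2 * real r + 1) / 2 * (refint (corr \<sigma> k l * legendre_poly r))\<^sup>2)"
      if "r \<le> k" for r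
    proof -
      have "(j, r) \<in> idx" using j that by (simp add: idx_def)
      then have "v (j, r) * v (j, r) = (?g ^ Suc l)\<^sup>2 * (z j)\<^sup>2 * (refint (corr \<sigma> k l * legendre_poly r))\<^sup>2 * (nu (j, r) * nu (j, r))"
        by (simp add: v basis_def refint_smult power2_eq_square mult_ac)
      also have "(?g ^ Suc l)\<^sup>2 = ?g ^ (2 * l + 1) * ?g" by (simp add: power2_eq_square power_add mult_2_right mult_ac)
      finally show ?thesis using nu_square[of "(j, r)"] j g by simp
    qed
    then have "(\<Sum>r\<le>k. v (j, r) * v (j, r))
        = ?g ^ (2 * l + 1) * (z j)\<^sup>2 * (\<Sum>r\<le>k. (2 * real r + 1) / 2 * (refint (corr \<sigma> k l * legendre_poly r))\<^sup>2)"
      unfolding sum_distrib_left by (intro sum.cong) auto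
    also have "\<dots> \<le> ?g ^ (2 * l + 1) * (z j)\<^sup>2 * corr_const k l"
      using g by (intro mult_left_mono corr_const_bound \<sigma>) auto
    also have "\<dots> \<le> (h ^ (2 * l) * cell_size xs j) * (A * (h ^ Suc k)\<^sup>2 * Y j) * corr_const k l"
    proof (intro mult_right_mono mult_mono z j corr_const_nonneg)
      have "?g ^ (2 * l) * ?g \<le> h ^ (2 * l) * cell_size xs j"
        using half_size_le[OF j] cell_size_le[OF j] g h_pos by (intro mult_mono power_mono) auto
      then show "?g ^ (2 * l + 1) \<le> h ^ (2 * l) * cell_size xs j" by (simp add: mult.commute)
    qed (use cell_size_pos[OF j] h_pos in auto)
    also have "\<dots> = corr_const k l * A * (h ^ (2 * l) * (h ^ Suc k)\<^sup>2) * (cell_size xs j * Y j)" by (simp add: mult_ac)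
    also have "h ^ (2 * l) * (h ^ Suc k)\<^sup>2 = (h ^ (k + l + 1))\<^sup>2"
      by (simp add: power2_eq_square power_add mult_2_right mult_ac)
    finally show ?thesis .
  qed
  then show ?thesis unfolding dotp_def sum_idx sum_distrib_left by (intro sum_mono) auto
qed

text \<open>Chosen to dominate every residual and increment: 256 is the largest constant in
  \<open>increments\<close>, and 7 bounds the length 2 pi of \<open>Omega\<close>.\<close>

definition K :: real where
  "K = 256 * C1 * sqrt (7 * corr_const k l) * M * h ^ (k + l + 1)"

definition C4 :: real where "C4 = 18 + 6 * c"

lemma K_square: "K\<^sup>2 = corr_const k l * (65536 * 7 * (C1 * M)\<^sup>2) * (h ^ (k + l + 1))\<^sup>2"
  using corr_const_nonneg[of k l] by (simp add: K_def power_mult_distrib)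

lemma K_nonneg: "K \<ge> 0"
  using C1_pos M_nonneg h_pos corr_const_nonneg[of k l] by (simp add: K_def)

lemma sum_cell_size_le: "(\<Sum>j<N. cell_size xs j * a) \<le> 7 * a" if "a \<ge> 0"
proof -
  have "2 * pi \<le> 7" using pi_approx by simp
  then show ?thesis using that unfolding sum_distrib_right[symmetric] sum_cell_size by (intro mult_right_mono)
qed

lemma sum_cell_size_nonneg: "0 \<le> (\<Sum>j<N. cell_size xs j * a)" if "a \<ge> 0"
  using that cell_size_pos by (intro sum_nonneg mult_nonneg_nonneg) (auto intro: less_imp_le)

lemma scale_K:
  assumes "dotp idx v v \<le> corr_const k l * (B * (C1 * M)\<^sup>2) * (h ^ (k + l + 1))\<^sup>2 * y" "B \<le> 65536" "0 \<le> B" "0 \<le> y" "y \<le> 7 * z"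
  shows "dotp idx v v \<le> K\<^sup>2 * z"
proof -
  have "corr_const k l * (B * (C1 * M)\<^sup>2) * (h ^ (k + l + 1))\<^sup>2 * y
      \<le> corr_const k l * (65536 * (C1 * M)\<^sup>2) * (h ^ (k + l + 1))\<^sup>2 * (7 * z)"
    using assms corr_const_nonneg[of k l] by (intro mult_mono mult_left_mono mult_right_mono mult_nonneg_nonneg) auto
  then show ?thesis using assms(1) unfolding K_square by (simp add: mult_ac)
qed

lemma \<gamma>_norm: "t \<in> {0..T} \<Longrightarrow> dotp idx (resid (- s) (Suc l) t) (resid (- s) (Suc l) t) \<le> K\<^sup>2"
proof -
  assume t: "t \<in> {0..T}"
  have "dotp idx (resid (- s) (Suc l) t) (resid (- s) (Suc l) t)
      \<le> corr_const k l * (1 * (C1 * M)\<^sup>2) * (h ^ (k + l + 1))\<^sup>2 * (\<Sum>j<N. cell_size xs j * 1)"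
  proof (rule resid_norm[where z = "\<lambda>j. cf (Suc l) j t" and \<sigma> = "- s"])
    fix j assume j: "j < N"
    have "\<bar>cf (Suc l) j t\<bar> \<le> C1 * M * cell_size xs j ^ Suc k" by (rule cf_bound[OF j t])
    also have "\<dots> \<le> C1 * M * h ^ Suc k"
      using C1_pos M_nonneg by (intro mult_left_mono power_cell_size_le j) auto
    finally have "(cf (Suc l) j t)\<^sup>2 \<le> (C1 * M * h ^ Suc k)\<^sup>2" by (rule power2_le_iff_abs_le[THEN iffD2, rotated]) (use C1_pos M_nonneg h_pos in simp)
    then show "(cf (Suc l) j t)\<^sup>2 \<le> 1 * (C1 * M)\<^sup>2 * (h ^ Suc k)\<^sup>2 * 1" by (simp add: power_mult_distrib)
  qed (use s_cases in \<open>auto simp: resid_def\<close>)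
  from scale_K[OF this, of 1] show ?thesis using sum_cell_size_le[of 1] sum_cell_size_nonneg[of 1] by simp
qed

lemma resid_diff:
  "i \<in> idx \<Longrightarrow> resid \<sigma> n t i - resid \<sigma> n t' i
    = - (half_size xs (fst i) ^ Suc l * (cf n (fst i) t - cf n (fst i) t') * refint (corr \<sigma> k l * basis i (fst i)))"
  by (simp add: resid_def algebra_simps)

lemma \<rho>_norm:
  assumes t: "0 < t" "t \<le> T" and \<tau>: "0 \<le> \<tau>" "\<tau> \<le> t"
  shows "dotp idx (\<lambda>i. resid s l (t - \<tau>) i - resid s l t i) (\<lambda>i. resid s l (t - \<tau>) i - resid s l t i) \<le> K\<^sup>2 * \<tau>"
proof -
  have tr: "t \<in> {0..T}" "t - \<tau> \<in> {0..T}" using t \<tau> by auto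
  have "dotp idx (\<lambda>i. resid s l (t - \<tau>) i - resid s l t i) (\<lambda>i. resid s l (t - \<tau>) i - resid s l t i)
      \<le> corr_const k l * (16 * (C1 * M)\<^sup>2) * (h ^ (k + l + 1))\<^sup>2 * (\<Sum>j<N. cell_size xs j * \<tau>)"
  proof (rule resid_norm[OF s_cases _ _ resid_diff])
    fix j assume j: "j < N"
    have "\<bar>cf l j (t - \<tau>) - cf l j t\<bar> \<le> C1 * (4 * M * sqrt \<tau>) * h ^ Suc k"
      by (rule \<rho>_diff_bound[OF j tr(2,1)])
        (use D_Hoelder_t[of _ t "t - \<tau>"] cell_Omega[OF j] tr \<tau> in auto)
    then have "(cf l j (t - \<tau>) - cf l j t)\<^sup>2 \<le> (C1 * (4 * M * sqrt \<tau>) * h ^ Suc k)\<^sup>2"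
      by (rule power2_le_iff_abs_le[THEN iffD2, rotated]) (use C1_pos M_nonneg h_pos \<tau> in simp)
    then show "(cf l j (t - \<tau>) - cf l j t)\<^sup>2 \<le> 16 * (C1 * M)\<^sup>2 * (h ^ Suc k)\<^sup>2 * \<tau>"
      using \<tau> by (simp add: power_mult_distrib mult_ac)
  qed auto
  from scale_K[OF this _ _ sum_cell_size_nonneg[OF \<tau>(1)] sum_cell_size_le[OF \<tau>(1)]] show ?thesis by simp
qed

text \<open>The premises of \<open>flux_bound\<close> with g = C4 + 14 t^(-1/4): \<open>C4\<close>
  bounds the sum of the weights, and 14 = 7 * 2 comes from the distance to the initial time, which
  is the same for all cells.\<close>

lemma increments_norm:
  assumes t: "0 < t" "t \<le> T" and \<tau>: "0 < \<tau>" "\<tau> < t / 2"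
  shows "dotp idx (\<lambda>i. resid s l (t - \<tau>) i - resid s l t i) (\<lambda>i. resid s l (t - \<tau>) i - resid s l t i)
      \<le> K\<^sup>2 * (C4 + 14 * t powr (-1/4)) * \<tau> * \<tau> powr (1/4)"
    and "dotp idx (\<lambda>i. resid (- s) (Suc l) (t - \<tau>) i - resid (- s) (Suc l) t i) (\<lambda>i. resid (- s) (Suc l) (t - \<tau>) i - resid (- s) (Suc l) t i)
      \<le> K\<^sup>2 * (C4 + 14 * t powr (-1/4)) * \<tau> powr (1/4)"
proof -
  define q where "q = 2 * t powr (-1/4)"
  define G where "G = (\<Sum>j<N. cell_size xs j * (weight j + q))"
  have w0: "0 \<le> weight j + q" for j by (simp add: weight_def q_def)
  have "G = (\<Sum>j<N. cell_size xs j * weight j) + (\<Sum>j<N. cell_size xs j * q)"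
    by (simp add: G_def distrib_left sum.distrib)
  also have "\<dots> \<le> C4 + 7 * q"
    unfolding C4_def by (intro add_mono sum_weight sum_cell_size_le) (simp add: q_def)
  finally have G: "G \<le> C4 + 14 * t powr (-1/4)" by (simp add: q_def)
  have G0: "0 \<le> G" unfolding G_def using cell_size_pos w0 by (intro sum_nonneg mult_nonneg_nonneg) (auto intro: less_imp_le)
  have inc: "(cf l j (t - \<tau>) - cf l j t)\<^sup>2 \<le> 256 * (C1 * M)\<^sup>2 * (h ^ Suc k)\<^sup>2 * (\<tau> * \<tau> powr (1/4) * (weight j + q))"
    "(cf (Suc l) j (t - \<tau>) - cf (Suc l) j t)\<^sup>2 \<le> 65536 * (C1 * M)\<^sup>2 * (h ^ Suc k)\<^sup>2 * (\<tau> powr (1/4) * (weight j + q))"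
    if j: "j < N" for j
  proof -
    obtain r where r: "r > 0" "r powr (-1/2) \<le> weight j + q"
      "\<bar>cf l j (t - \<tau>) - cf l j t\<bar> \<le> 16 * C1 * M * h ^ Suc k * sqrt (\<tau> * min 1 (\<tau> / r\<^sup>2))"
      "\<bar>cf (Suc l) j (t - \<tau>) - cf (Suc l) j t\<bar> \<le> 256 * C1 * M * h ^ Suc k * min 1 (\<tau> / r\<^sup>2)"
      using increments[OF t \<tau> j] unfolding q_def by blast
    define y where "y = min 1 (\<tau> / r\<^sup>2)"
    have y: "0 \<le> y" "y \<le> 1" using \<tau> by (auto simp: y_def)
    have "y \<le> \<tau> powr (1/4) * r powr (-1/2)" unfolding y_def by (rule min_powr_bound[OF \<tau>(1) r(1)])
    also have "\<dots> \<le> \<tau> powr (1/4) * (weight j + q)" using r by (intro mult_left_mono) auto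
    finally have yq: "y \<le> \<tau> powr (1/4) * (weight j + q)" .
    have hk: "0 \<le> C1 * M * h ^ Suc k" using C1_pos M_nonneg h_pos by simp
    have "(cf l j (t - \<tau>) - cf l j t)\<^sup>2 \<le> (16 * C1 * M * h ^ Suc k * sqrt (\<tau> * y))\<^sup>2"
      by (rule power2_le_iff_abs_le[THEN iffD2, rotated, OF r(3)[folded y_def]]) (use C1_pos M_nonneg h_pos y \<tau> in simp)
    also have "\<dots> = 256 * (C1 * M)\<^sup>2 * (h ^ Suc k)\<^sup>2 * (\<tau> * y)"
      using y \<tau> by (simp add: power_mult_distrib mult_ac del: power_Suc)
    also have "\<dots> \<le> 256 * (C1 * M)\<^sup>2 * (h ^ Suc k)\<^sup>2 * (\<tau> * (\<tau> powr (1/4) * (weight j + q)))"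
      using yq \<tau> by (intro mult_left_mono) auto
    finally show "(cf l j (t - \<tau>) - cf l j t)\<^sup>2 \<le> 256 * (C1 * M)\<^sup>2 * (h ^ Suc k)\<^sup>2 * (\<tau> * \<tau> powr (1/4) * (weight j + q))"
      by (simp add: mult.assoc)
    have "(cf (Suc l) j (t - \<tau>) - cf (Suc l) j t)\<^sup>2 \<le> (256 * C1 * M * h ^ Suc k * y)\<^sup>2"
      by (rule power2_le_iff_abs_le[THEN iffD2, rotated, OF r(4)[folded y_def]]) (use C1_pos M_nonneg h_pos y in simp)
    also have "\<dots> = 65536 * (C1 * M)\<^sup>2 * (h ^ Suc k)\<^sup>2 * (y * y)"
      by (simp add: power_mult_distrib power2_eq_square mult_ac del: power_Suc)
    also have "\<dots> \<le> 65536 * (C1 * M)\<^sup>2 * (h ^ Suc k)\<^sup>2 * (\<tau> powr (1/4) * (weight j + q))"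
    proof (intro mult_left_mono)
      have "y * y \<le> y" using y by (simp add: mult_left_le)
      then show "y * y \<le> \<tau> powr (1/4) * (weight j + q)" using yq by linarith
    qed simp
    finally show "(cf (Suc l) j (t - \<tau>) - cf (Suc l) j t)\<^sup>2 \<le> 65536 * (C1 * M)\<^sup>2 * (h ^ Suc k)\<^sup>2 * (\<tau> powr (1/4) * (weight j + q))" .
  qed
  have sG: "(\<Sum>j<N. cell_size xs j * (x * (weight j + q))) = x * G" for x
    by (simp add: G_def sum_distrib_left mult_ac)
  have 1: "dotp idx (\<lambda>i. resid s l (t - \<tau>) i - resid s l t i) (\<lambda>i. resid s l (t - \<tau>) i - resid s l t i)
      \<le> corr_const k l * (256 * (C1 * M)\<^sup>2) * (h ^ (k + l + 1))\<^sup>2 * (\<Sum>j<N. cell_size xs j * (\<tau> * \<tau> powr (1/4) * (weight j + q)))"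
    by (rule resid_norm[OF s_cases _ inc(1) resid_diff]) auto
  have "dotp idx (\<lambda>i. resid s l (t - \<tau>) i - resid s l t i) (\<lambda>i. resid s l (t - \<tau>) i - resid s l t i) \<le> K\<^sup>2 * (\<tau> * \<tau> powr (1/4) * G)"
    by (rule scale_K[OF 1[unfolded sG]]) (use \<tau> G0 in auto)
  also have "\<dots> \<le> K\<^sup>2 * (\<tau> * \<tau> powr (1/4) * (C4 + 14 * t powr (-1/4)))"
    using G \<tau> by (intro mult_left_mono) auto
  finally show "dotp idx (\<lambda>i. resid s l (t - \<tau>) i - resid s l t i) (\<lambda>i. resid s l (t - \<tau>) i - resid s l t i)
      \<le> K\<^sup>2 * (C4 + 14 * t powr (-1/4)) * \<tau> * \<tau> powr (1/4)" by (simp add: mult_ac)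
  have "- s = 1 \<or> - s = -1" using s_cases by auto
  then have 2: "dotp idx (\<lambda>i. resid (- s) (Suc l) (t - \<tau>) i - resid (- s) (Suc l) t i) (\<lambda>i. resid (- s) (Suc l) (t - \<tau>) i - resid (- s) (Suc l) t i)
      \<le> corr_const k l * (65536 * (C1 * M)\<^sup>2) * (h ^ (k + l + 1))\<^sup>2 * (\<Sum>j<N. cell_size xs j * (\<tau> powr (1/4) * (weight j + q)))"
    by (rule resid_norm[OF _ _ inc(2) resid_diff]) auto
  have "dotp idx (\<lambda>i. resid (- s) (Suc l) (t - \<tau>) i - resid (- s) (Suc l) t i) (\<lambda>i. resid (- s) (Suc l) (t - \<tau>) i - resid (- s) (Suc l) t i)
      \<le> K\<^sup>2 * (\<tau> powr (1/4) * G)"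
    by (rule scale_K[OF 2[unfolded sG]]) (use \<tau> G0 in auto)
  also have "\<dots> \<le> K\<^sup>2 * (\<tau> powr (1/4) * (C4 + 14 * t powr (-1/4)))"
    using G \<tau> by (intro mult_left_mono) auto
  finally show "dotp idx (\<lambda>i. resid (- s) (Suc l) (t - \<tau>) i - resid (- s) (Suc l) t i) (\<lambda>i. resid (- s) (Suc l) (t - \<tau>) i - resid (- s) (Suc l) t i)
      \<le> K\<^sup>2 * (C4 + 14 * t powr (-1/4)) * \<tau> powr (1/4)" by (simp add: mult_ac)
qed

lemma error_system:
  assumes t: "0 < t" "t \<le> T"
  shows "mixed_error_system idx dmat (\<lambda>t. coords (Eu t)) (resid s l) (resid s (l + 2)) (\<lambda>t. coords (Eq t))
    (resid (- s) (Suc l)) t K"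
proof
  have l: "l + 2 \<le> k + l + 1" using k1 by simp
  fix i assume i: "i \<in> idx"
  show "continuous_on {0..t} (\<lambda>t. coords (Eu t) i)"
    by (rule continuous_on_subset[OF DERIV_continuous_on[OF coords_Eu_deriv[OF i]]]) (use t in auto)
  show "continuous_on {0..t} (\<lambda>t. resid s l t i)"
    by (rule continuous_on_subset[OF DERIV_continuous_on[OF resid_deriv[OF i l]]]) (use t in auto)
  show "coords (Eu 0) i = 0" by (rule coords_0[OF i])
  fix r assume r: "0 < r" "r < t"
  then have w: "at r within {0..T} = at r" using t by (intro at_within_Icc_at) auto
  show "((\<lambda>t. coords (Eu t) i) has_real_derivative
      - mat_vec idx (transp_mat dmat) (coords (Eq r)) i + resid s (l + 2) r i) (at r)"
    using coords_Eu_deriv[OF i, of r] r t unfolding w by simp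
  show "((\<lambda>t. resid s l t i) has_real_derivative resid s (l + 2) r i) (at r)"
    using resid_deriv[OF i l, of r] r t unfolding w by simp
qed (use t K_nonneg finite_idx coords_Eq \<gamma>_norm \<rho>_norm in auto)

lemma u_error:
  assumes t: "t \<in> {0..T}"
  shows "L2_norm_Omega (\<lambda>x. u_interp fl k l N xs T u x t - uh x t) \<le> 3 * K * (1 + t)"
proof -
  have L2: "L2_norm_Omega (\<lambda>x. u_interp fl k l N xs T u x t - uh x t) = sqrt (dotp idx (coords (Eu t)) (coords (Eu t)))"
  proof (rule L2_norm_coords[OF degree_E(1)])
    fix j x assume "j < N" "x \<in> cell xs j"
    then show "u_interp fl k l N xs T u x t - uh x t = poly (Eu t j) (cellmap xs j x)"
      using u_interp_eq[of j x t] uh_eq[of j t x] t by (simp add: Eu_def)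
  qed
  have "dotp idx (coords (Eu t)) (coords (Eu t)) \<le> (3 * K * (1 + t))\<^sup>2"
  proof (cases "t = 0")
    case True
    then have "dotp idx (coords (Eu t)) (coords (Eu t)) = 0" by (simp add: dotp_def coords_0)
    then show ?thesis by simp
  next
    case False
    then have "0 < t" "t \<le> T" using t by auto
    then have "dotp idx (coords (Eu t)) (coords (Eu t)) \<le> 9 * K\<^sup>2 * t"
      by (rule mixed_error_system.primal_bound[OF error_system])
    also have "\<dots> \<le> 9 * K\<^sup>2 * (1 + t)\<^sup>2"
      using t by (intro mult_left_mono) (auto simp: power2_eq_square algebra_simps)
    finally show ?thesis by (simp add: power_mult_distrib)
  qed
  then show ?thesis unfolding L2 using K_nonneg t by (intro real_le_lsqrt) (auto simp: dotp_nonneg)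
qed

lemma q_error:
  assumes t: "t \<in> {0..T}"
  shows "L2_norm_Omega (\<lambda>x. q_interp fl k l N xs T u x t - qh x t) \<le> sqrt (144 + 8 * C4) * K * (1 + t powr (1/2))"
proof -
  have L2: "L2_norm_Omega (\<lambda>x. q_interp fl k l N xs T u x t - qh x t) = sqrt (dotp idx (coords (Eq t)) (coords (Eq t)))"
  proof (rule L2_norm_coords[OF degree_E(2)])
    fix j x assume "j < N" "x \<in> cell xs j"
    then show "q_interp fl k l N xs T u x t - qh x t = poly (Eq t j) (cellmap xs j x)"
      using q_interp_eq[of j x t] qh_eq[of j t x] t by (simp add: Eq_def)
  qed
  have C4: "C4 \<ge> 0" using c_nonneg by (simp add: C4_def)
  have pw: "(1 + t powr (1/2))\<^sup>2 \<ge> 1 + t"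
    using t by (simp add: power2_sum powr_half_sqrt)
  have "dotp idx (coords (Eq t)) (coords (Eq t)) \<le> (144 + 8 * C4) * K\<^sup>2 * (1 + t powr (1/2))\<^sup>2"
  proof (cases "t = 0")
    case True
    have "coords (Eq t) i = resid (- s) (Suc l) t i" if "i \<in> idx" for i
      using coords_Eq[OF that t] True by (simp add: mat_vec_def coords_0)
    then have "dotp idx (coords (Eq t)) (coords (Eq t)) = dotp idx (resid (- s) (Suc l) t) (resid (- s) (Suc l) t)"
      by (simp add: dotp_def)
    also have "\<dots> \<le> 1 * K\<^sup>2 * 1" using \<gamma>_norm[OF t] by simp
    also have "\<dots> \<le> (144 + 8 * C4) * K\<^sup>2 * (1 + t powr (1/2))\<^sup>2"
      using C4 pw t by (intro mult_mono) auto
    finally show ?thesis .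
  next
    case False
    then have t': "0 < t" "t \<le> T" using t by auto
    interpret E: mixed_error_system idx dmat "\<lambda>t. coords (Eu t)" "resid s l" "resid s (l + 2)" "\<lambda>t. coords (Eq t)"
        "resid (- s) (Suc l)" t K
      by (rule error_system[OF t'])
    \<comment> \<open>The singular power of t cancels here; 144 = 32 + 8 * 14.\<close>
    have "32 + 8 * (C4 + 14 * t powr (-1/4)) * t powr (1/4) = 144 + 8 * C4 * t powr (1/4)"
      using t' by (simp add: algebra_simps flip: powr_add)
    also have "\<dots> \<le> (144 + 8 * C4) * (1 + t)"
    proof -
      have "t powr (1/4) \<le> 1 + t"
      proof (cases "t \<le> 1")
        case True
        then show ?thesis using powr_le1[of "1/4" t] t' by simp
      next
        case False
        then show ?thesis using powr_mono[of "1/4" 1 t] by simp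
      qed
      then have "8 * C4 * t powr (1/4) \<le> 8 * C4 * (1 + t)" using C4 by (intro mult_left_mono) auto
      then show ?thesis using t' by (simp add: algebra_simps)
    qed
    also have "\<dots> \<le> (144 + 8 * C4) * (1 + t powr (1/2))\<^sup>2"
      using pw C4 by (intro mult_left_mono) auto
    finally have le: "32 + 8 * (C4 + 14 * t powr (-1/4)) * t powr (1/4) \<le> (144 + 8 * C4) * (1 + t powr (1/2))\<^sup>2" .
    have "dotp idx (coords (Eq t)) (coords (Eq t)) \<le> K\<^sup>2 * (32 + 8 * (C4 + 14 * t powr (-1/4)) * t powr (1/4))"
      by (rule E.flux_bound) (use increments_norm[OF t'] C4 in \<open>auto simp: E.\<Delta>_def[abs_def]\<close>)
    also have "\<dots> \<le> K\<^sup>2 * ((144 + 8 * C4) * (1 + t powr (1/2))\<^sup>2)"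
      by (rule mult_left_mono[OF le]) simp
    finally show ?thesis by (simp only: mult_ac)
  qed
  also have "\<dots> = (sqrt (144 + 8 * C4) * K * (1 + t powr (1/2)))\<^sup>2"
    using C4 by (simp add: power_mult_distrib)
  finally show ?thesis unfolding L2 using K_nonneg C4 by (intro real_le_lsqrt) (auto simp: dotp_nonneg)
qed

end

section \<open>Choice of the constant and conclusion\<close>

theorem theorem4p1:
  fixes k l :: nat and c :: real
  assumes "1 \<le> l" and "l \<le> k"
  shows "\<exists>C>0. \<forall>(T::real) (N::nat) (xs::nat \<Rightarrow> real) (fl::flux) (b::bc) (u0::real \<Rightarrow> real)
            (u::real \<Rightarrow> real \<Rightarrow> real) (uh::real \<Rightarrow> real \<Rightarrow> real) (qh::real \<Rightarrow> real \<Rightarrow> real).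
          0 < T \<and> mesh N xs \<and> quasi_uniform c N xs \<and>
          heat_solution T u0 u \<and> boundary_condition fl b T u \<and>
          Winf_norm_unif T (k + l + 2) u < \<infinity> \<and>
          ldg_solution k N xs fl b T uh qh \<and>
          (\<forall>j<N. \<forall>x\<in>cell xs j. uh x 0 = u_interp fl k l N xs T u x 0)
          \<longrightarrow>
          (\<forall>t\<in>{0..T}.
             L2_norm_Omega (\<lambda>x. u_interp fl k l N xs T u x t - uh x t)
               \<le> C * (1 + t) * mesh_size N xs ^ (k + l + 1)
                   * real_of_ereal (Winf_norm_unif T (k + l + 2) u) \<and>
             L2_norm_Omega (\<lambda>x. q_interp fl k l N xs T u x t - qh x t)
               \<le> C * (1 + t powr (1 / 2)) * mesh_size N xs ^ (k + l + 1)
                   * real_of_ereal (Winf_norm_unif T (k + l + 2) u))"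
proof -
  obtain C1 where C1: "kap_const k C1"
    using kap_bound[of k] unfolding kap_const_def by blast
  then have C1p: "C1 > 0" by (simp add: kap_const_def)
  define \<kappa> where "\<kappa> = 256 * C1 * sqrt (7 * corr_const k l)"
  \<comment> \<open>The absolute value of \<open>c\<close> is taken because the constant precedes
    the mesh, and c >= 0 follows only once a quasi-uniform mesh is given. The 1 keeps the constant
    positive.\<close>
  define C where "C = 1 + \<kappa> * (3 + sqrt (144 + 8 * (18 + 6 * \<bar>c\<bar>)))"
  have \<kappa>0: "\<kappa> \<ge> 0" using C1p corr_const_nonneg[of k l] by (simp add: \<kappa>_def)
  have C: "C > 0" "3 * \<kappa> \<le> C" "sqrt (144 + 8 * (18 + 6 * \<bar>c\<bar>)) * \<kappa> \<le> C"
    using \<kappa>0 by (auto simp: C_def algebra_simps intro: add_pos_nonneg)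
  show ?thesis
  proof (intro exI[of _ C] conjI allI impI)
    fix T :: real and N :: nat and xs :: "nat \<Rightarrow> real" and fl :: flux and b :: bc and u0 :: "real \<Rightarrow> real"
      and u uh qh :: "real \<Rightarrow> real \<Rightarrow> real"
    assume H: "0 < T \<and> mesh N xs \<and> quasi_uniform c N xs \<and>
          heat_solution T u0 u \<and> boundary_condition fl b T u \<and>
          Winf_norm_unif T (k + l + 2) u < \<infinity> \<and>
          ldg_solution k N xs fl b T uh qh \<and>
          (\<forall>j<N. \<forall>x\<in>cell xs j. uh x 0 = u_interp fl k l N xs T u x 0)"
    define M where "M = real_of_ereal (Winf_norm_unif T (k + l + 2) u)"
    interpret ldg_bounds T M u0 u k l N xs fl b uh qh c C1
    proof
      show "\<exists>g. weak_deriv i (\<lambda>x. u x t) g \<and> (AE x in lebesgue_on Omega. \<bar>g x\<bar> \<le> M)"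
        if "t \<in> {0..T}" "i \<le> k + l + 2" for t i
        unfolding M_def using Winf_norm_imp_weak H that by blast
    qed (use H assms C1 in auto)
    have K: "K = \<kappa> * (M * h ^ (k + l + 1))" by (simp add: K_def \<kappa>_def)
    have Mh: "0 \<le> M * h ^ (k + l + 1)" using M_nonneg h_pos by simp
    show "\<forall>t\<in>{0..T}.
             L2_norm_Omega (\<lambda>x. u_interp fl k l N xs T u x t - uh x t)
               \<le> C * (1 + t) * h ^ (k + l + 1) * real_of_ereal (Winf_norm_unif T (k + l + 2) u) \<and>
             L2_norm_Omega (\<lambda>x. q_interp fl k l N xs T u x t - qh x t)
               \<le> C * (1 + t powr (1 / 2)) * h ^ (k + l + 1) * real_of_ereal (Winf_norm_unif T (k + l + 2) u)"
      unfolding M_def[symmetric]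
    proof (intro ballI conjI)
      fix t assume t: "t \<in> {0..T}"
      have "L2_norm_Omega (\<lambda>x. u_interp fl k l N xs T u x t - uh x t) \<le> 3 * \<kappa> * (M * h ^ (k + l + 1) * (1 + t))"
        using u_error[OF t] unfolding K by (simp add: mult_ac)
      also have "\<dots> \<le> C * (M * h ^ (k + l + 1) * (1 + t))"
        using C(2) t by (intro mult_right_mono mult_nonneg_nonneg[OF Mh]) auto
      finally show "L2_norm_Omega (\<lambda>x. u_interp fl k l N xs T u x t - uh x t) \<le> C * (1 + t) * h ^ (k + l + 1) * M"
        by (simp only: mult_ac)
      have "L2_norm_Omega (\<lambda>x. q_interp fl k l N xs T u x t - qh x t)
          \<le> sqrt (144 + 8 * (18 + 6 * \<bar>c\<bar>)) * \<kappa> * (M * h ^ (k + l + 1) * (1 + t powr (1/2)))"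
        using q_error[OF t] c_nonneg unfolding K C4_def by (simp add: mult_ac)
      also have "\<dots> \<le> C * (M * h ^ (k + l + 1) * (1 + t powr (1/2)))"
        using C(3) by (intro mult_right_mono mult_nonneg_nonneg[OF Mh]) auto
      finally show "L2_norm_Omega (\<lambda>x. q_interp fl k l N xs T u x t - qh x t) \<le> C * (1 + t powr (1 / 2)) * h ^ (k + l + 1) * M"
        by (simp only: mult_ac)
    qed
  qed (rule C(1))
qed

end
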